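(* The following are provable in $\mathsf{ZF}$ (no choice): (1) $\mathsf{EDM_{DM}}$ is equivalent to the axiom of choice $\mathsf{AC}$. (2) $\mathsf{EDM_{BG}}$ implies $\mathsf{EDM_{T}}$, which in turn implies $\mathsf{PC}({>}\aleph_0,{<}\aleph_0,{>}\aleph_0)$. (3) $\mathsf{EDM_{BG}}$ implies $\mathsf{PC}({\nleq}\aleph_0,{<}\aleph_0,{>}\aleph_0)$, which in turn implies $\mathsf{PC}({>}\aleph_0,{<}\aleph_0,{>}\aleph_0)$.
   Context: Work in $\mathsf{ZF}$ without choice. $|X|\le|Y|$ means there is an injection $X\to Y$; $|X|=|Y|$ means there is a bijection; $|X|<|Y|$ (equivalently $|Y|>|X|$) means $|X|\le|Y|$ and $|X|\ne|Y|$. So $|X|\nless\aleph_0$ means $X$ is infinite (not finite), $|X|\nleq\aleph_0$ means $X$ is uncountable (not countable). A graph $G=(V,E)$ is a set $V$ with a set $E$ of unordered pairs of distinct elements of $V$; $I\subseteq V$ is independent if no pair of distinct elements of $I$ is in $E$; a subgraph $(V',E')$ has $V'\subseteq V$, $E'\subseteq E$; it is a clique if any two distinct elements of $V'$ form an edge in $E'$. $\mathsf{EDM_{DM}}$: if $G=(V,E)$ is a graph with $|V|\nleq\aleph_0$, then either $V$ contains an independent set $I$ with $|I|\ge\aleph_0$, or there is a subgraph $G'=(V',E')$ of $G$ which is a clique with $|V'|=|V|$. $\mathsf{EDM_{BG}}$: if $G=(V,E)$ is a graph with $|V|\nleq\aleph_0$, then either $V$ contains an independent set $I$ with $|I|\ge\aleph_0$,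 or there is a subgraph $G'=(V',E')$ of $G$ which is a clique with $|V'|\nleq\aleph_0$. $\mathsf{EDM_{T}}$: if $G=(V,E)$ is a graph with $|V|\nleq\aleph_0$, then either $V$ contains an independent set $I$ with $|I|\nless\aleph_0$, or there is a subgraph $G'=(V',E')$ of $G$ which is a clique with $|V'|\nleq\aleph_0$. $\mathsf{PC}({>}\aleph_0,{<}\aleph_0,{>}\aleph_0)$: every family $X$ of non-empty finite sets with $|X|>\aleph_0$ has a subfamily $Y$ with $|Y|>\aleph_0$ which has a choice function. $\mathsf{PC}({\nleq}\aleph_0,{<}\aleph_0,{>}\aleph_0)$: every family $X$ of non-empty finite sets with $|X|\nleq\aleph_0$ has a subfamily $Y$ with $|Y|>\aleph_0$ which has a choice function. *)

theory Defs
  imports Main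
begin

text \<open>
  HOL proves the axiom of choice, and so does every structure whose Separation or Replacement
  is stated for all HOL predicates. Provability in ZF without choice is therefore
  rendered literally: first-order formulas over membership and equality, a natural deduction
  calculus for classical first-order logic with equality, the axioms of ZF, and
  derivability from them.
\<close>

section \<open>First-order logic\<close>

text \<open>Bound variables are de Bruijn indices; the only terms are variables.\<close>

datatype fm =
    Fls
  | Eq nat nat
  | Mem nat nat
  | Imp fm fm
  | All fm

primrec ren :: "(nat \<Rightarrow> nat) \<Rightarrow> fm \<Rightarrow> fm" where
  "ren f Fls = Fls"
| "ren f (Eq i j) = Eq (f i) (f j)"
| "ren f (Mem i j) = Mem (f i) (f j)"
| "ren f (Imp p q) = Imp (ren f p) (ren f q)"
| "ren f (All p) = All (ren (case_nat 0 (\<lambda>i. Suc (f i))) p)"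

definition inst0 :: "fm \<Rightarrow> nat \<Rightarrow> fm" where
  "inst0 p i = ren (case_nat i (\<lambda>j. j)) p"

primrec fv_below :: "nat \<Rightarrow> fm \<Rightarrow> bool" where
  "fv_below n Fls \<longleftrightarrow> True"
| "fv_below n (Eq i j) \<longleftrightarrow> i < n \<and> j < n"
| "fv_below n (Mem i j) \<longleftrightarrow> i < n \<and> j < n"
| "fv_below n (Imp p q) \<longleftrightarrow> fv_below n p \<and> fv_below n q"
| "fv_below n (All p) \<longleftrightarrow> fv_below (Suc n) p"

text \<open>
  In \<open>AllI\<close> shifting the hypotheses makes the variable 0 fresh for them.
  The set of hypotheses may be infinite, but each derivation uses only finitely many of them.
\<close>

inductive proves :: "fm set \<Rightarrow> fm \<Rightarrow> bool" (infix "\<turnstile>" 50) where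
  Assm: "p \<in> H \<Longrightarrow> H \<turnstile> p"
| ImpI: "insert p H \<turnstile> q \<Longrightarrow> H \<turnstile> Imp p q"
| ImpE: "H \<turnstile> Imp p q \<Longrightarrow> H \<turnstile> p \<Longrightarrow> H \<turnstile> q"
| Contr: "insert (Imp p Fls) H \<turnstile> Fls \<Longrightarrow> H \<turnstile> p"
| AllI: "ren Suc ` H \<turnstile> p \<Longrightarrow> H \<turnstile> All p"
| AllE: "H \<turnstile> All p \<Longrightarrow> H \<turnstile> inst0 p i"
| EqI: "H \<turnstile> Eq i i"
| EqE: "H \<turnstile> Eq i j \<Longrightarrow> H \<turnstile> inst0 p i \<Longrightarrow> H \<turnstile> inst0 p j"


section \<open>Writing formulas with named variables\<close>

text \<open>
  A \<open>form\<close> is a formula placed under \<open>d\<close> quantifiers, as a function of \<open>d\<close>.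
  Its variables are de Bruijn levels: the variable bound by the quantifier at depth \<open>k\<close>
  is \<open>k\<close>, at every depth \<open>d > k\<close> below it, where its de Bruijn index is \<open>d - Suc k\<close>.
  Hence a quantifier can bind a HOL variable, and no shifting is needed when a definition is
  used below further quantifiers. A sentence is a \<open>form\<close> without free variables, applied to \<open>0\<close>.
\<close>

type_synonym var = nat
type_synonym form = "nat \<Rightarrow> fm"

definition fmem :: "var \<Rightarrow> var \<Rightarrow> form" (infix "\<^bold>\<in>" 50) where
  "(x \<^bold>\<in> y) d = Mem (d - Suc x) (d - Suc y)"

definition feq :: "var \<Rightarrow> var \<Rightarrow> form" (infix "\<^bold>=" 50) where
  "(x \<^bold>= y) d = Eq (d - Suc x) (d - Suc y)"

definition fimp :: "form \<Rightarrow> form \<Rightarrow> form" (infixr "\<^bold>\<longrightarrow>" 25) where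
  "(A \<^bold>\<longrightarrow> B) d = Imp (A d) (B d)"

definition fnot :: "form \<Rightarrow> form" ("\<^bold>\<not> _" [40] 40) where
  "(\<^bold>\<not> A) d = Imp (A d) Fls"

definition fall :: "(var \<Rightarrow> form) \<Rightarrow> form" (binder "\<^bold>\<forall>" 10) where
  "(\<^bold>\<forall>x. A x) d = All (A d (Suc d))"

definition fconj :: "form \<Rightarrow> form \<Rightarrow> form" (infixr "\<^bold>\<and>" 35) where
  "(A \<^bold>\<and> B) = (\<^bold>\<not> (A \<^bold>\<longrightarrow> \<^bold>\<not> B))"

definition fdisj :: "form \<Rightarrow> form \<Rightarrow> form" (infixr "\<^bold>\<or>" 30) where
  "(A \<^bold>\<or> B) = (\<^bold>\<not> A \<^bold>\<longrightarrow> B)"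

definition fiff :: "form \<Rightarrow> form \<Rightarrow> form" (infixr "\<^bold>\<longleftrightarrow>" 25) where
  "(A \<^bold>\<longleftrightarrow> B) = ((A \<^bold>\<longrightarrow> B) \<^bold>\<and> (B \<^bold>\<longrightarrow> A))"

definition fex :: "(var \<Rightarrow> form) \<Rightarrow> form" (binder "\<^bold>\<exists>" 10) where
  "(\<^bold>\<exists>x. A x) = (\<^bold>\<not> (\<^bold>\<forall>x. \<^bold>\<not> A x))"

text \<open>The formula \<open>p\<close>, with its free variable \<open>i\<close> standing for \<open>v i\<close>.\<close>

definition schematic :: "fm \<Rightarrow> (nat \<Rightarrow> var) \<Rightarrow> form" where
  "schematic p v d = ren (\<lambda>i. d - Suc (v i)) p"


section \<open>Set-theoretic vocabulary\<close>

definition is_subset :: "var \<Rightarrow> var \<Rightarrow> form" (infix "\<^bold>\<subseteq>" 50) where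
  "x \<^bold>\<subseteq> y = (\<^bold>\<forall>z. z \<^bold>\<in> x \<^bold>\<longrightarrow> z \<^bold>\<in> y)"

definition is_empty :: "var \<Rightarrow> form" where
  "is_empty x = (\<^bold>\<forall>z. \<^bold>\<not> z \<^bold>\<in> x)"

text \<open>\<open>p = {x, y}\<close>\<close>

definition is_upair :: "var \<Rightarrow> var \<Rightarrow> var \<Rightarrow> form" where
  "is_upair p x y = (\<^bold>\<forall>z. z \<^bold>\<in> p \<^bold>\<longleftrightarrow> z \<^bold>= x \<^bold>\<or> z \<^bold>= y)"

text \<open>\<open>p = {{x, x}, {x, y}}\<close>\<close>

definition is_pair :: "var \<Rightarrow> var \<Rightarrow> var \<Rightarrow> form" where
  "is_pair p x y = (\<^bold>\<forall>z. z \<^bold>\<in> p \<^bold>\<longleftrightarrow> is_upair z x x \<^bold>\<or> is_upair z x y)"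

text \<open>\<open>s = x \<union> {x}\<close>\<close>

definition is_succ :: "var \<Rightarrow> var \<Rightarrow> form" where
  "is_succ s x = (\<^bold>\<forall>z. z \<^bold>\<in> s \<^bold>\<longleftrightarrow> z \<^bold>\<in> x \<^bold>\<or> z \<^bold>= x)"

definition is_inductive :: "var \<Rightarrow> form" where
  "is_inductive w = ((\<^bold>\<exists>e. is_empty e \<^bold>\<and> e \<^bold>\<in> w) \<^bold>\<and>
     (\<^bold>\<forall>x. x \<^bold>\<in> w \<^bold>\<longrightarrow> (\<^bold>\<exists>s. is_succ s x \<^bold>\<and> s \<^bold>\<in> w)))"

definition is_omega :: "var \<Rightarrow> form" where
  "is_omega w = (is_inductive w \<^bold>\<and> (\<^bold>\<forall>v. is_inductive v \<^bold>\<longrightarrow> w \<^bold>\<subseteq> v))"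

text \<open>\<open>(x, y) \<in> f\<close>\<close>

definition maps :: "var \<Rightarrow> var \<Rightarrow> var \<Rightarrow> form" where
  "maps f x y = (\<^bold>\<exists>p. is_pair p x y \<^bold>\<and> p \<^bold>\<in> f)"

definition is_fun :: "var \<Rightarrow> var \<Rightarrow> var \<Rightarrow> form" where
  "is_fun f X Y =
     ((\<^bold>\<forall>p. p \<^bold>\<in> f \<^bold>\<longrightarrow> (\<^bold>\<exists>x. \<^bold>\<exists>y. x \<^bold>\<in> X \<^bold>\<and> y \<^bold>\<in> Y \<^bold>\<and> is_pair p x y)) \<^bold>\<and>
      (\<^bold>\<forall>x. x \<^bold>\<in> X \<^bold>\<longrightarrow> (\<^bold>\<exists>y. \<^bold>\<forall>z. maps f x z \<^bold>\<longleftrightarrow> z \<^bold>= y)))"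

definition is_inj :: "var \<Rightarrow> var \<Rightarrow> var \<Rightarrow> form" where
  "is_inj f X Y = (is_fun f X Y \<^bold>\<and>
     (\<^bold>\<forall>x. \<^bold>\<forall>x'. \<^bold>\<forall>y. maps f x y \<^bold>\<and> maps f x' y \<^bold>\<longrightarrow> x \<^bold>= x'))"

definition is_bij :: "var \<Rightarrow> var \<Rightarrow> var \<Rightarrow> form" where
  "is_bij f X Y = (is_inj f X Y \<^bold>\<and> (\<^bold>\<forall>y. y \<^bold>\<in> Y \<^bold>\<longrightarrow> (\<^bold>\<exists>x. maps f x y)))"

definition card_le :: "var \<Rightarrow> var \<Rightarrow> form" where
  "card_le X Y = (\<^bold>\<exists>f. is_inj f X Y)"

definition card_eq :: "var \<Rightarrow> var \<Rightarrow> form" where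
  "card_eq X Y = (\<^bold>\<exists>f. is_bij f X Y)"

definition card_less :: "var \<Rightarrow> var \<Rightarrow> form" where
  "card_less X Y = (card_le X Y \<^bold>\<and> \<^bold>\<not> card_eq X Y)"

definition card_le_aleph0 :: "var \<Rightarrow> form" where
  "card_le_aleph0 X = (\<^bold>\<exists>w. is_omega w \<^bold>\<and> card_le X w)"

definition card_ge_aleph0 :: "var \<Rightarrow> form" where
  "card_ge_aleph0 X = (\<^bold>\<exists>w. is_omega w \<^bold>\<and> card_le w X)"

definition card_less_aleph0 :: "var \<Rightarrow> form" where
  "card_less_aleph0 X = (\<^bold>\<exists>w. is_omega w \<^bold>\<and> card_less X w)"

definition card_greater_aleph0 :: "var \<Rightarrow> form" where
  "card_greater_aleph0 X = (\<^bold>\<exists>w. is_omega w \<^bold>\<and> card_less w X)"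

definition has_choice_function :: "var \<Rightarrow> form" where
  "has_choice_function Y =
     (\<^bold>\<exists>f. \<^bold>\<exists>U. is_fun f Y U \<^bold>\<and> (\<^bold>\<forall>y. \<^bold>\<forall>z. maps f y z \<^bold>\<longrightarrow> z \<^bold>\<in> y))"


section \<open>The axioms of ZF\<close>

definition Extensionality :: form where
  "Extensionality = (\<^bold>\<forall>x. \<^bold>\<forall>y. (\<^bold>\<forall>z. z \<^bold>\<in> x \<^bold>\<longleftrightarrow> z \<^bold>\<in> y) \<^bold>\<longrightarrow> x \<^bold>= y)"

definition Foundation :: form where
  "Foundation = (\<^bold>\<forall>x. \<^bold>\<not> is_empty x \<^bold>\<longrightarrow>
     (\<^bold>\<exists>y. y \<^bold>\<in> x \<^bold>\<and> \<^bold>\<not> (\<^bold>\<exists>z. z \<^bold>\<in> x \<^bold>\<and> z \<^bold>\<in> y)))"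

definition Pairing :: form where
  "Pairing = (\<^bold>\<forall>x. \<^bold>\<forall>y. \<^bold>\<exists>p. is_upair p x y)"

definition Union_axiom :: form where
  "Union_axiom = (\<^bold>\<forall>x. \<^bold>\<exists>u. \<^bold>\<forall>z. z \<^bold>\<in> u \<^bold>\<longleftrightarrow> (\<^bold>\<exists>y. y \<^bold>\<in> x \<^bold>\<and> z \<^bold>\<in> y))"

definition Power_set :: form where
  "Power_set = (\<^bold>\<forall>x. \<^bold>\<exists>p. \<^bold>\<forall>z. z \<^bold>\<in> p \<^bold>\<longleftrightarrow> z \<^bold>\<subseteq> x)"

definition Infinity :: form where
  "Infinity = (\<^bold>\<exists>w. is_inductive w)"

text \<open>
  In the schemas the parameters are the variables \<open>0, \<dots>, n - 1\<close>, bound by the \<open>n\<close> outermost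
  quantifiers. The free variables of \<open>p\<close> are, in this order, \<open>x\<close> (in Replacement: \<open>x\<close>, \<open>y\<close>)
  and the parameters; the bound on them imposed in \<open>ZF\<close> makes the instances sentences and
  keeps \<open>p\<close> from referring to \<open>b\<close>.
\<close>

definition Separation :: "nat \<Rightarrow> fm \<Rightarrow> fm" where
  "Separation n p = (All ^^ n)
     ((\<^bold>\<forall>a. \<^bold>\<exists>b. \<^bold>\<forall>x. x \<^bold>\<in> b \<^bold>\<longleftrightarrow> x \<^bold>\<in> a \<^bold>\<and> schematic p (case_nat x (\<lambda>i. i))) n)"

definition Replacement :: "nat \<Rightarrow> fm \<Rightarrow> fm" where
  "Replacement n p = (let P = (\<lambda>x y. schematic p (case_nat x (case_nat y (\<lambda>i. i)))) in
     (All ^^ n)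
     ((\<^bold>\<forall>a. (\<^bold>\<forall>x. \<^bold>\<forall>y. \<^bold>\<forall>z. x \<^bold>\<in> a \<^bold>\<and> P x y \<^bold>\<and> P x z \<^bold>\<longrightarrow> y \<^bold>= z) \<^bold>\<longrightarrow>
        (\<^bold>\<exists>b. \<^bold>\<forall>y. y \<^bold>\<in> b \<^bold>\<longleftrightarrow> (\<^bold>\<exists>x. x \<^bold>\<in> a \<^bold>\<and> P x y))) n))"

definition ZF :: "fm set" where
  "ZF = {Extensionality 0, Foundation 0, Pairing 0, Union_axiom 0, Power_set 0, Infinity 0}
     \<union> {Separation n p | n p. fv_below (Suc n) p}
     \<union> {Replacement n p | n p. fv_below (Suc (Suc n)) p}"

definition ZF_proves :: "form \<Rightarrow> bool" where
  "ZF_proves A \<longleftrightarrow> ZF \<turnstile> A 0"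


section \<open>Choice principles and the Erdos-Dushnik-Miller statements\<close>

definition AC :: form where
  "AC = (\<^bold>\<forall>X. (\<^bold>\<forall>x. x \<^bold>\<in> X \<^bold>\<longrightarrow> \<^bold>\<not> is_empty x) \<^bold>\<longrightarrow> has_choice_function X)"

definition is_graph :: "var \<Rightarrow> var \<Rightarrow> form" where
  "is_graph V E = (\<^bold>\<forall>e. e \<^bold>\<in> E \<^bold>\<longrightarrow>
     (\<^bold>\<exists>x. \<^bold>\<exists>y. x \<^bold>\<in> V \<^bold>\<and> y \<^bold>\<in> V \<^bold>\<and> \<^bold>\<not> x \<^bold>= y \<^bold>\<and> is_upair e x y))"

definition adjacent :: "var \<Rightarrow> var \<Rightarrow> var \<Rightarrow> form" where
  "adjacent E x y = (\<^bold>\<exists>e. is_upair e x y \<^bold>\<and> e \<^bold>\<in> E)"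

definition is_independent :: "var \<Rightarrow> var \<Rightarrow> var \<Rightarrow> form" where
  "is_independent V E I = (I \<^bold>\<subseteq> V \<^bold>\<and>
     (\<^bold>\<forall>x. \<^bold>\<forall>y. x \<^bold>\<in> I \<^bold>\<and> y \<^bold>\<in> I \<^bold>\<and> \<^bold>\<not> x \<^bold>= y \<^bold>\<longrightarrow> \<^bold>\<not> adjacent E x y))"

definition is_subgraph :: "var \<Rightarrow> var \<Rightarrow> var \<Rightarrow> var \<Rightarrow> form" where
  "is_subgraph V' E' V E = (is_graph V' E' \<^bold>\<and> V' \<^bold>\<subseteq> V \<^bold>\<and> E' \<^bold>\<subseteq> E)"

definition is_clique :: "var \<Rightarrow> var \<Rightarrow> form" where
  "is_clique V' E' =
     (\<^bold>\<forall>x. \<^bold>\<forall>y. x \<^bold>\<in> V' \<^bold>\<and> y \<^bold>\<in> V' \<^bold>\<and> \<^bold>\<not> x \<^bold>= y \<^bold>\<longrightarrow> adjacent E' x y)"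

definition EDM_DM :: form where
  "EDM_DM = (\<^bold>\<forall>V. \<^bold>\<forall>E. is_graph V E \<^bold>\<and> \<^bold>\<not> card_le_aleph0 V \<^bold>\<longrightarrow>
     (\<^bold>\<exists>I. is_independent V E I \<^bold>\<and> card_ge_aleph0 I) \<^bold>\<or>
     (\<^bold>\<exists>V'. \<^bold>\<exists>E'. is_subgraph V' E' V E \<^bold>\<and> is_clique V' E' \<^bold>\<and> card_eq V' V))"

definition EDM_BG :: form where
  "EDM_BG = (\<^bold>\<forall>V. \<^bold>\<forall>E. is_graph V E \<^bold>\<and> \<^bold>\<not> card_le_aleph0 V \<^bold>\<longrightarrow>
     (\<^bold>\<exists>I. is_independent V E I \<^bold>\<and> card_ge_aleph0 I) \<^bold>\<or>
     (\<^bold>\<exists>V'. \<^bold>\<exists>E'. is_subgraph V' E' V E \<^bold>\<and> is_clique V' E' \<^bold>\<and> \<^bold>\<not> card_le_aleph0 V'))"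

definition EDM_T :: form where
  "EDM_T = (\<^bold>\<forall>V. \<^bold>\<forall>E. is_graph V E \<^bold>\<and> \<^bold>\<not> card_le_aleph0 V \<^bold>\<longrightarrow>
     (\<^bold>\<exists>I. is_independent V E I \<^bold>\<and> \<^bold>\<not> card_less_aleph0 I) \<^bold>\<or>
     (\<^bold>\<exists>V'. \<^bold>\<exists>E'. is_subgraph V' E' V E \<^bold>\<and> is_clique V' E' \<^bold>\<and> \<^bold>\<not> card_le_aleph0 V'))"

definition nonempty_finite_family :: "var \<Rightarrow> form" where
  "nonempty_finite_family X = (\<^bold>\<forall>x. x \<^bold>\<in> X \<^bold>\<longrightarrow> \<^bold>\<not> is_empty x \<^bold>\<and> card_less_aleph0 x)"

definition PC_greater :: form where
  "PC_greater = (\<^bold>\<forall>X. nonempty_finite_family X \<^bold>\<and> card_greater_aleph0 X \<^bold>\<longrightarrow>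
     (\<^bold>\<exists>Y. Y \<^bold>\<subseteq> X \<^bold>\<and> card_greater_aleph0 Y \<^bold>\<and> has_choice_function Y))"

definition PC_not_le :: form where
  "PC_not_le = (\<^bold>\<forall>X. nonempty_finite_family X \<^bold>\<and> \<^bold>\<not> card_le_aleph0 X \<^bold>\<longrightarrow>
     (\<^bold>\<exists>Y. Y \<^bold>\<subseteq> X \<^bold>\<and> card_greater_aleph0 Y \<^bold>\<and> has_choice_function Y))"

end

theory Submission
  imports Defs "HOL-Library.Countable_Set"
begin

text \<open>
  The calculus is complete: a sentence not derivable from \<open>ZF\<close> fails in a model of \<open>ZF\<close> whose
  universe is, up to isomorphism, the type \<open>nat\<close>. Hence it suffices to argue in an arbitrary model,
  where Separation and Replacement are available only for predicates definable with parameters.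

  In a model, the vertices \<open>(x, y)\<close> with \<open>y \<in> x \<in> X\<close>, joined when their first components differ,
  form a graph whose independent sets are finite and whose cliques are choice functions of
  subfamilies of \<open>X\<close>. Applied to a countable subfamily \<open>C\<close> of \<open>X\<close>, this shows that \<open>C\<close> has a choice
  function, which makes the subfamily obtained from \<open>X\<close> Dedekind infinite. A graph without edges
  shows that under \<open>EDM_BG\<close> every uncountable set is Dedekind infinite. Two disjoint cliques, on a
  set and on a Hartogs ordinal of it, turn \<open>EDM_DM\<close> into a well-ordering of the set.

  Under choice, let \<open>k\<close> be the cardinality of the vertex set, and suppose that there is no infinite
  independent set. Some set \<open>A\<close> of size \<open>k\<close> has fewer than \<open>k\<close> non-neighbours of \<open>x\<close> in \<open>A\<close> for each
  \<open>x \<in> A\<close>. If \<open>k\<close> is regular, or if \<open>k\<close> of these numbers have a common bound below \<open>k\<close>, a maximal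
  clique has size \<open>k\<close>. Otherwise a cofinal sequence of smaller cliques, given by induction on \<open>k\<close>,
  each avoiding the non-neighbours of the earlier ones, has a union of size \<open>k\<close>.
\<close>

section \<open>Completeness of the calculus\<close>

text \<open>A hypothesis in HOL cannot range over models on all types, so one type has to host
  enough of them; formulas are countable, which makes \<open>nat\<close> sufficient once finite
  quotients are excluded. The choice principle of HOL does no harm inside a model, because it yields
  only HOL functions: a set, function or injection counts only if it is an element of the model, and
  such elements come only from the axioms. This is why nearly every construction carries a goal
  \<open>Def\<close> or \<open>DefF\<close>, and why inductions over the ordinals and natural
  numbers of a model are restricted to definable predicates. In the choice half the obstacle is
  singular \<open>k\<close>: fewer than \<open>k\<close> vertices may have non-neighbourhoods whose
  sizes, each below \<open>k\<close>, are unbounded, so that together they fill a set of size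
  \<open>k\<close>. Cliques are therefore built inside sets of vertices with a common bound on the
  number of non-neighbours, and the cofinality of \<open>k\<close> controls how such bounds
  accumulate.\<close>

lemma ren_ren: "ren f (ren g p) = ren (\<lambda>i. f (g i)) p"
proof (induction p arbitrary: f g)
  case (All p)
  have "(\<lambda>i. case_nat 0 (\<lambda>i. Suc (f i)) (case_nat 0 (\<lambda>i. Suc (g i)) i))
      = case_nat 0 (\<lambda>i. Suc (f (g i)))"
    by (auto split: nat.splits)
  then show ?case by (simp add: All)
qed auto

lemma ren_cong: "fv_below n p \<Longrightarrow> (\<And>i. i < n \<Longrightarrow> f i = g i) \<Longrightarrow> ren f p = ren g p"
proof (induction p arbitrary: n f g)
  case (Imp p q)
  then show ?case by (metis fv_below.simps(4) ren.simps(4))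
next
  case (All p)
  have "ren (case_nat 0 (\<lambda>i. Suc (f i))) p = ren (case_nat 0 (\<lambda>i. Suc (g i))) p"
    using All.prems by (intro All.IH[of "Suc n"]) (auto split: nat.splits)
  then show ?case by simp
qed auto

lemma ren_id: "ren (\<lambda>i. i) p = p"
proof (induction p)
  case (All p)
  have "case_nat 0 Suc = (\<lambda>i. i)" by (auto split: nat.splits)
  then show ?case by (simp add: All)
qed auto

lemma fv_below_mono: "fv_below n p \<Longrightarrow> n \<le> m \<Longrightarrow> fv_below m p"
proof (induction p arbitrary: n m)
  case (Imp p q)
  then show ?case by (metis fv_below.simps(4))
next
  case (All p)
  then show ?case by (metis fv_below.simps(5) Suc_le_mono)
qed auto

lemma fv_below_exists: "\<exists>n. fv_below n p"
proof (induction p)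
  case (Eq i j) show ?case by (auto intro: exI[of _ "Suc (max i j)"])
next
  case (Mem i j) show ?case by (auto intro: exI[of _ "Suc (max i j)"])
next
  case (Imp p q)
  then obtain m n where "fv_below m p" "fv_below n q" by auto
  then have "fv_below (max m n) (Imp p q)" by (auto intro: fv_below_mono)
  then show ?case by blast
next
  case (All p)
  then show ?case by (auto intro: fv_below_mono[OF _ le_SucI])
qed auto

lemma fv_below_finite: "finite S \<Longrightarrow> \<exists>n. \<forall>p\<in>S. fv_below n p"
proof (induction rule: finite_induct)
  case (insert p S)
  then obtain n m where "\<forall>p\<in>S. fv_below n p" "fv_below m p" using fv_below_exists by blast
  then have "\<forall>q\<in>insert p S. fv_below (max m n) q" by (auto intro: fv_below_mono)
  then show ?case by blast
qed auto

lemma ren_inst0: "ren f (inst0 p i) = inst0 (ren (case_nat 0 (\<lambda>i. Suc (f i))) p) (f i)"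
proof -
  have "(\<lambda>j. f (case_nat i (\<lambda>j. j) j))
      = (\<lambda>j. case_nat (f i) (\<lambda>j. j) (case_nat 0 (\<lambda>i. Suc (f i)) j))"
    by (auto split: nat.splits)
  then show ?thesis by (simp add: inst0_def ren_ren)
qed

section \<open>Admissible rules of the calculus\<close>

lemma weaken: "H \<turnstile> p \<Longrightarrow> H \<subseteq> H' \<Longrightarrow> H' \<turnstile> p"
proof (induction arbitrary: H' rule: proves.induct)
  case (ImpI p H q)
  then show ?case by (meson insert_mono proves.ImpI)
next
  case (Contr p H)
  then show ?case by (meson insert_mono proves.Contr)
next
  case (AllI H p)
  then show ?case by (meson image_mono proves.AllI)
next
  case (EqE H i j p)
  then show ?case by (intro proves.EqE[of _ i j p]) auto
next
  case (ImpE H p q)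
  then show ?case by (intro proves.ImpE[of _ p q]) auto
qed (auto intro: proves.Assm proves.AllE proves.EqI)

text \<open>Under a quantifier the renaming is lifted to fix 0, and a lifted renaming commutes with
  the shift \<open>ren Suc\<close> of the hypotheses; hence the induction is over all
  \<open>f\<close>.\<close>

lemma proves_ren: "H \<turnstile> p \<Longrightarrow> ren f ` H \<turnstile> ren f p"
proof (induction arbitrary: f rule: proves.induct)
  case (AllI H p)
  have "ren (case_nat 0 (\<lambda>i. Suc (f i))) ` ren Suc ` H = ren Suc ` ren f ` H"
    by (simp add: image_image ren_ren)
  then show ?case using AllI.IH[of "case_nat 0 (\<lambda>i. Suc (f i))"] by (simp add: proves.AllI)
next
  case (AllE H p i)
  then show ?case using proves.AllE by (simp add: ren_inst0)
next
  case (EqE H i j p)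
  then show ?case
    by (simp add: ren_inst0) (rule proves.EqE[of _ "f i" "f j"], auto)
next
  case (EqI H i)
  then show ?case by (simp add: proves.EqI)
next
  case (ImpE H p q)
  then show ?case using proves.ImpE by fastforce
next
  case (Contr p H)
  then show ?case using proves.Contr by simp
qed (auto intro: proves.Assm proves.ImpI)

lemma proves_finite: "H \<turnstile> p \<Longrightarrow> \<exists>F\<subseteq>H. finite F \<and> F \<turnstile> p"
proof (induction rule: proves.induct)
  case (Assm p H)
  then show ?case by (intro exI[of _ "{p}"]) (auto intro: proves.Assm)
next
  case (ImpI p H q)
  obtain F where F: "F \<subseteq> insert p H" "finite F" "F \<turnstile> q"
    using ImpI.IH by blast
  then have "F - {p} \<turnstile> Imp p q" by (intro proves.ImpI weaken[OF F(3)]) auto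
  then show ?case using F by (intro exI[of _ "F - {p}"]) auto
next
  case (Contr p H)
  obtain F where F: "F \<subseteq> insert (Imp p Fls) H" "finite F" "F \<turnstile> Fls"
    using Contr.IH by blast
  have "F - {Imp p Fls} \<turnstile> p" by (rule proves.Contr, rule weaken[OF F(3)]) auto
  then show ?case using F by (intro exI[of _ "F - {Imp p Fls}"]) auto
next
  case (ImpE H p q)
  obtain F G where FG: "F \<subseteq> H" "finite F" "F \<turnstile> Imp p q" "G \<subseteq> H" "finite G" "G \<turnstile> p"
    using ImpE.IH by blast
  have "F \<union> G \<turnstile> Imp p q" "F \<union> G \<turnstile> p"
    by (auto intro: weaken[OF FG(3)] weaken[OF FG(6)])
  then have "F \<union> G \<turnstile> q" by (rule proves.ImpE)
  then show ?case using FG by (intro exI[of _ "F \<union> G"]) simp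
next
  case (AllI H p)
  obtain F where F: "F \<subseteq> ren Suc ` H" "finite F" "F \<turnstile> p"
    using AllI.IH by blast
  then obtain G where "G \<subseteq> H" "finite G" "F = ren Suc ` G" by (meson finite_subset_image)
  then show ?case using F proves.AllI by blast
next
  case (AllE H p i)
  then show ?case using proves.AllE[of _ p i] by blast
next
  case (EqI H i)
  show ?case by (intro exI[of _ "{}"]) (auto intro: proves.EqI)
next
  case (EqE H i j p)
  obtain F G where FG: "F \<subseteq> H" "finite F" "F \<turnstile> Eq i j" "G \<subseteq> H" "finite G" "G \<turnstile> inst0 p i"
    using EqE.IH by blast
  have "F \<union> G \<turnstile> Eq i j" "F \<union> G \<turnstile> inst0 p i"
    by (auto intro: weaken[OF FG(3)] weaken[OF FG(6)])
  then have "F \<union> G \<turnstile> inst0 p j" by (rule proves.EqE)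
  then show ?case using FG by (intro exI[of _ "F \<union> G"]) simp
qed

text \<open>The eigenvariable rule in its usual form. The renaming \<open>f\<close> moves
  \<open>k\<close> to 0 and shifts all other variables: on formulas below \<open>k\<close> it is the
  shift of \<open>AllI\<close>, and it undoes the instantiation of \<open>q\<close> at
  \<open>k\<close>.\<close>

lemma AllI_fresh:
  assumes H: "H \<turnstile> inst0 q k" and fr: "\<And>p. p \<in> H \<Longrightarrow> fv_below k p" and q: "fv_below (Suc k) q"
  shows "H \<turnstile> All q"
proof -
  define f where "f = (\<lambda>i. if i = k then 0 else Suc i)"
  have 1: "ren f ` H = ren Suc ` H"
    by (intro image_cong refl ren_cong[OF fr]) (auto simp: f_def)
  have "ren f (inst0 q k) = ren (\<lambda>i. i) q"
    unfolding inst0_def ren_ren by (rule ren_cong[OF q]) (auto simp: f_def split: nat.splits)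
  then show ?thesis using proves_ren[OF H, of f] 1 by (auto intro: AllI simp: ren_id)
qed

section \<open>Maximal consistent sets with witnesses\<close>

definition consistent :: "fm set \<Rightarrow> bool" where
  "consistent H \<longleftrightarrow> \<not> H \<turnstile> Fls"

text \<open>Refuting the counterexample at \<open>k\<close> would prove \<open>q\<close> for a
  variable fresh for \<open>H\<close>, hence \<open>All q\<close>, which \<open>H\<close>
  denies.\<close>

lemma consistent_witness:
  assumes "consistent H" "Imp (All q) Fls \<in> H" "\<And>p. p \<in> H \<Longrightarrow> fv_below k p"
  shows "consistent (insert (Imp (inst0 q k) Fls) H)"
  unfolding consistent_def
proof
  assume "insert (Imp (inst0 q k) Fls) H \<turnstile> Fls"
  then have "H \<turnstile> inst0 q k" by (rule Contr)
  moreover have "fv_below (Suc k) q" using assms(3)[OF assms(2)] by simp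
  ultimately have "H \<turnstile> All q" using assms(3) AllI_fresh by blast
  then have "H \<turnstile> Fls" using assms(2) Assm ImpE by blast
  then show False using assms(1) by (simp add: consistent_def)
qed

instance fm :: countable by countable_datatype

definition fresh :: "fm set \<Rightarrow> nat" where
  "fresh H = (SOME k. \<forall>p\<in>H. fv_below k p)"

definition witness :: "fm set \<Rightarrow> fm \<Rightarrow> fm set" where
  "witness H p = (if \<exists>q. p = Imp (All q) Fls
     then insert (Imp (inst0 (THE q. p = Imp (All q) Fls) (fresh H)) Fls) H else H)"

lemma witness_subset: "\<exists>r. witness T p \<subseteq> insert r T"
  unfolding witness_def by (cases "\<exists>q. p = Imp (All q) Fls") auto

text \<open>Lindenbaum's enumeration with Henkin's witnesses added on the spot: when a negated
  universal formula enters, so does a counterexample at a variable fresh for the set reached so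
  far.\<close>

primrec extend :: "fm set \<Rightarrow> nat \<Rightarrow> fm set" where
  "extend H 0 = H"
| "extend H (Suc n) = (let T = insert (from_nat n) (extend H n) in
     if consistent T then witness T (from_nat n) else extend H n)"

definition henkin :: "fm set \<Rightarrow> bool" where
  "henkin U \<longleftrightarrow> consistent U \<and> (\<forall>p. p \<notin> U \<longrightarrow> \<not> consistent (insert p U)) \<and>
     (\<forall>q. Imp (All q) Fls \<in> U \<longrightarrow> (\<exists>k. Imp (inst0 q k) Fls \<in> U))"

lemma fresh: "\<exists>k. \<forall>p\<in>H. fv_below k p \<Longrightarrow> p \<in> H \<Longrightarrow> fv_below (fresh H) p"
  unfolding fresh_def by (rule someI2_ex) auto

text \<open>Variables double as witnessing constants, so a fresh one must exist at every stage. It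
  does because \<open>H\<close> consists of sentences and only finitely many formulas have been
  added before any given stage.\<close>

lemma henkin_extension:
  assumes con: "consistent H" and sent: "\<And>p. p \<in> H \<Longrightarrow> fv_below 0 p"
  obtains U where "H \<subseteq> U" "henkin U"
proof -
  let ?E = "extend H"
  have bdd: "\<exists>k. \<forall>p\<in>?E n. fv_below k p" for n
  proof -
    have "\<exists>F. finite F \<and> ?E n \<subseteq> H \<union> F"
    proof (induction n)
      case (Suc n)
      then obtain F where F: "finite F" "?E n \<subseteq> H \<union> F" by auto
      obtain r where "witness (insert (from_nat n) (?E n)) (from_nat n)
          \<subseteq> insert r (insert (from_nat n) (?E n))"
        using witness_subset by blast
      then have "?E (Suc n) \<subseteq> H \<union> insert r (insert (from_nat n) F)"
        using F(2) by (auto simp: Let_def)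
      then show ?case using F(1) by (meson finite_insert)
    qed auto
    then obtain F where F: "finite F" "?E n \<subseteq> H \<union> F" by auto
    then obtain k where "\<forall>p\<in>F. fv_below k p" using fv_below_finite by blast
    then show ?thesis using F sent by (blast intro: fv_below_mono)
  qed
  have bdd': "\<exists>k. \<forall>p\<in>insert q (?E n). fv_below k p" for n q
  proof -
    obtain k m where "\<forall>p\<in>?E n. fv_below k p" "fv_below m q" using bdd fv_below_exists by blast
    then have "\<forall>p\<in>insert q (?E n). fv_below (max k m) p" by (auto intro: fv_below_mono)
    then show ?thesis by blast
  qed
  have cons: "consistent (?E n)" for n
  proof (induction n)
    case (Suc n)
    let ?T = "insert (from_nat n) (?E n)"
    have "consistent (witness ?T (from_nat n))" if T: "consistent ?T"
    proof (cases "\<exists>q. (from_nat n :: fm) = Imp (All q) Fls")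
      case True
      then obtain q where q: "(from_nat n :: fm) = Imp (All q) Fls" by auto
      show ?thesis
        using consistent_witness[OF T, of q "fresh ?T"] fresh[OF bdd']
        by (auto simp: witness_def q)
    qed (auto simp: witness_def T)
    then show ?case using Suc by (auto simp: Let_def)
  qed (simp add: con)
  have "?E n \<subseteq> ?E (Suc n)" for n by (auto simp: Let_def witness_def)
  then have mono: "m \<le> n \<Longrightarrow> ?E m \<subseteq> ?E n" for m n by (rule lift_Suc_mono_le)
  define U where "U = (\<Union>n. ?E n)"
  have conU: "consistent U" unfolding consistent_def
  proof
    assume "U \<turnstile> Fls"
    then obtain F where F: "F \<subseteq> U" "finite F" "F \<turnstile> Fls" using proves_finite by blast
    have "\<exists>n. F \<subseteq> ?E n" using F(2,1)
    proof (induction rule: finite_induct)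
      case (insert x F)
      then obtain m n where "F \<subseteq> ?E n" "x \<in> ?E m" by (auto simp: U_def)
      then have "insert x F \<subseteq> ?E (max m n)" using mono[of m "max m n"] mono[of n "max m n"] by auto
      then show ?case by blast
    qed auto
    then show False using F(3) cons weaken by (auto simp: consistent_def)
  qed
  have sub: "?E n \<subseteq> U" for n by (auto simp: U_def)
  have con_sub: "consistent T" if "consistent T'" "T \<subseteq> T'" for T T'
    using that weaken by (auto simp: consistent_def)
  \<comment> \<open>A formula \<open>p\<close> is examined at stage \<open>to_nat p\<close>; if it
    is consistent with the limit \<open>U\<close>, it is consistent with that stage and enters
    there.\<close>
  have step: "witness (insert p (?E n)) p \<subseteq> ?E (Suc n)"
    if "n = to_nat p" "consistent (insert p U)" for p n
    using con_sub[OF that(2), of "insert p (?E n)"] that(1) sub[of n] by (auto simp: Let_def)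
  have mem: "p \<in> U" if "consistent (insert p U)" for p
    using step[OF refl that] sub[of "Suc (to_nat p)"] by (auto simp: witness_def split: if_splits)
  have wit: "\<exists>k. Imp (inst0 q k) Fls \<in> U" if "Imp (All q) Fls \<in> U" for q
    using step[OF refl, of "Imp (All q) Fls"] sub[of "Suc (to_nat (Imp (All q) Fls))"] conU that
    by (force simp: witness_def insert_absorb)
  show ?thesis
  proof
    show "H \<subseteq> U" using sub[of 0] by simp
    show "henkin U" unfolding henkin_def using conU mem wit by auto
  qed
qed

text \<open>Equality is interpreted by an arbitrary relation, because the term model reads
  \<open>Eq\<close> as membership in a set of formulas; true equality comes only with the
  quotient.\<close>

primrec sat :: "('a \<Rightarrow> 'a \<Rightarrow> bool) \<Rightarrow> ('a \<Rightarrow> 'a \<Rightarrow> bool) \<Rightarrow> (nat \<Rightarrow> 'a) \<Rightarrow> fm \<Rightarrow> bool" where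
  "sat eq mem e Fls \<longleftrightarrow> False"
| "sat eq mem e (Eq i j) \<longleftrightarrow> eq (e i) (e j)"
| "sat eq mem e (Mem i j) \<longleftrightarrow> mem (e i) (e j)"
| "sat eq mem e (Imp p q) \<longleftrightarrow> (sat eq mem e p \<longrightarrow> sat eq mem e q)"
| "sat eq mem e (All p) \<longleftrightarrow> (\<forall>x. sat eq mem (case_nat x e) p)"

lemma sat_ren: "sat eq mem e (ren f p) \<longleftrightarrow> sat eq mem (\<lambda>i. e (f i)) p"
proof (induction p arbitrary: e f)
  case (All p)
  have "(\<lambda>i. case_nat x e (case_nat 0 (\<lambda>i. Suc (f i)) i)) = case_nat x (\<lambda>i. e (f i))" for x
    by (auto split: nat.splits)
  then show ?case by (simp add: All)
qed auto

lemma sat_cong: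
  "fv_below n p \<Longrightarrow> (\<And>i. i < n \<Longrightarrow> e i = e' i) \<Longrightarrow> sat eq mem e p = sat eq mem e' p"
proof (induction p arbitrary: n e e')
  case (Imp p q)
  then show ?case by (metis fv_below.simps(4) sat.simps(4))
next
  case (All p)
  have "sat eq mem (case_nat x e) p = sat eq mem (case_nat x e') p" for x
    using All.prems by (intro All.IH[of "Suc n"]) (auto split: nat.splits)
  then show ?case by simp
qed auto

section \<open>The term model of a Henkin set\<close>

context
  fixes U assumes U: "henkin U"
begin

lemma henkin_mem: "U \<turnstile> p \<Longrightarrow> p \<in> U"
proof (rule ccontr)
  assume p: "U \<turnstile> p" and "p \<notin> U"
  then have "insert p U \<turnstile> Fls" using U by (auto simp: henkin_def consistent_def)
  then have "U \<turnstile> Fls" using p ImpI ImpE by blast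
  then show False using U by (simp add: henkin_def consistent_def)
qed

lemma henkin_Imp: "Imp p q \<in> U \<longleftrightarrow> (p \<in> U \<longrightarrow> q \<in> U)"
proof
  show "Imp p q \<in> U \<Longrightarrow> p \<in> U \<longrightarrow> q \<in> U" using Assm ImpE henkin_mem by blast
  assume "p \<in> U \<longrightarrow> q \<in> U"
  moreover have "Imp p q \<in> U" if "p \<notin> U"
  proof -
    have "insert p U \<turnstile> Fls" using that U by (auto simp: henkin_def consistent_def)
    then have "insert (Imp q Fls) (insert p U) \<turnstile> Fls" by (auto elim: weaken)
    then show ?thesis by (meson Contr ImpI henkin_mem)
  qed
  moreover have "Imp p q \<in> U" if "q \<in> U"
    by (rule henkin_mem, rule ImpI, rule Assm) (simp add: that)
  ultimately show "Imp p q \<in> U" by blast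
qed

lemma henkin_Fls: "Fls \<notin> U"
  using U Assm by (auto simp: henkin_def consistent_def)

lemma henkin_All: "All q \<in> U \<longleftrightarrow> (\<forall>k. inst0 q k \<in> U)"
proof
  show "All q \<in> U \<Longrightarrow> \<forall>k. inst0 q k \<in> U" using Assm AllE henkin_mem by blast
  assume q: "\<forall>k. inst0 q k \<in> U"
  show "All q \<in> U"
  proof (rule ccontr)
    assume "All q \<notin> U"
    then have "Imp (All q) Fls \<in> U" by (simp add: henkin_Imp)
    then obtain k where "Imp (inst0 q k) Fls \<in> U" using U by (auto simp: henkin_def)
    then show False using q by (simp add: henkin_Imp henkin_Fls)
  qed
qed

text \<open>The universe consists of the variables themselves, so an environment is a renaming and
  truth is membership of the renamed formula.\<close>

lemma henkin_sat: "sat (\<lambda>i j. Eq i j \<in> U) (\<lambda>i j. Mem i j \<in> U) f p \<longleftrightarrow> ren f p \<in> U"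
proof (induction p arbitrary: f)
  case (All p)
  have "inst0 (ren (case_nat 0 (\<lambda>i. Suc (f i))) p) k = ren (case_nat k f) p" for k
  proof -
    have "(\<lambda>i. case_nat k (\<lambda>j. j) (case_nat 0 (\<lambda>i. Suc (f i)) i)) = case_nat k f"
      by (auto split: nat.splits)
    then show ?thesis by (simp add: inst0_def ren_ren)
  qed
  then show ?case by (simp add: All henkin_All)
qed (auto simp: henkin_Imp henkin_Fls)

lemma henkin_subst:
  assumes "Eq i j \<in> U" "inst0 p i \<in> U" shows "inst0 p j \<in> U"
  by (rule henkin_mem, rule EqE; rule Assm) (use assms in auto)

lemma henkin_refl: "Eq i i \<in> U"
  by (intro henkin_mem EqI)

lemma henkin_sym: "Eq i j \<in> U \<Longrightarrow> Eq j i \<in> U"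
  using henkin_subst[of i j "Eq 0 (Suc i)"] henkin_refl by (simp add: inst0_def)

lemma henkin_trans: "Eq i j \<in> U \<Longrightarrow> Eq j k \<in> U \<Longrightarrow> Eq i k \<in> U"
  using henkin_subst[of j k "Eq (Suc i) 0"] by (simp add: inst0_def)

lemma henkin_Mem_cong: "Eq i i' \<in> U \<Longrightarrow> Eq j j' \<in> U \<Longrightarrow> Mem i j \<in> U \<Longrightarrow> Mem i' j' \<in> U"
  using henkin_subst[of i i' "Mem 0 (Suc j)"] henkin_subst[of j j' "Mem (Suc i') 0"]
  by (simp add: inst0_def)

end

text \<open>Truth survives the passage to equality classes; surjectivity of \<open>g\<close> makes
  the quantifiers of the two universes correspond.\<close>

lemma sat_quotient:
  assumes "surj g" "\<And>i j. eq i j \<longleftrightarrow> g i = g j" "\<And>i j. mem i j \<longleftrightarrow> mem' (g i) (g j)"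
  shows "sat eq mem e p \<longleftrightarrow> sat (=) mem' (\<lambda>i. g (e i)) p"
proof (induction p arbitrary: e)
  case (All p)
  have "(\<lambda>i. g (case_nat x e i)) = case_nat (g x) (\<lambda>i. g (e i))" for x
    by (auto split: nat.splits)
  then have "sat eq mem e (All p) \<longleftrightarrow> (\<forall>x. sat (=) mem' (case_nat (g x) (\<lambda>i. g (e i))) p)"
    by (simp add: All)
  also have "\<dots> \<longleftrightarrow> sat (=) mem' (\<lambda>i. g (e i)) (All p)"
    using \<open>surj g\<close> by simp (metis surjD)
  finally show ?case .
qed (auto simp: assms)

text \<open>Infinitely many equality classes let the quotient be a structure on all of \<open>nat\<close>.\<close>

theorem completeness:
  assumes H: "\<And>p. p \<in> H \<Longrightarrow> fv_below 0 p" and p: "fv_below 0 p"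
    and inf: "\<And>eq mem F. finite (F :: nat set) \<Longrightarrow> (\<And>p e. p \<in> H \<Longrightarrow> sat eq mem e p) \<Longrightarrow>
      (\<And>i. eq i i) \<Longrightarrow> (\<And>i j. eq i j \<Longrightarrow> eq j i) \<Longrightarrow>
      (\<And>i j i' j'. eq i i' \<Longrightarrow> eq j j' \<Longrightarrow> mem i j \<Longrightarrow> mem i' j') \<Longrightarrow> \<exists>i. \<forall>j\<in>F. \<not> eq i j"
    and valid: "\<And>mem (e :: nat \<Rightarrow> nat). (\<And>p e. p \<in> H \<Longrightarrow> sat (=) mem e p) \<Longrightarrow> sat (=) mem e p"
  shows "H \<turnstile> p"
proof (rule ccontr)
  assume "\<not> H \<turnstile> p"
  then have "consistent (insert (Imp p Fls) H)" using Contr by (auto simp: consistent_def)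
  then obtain U where HU: "insert (Imp p Fls) H \<subseteq> U" and U: "henkin U"
    by (rule henkin_extension) (use H p in auto)
  let ?eq = "\<lambda>i j. Eq i j \<in> U" and ?mem = "\<lambda>i j. Mem i j \<in> U"
  \<comment> \<open>A sentence is fixed by every renaming, so membership in \<open>U\<close> makes
    it true in the term model under every environment.\<close>
  have sent: "sat ?eq ?mem e q" if "q \<in> U" "fv_below 0 q" for e q
    using that ren_cong[OF that(2), of e "\<lambda>i. i"] by (simp add: henkin_sat[OF U] ren_id)
  define C where "C = (\<lambda>i. {j. Eq i j \<in> U})"
  have Ceq: "C i = C j \<longleftrightarrow> Eq i j \<in> U" for i j
    using henkin_refl[OF U] henkin_sym[OF U] henkin_trans[OF U] unfolding C_def by blast
  have "infinite (range C)"
  proof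
    assume "finite (range C)"
    \<comment> \<open>\<open>F\<close> holds finitely many representatives of all classes; the
      hypothesis \<open>inf\<close> then yields an element whose class is none of theirs.\<close>
    then obtain F where F: "finite F" "range C = C ` F"
      by (metis finite_subset_image subset_refl)
    have "\<exists>i. \<forall>j\<in>F. \<not> ?eq i j"
    proof (rule inf)
      show "sat ?eq ?mem e q" if "q \<in> H" for q e using sent that HU H by blast
      show "?mem i' j'" if "?eq i i'" "?eq j j'" "?mem i j" for i j i' j'
        using henkin_Mem_cong[OF U that] .
    qed (fact F(1) henkin_refl[OF U] henkin_sym[OF U])+
    then obtain i where i: "\<forall>j\<in>F. Eq i j \<notin> U" by blast
    have "C i \<in> C ` F" using F(2) by auto
    then show False using i Ceq by auto
  qed
  then have bij: "bij_betw (to_nat_on (range C)) (range C) UNIV"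
    by (intro to_nat_on_infinite) auto
  define g where "g = (\<lambda>i. to_nat_on (range C) (C i))"
  have g: "g i = g j \<longleftrightarrow> Eq i j \<in> U" for i j
    unfolding g_def using bij_betw_imp_inj_on[OF bij] Ceq by (metis inj_onD rangeI)
  have surj: "surj g"
    using bij unfolding g_def bij_betw_def by (metis image_image)
  define mem where "mem = (\<lambda>x y. \<exists>i j. g i = x \<and> g j = y \<and> Mem i j \<in> U)"
  have mem: "Mem i j \<in> U \<longleftrightarrow> mem (g i) (g j)" for i j
    using henkin_Mem_cong[OF U] g unfolding mem_def by blast
  have q: "sat ?eq ?mem e q \<longleftrightarrow> sat (=) mem (\<lambda>i. g (e i)) q" for e q
    by (rule sat_quotient) (use surj g mem in auto)
  have *: "sat (=) mem e q" if "q \<in> U" "fv_below 0 q" for e q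
    using sent[OF that] q sat_cong[OF that(2)] by blast
  have "sat (=) mem e p" for e by (rule valid) (use * HU H in auto)
  moreover have "sat (=) mem e (Imp p Fls)" for e by (rule *) (use HU p in auto)
  ultimately show False by auto
qed


section \<open>Satisfaction of formulas with named variables\<close>

text \<open>
  Index environment of a formula at depth \<open>d\<close> whose variables, being levels, are evaluated
  by \<open>l\<close>. The value at indices beyond \<open>d\<close> is irrelevant.
\<close>

definition levels :: "(nat \<Rightarrow> 'a) \<Rightarrow> nat \<Rightarrow> nat \<Rightarrow> 'a" where
  "levels l d i = (if i < d then l (d - Suc i) else undefined)"

definition holds :: "('a \<Rightarrow> 'a \<Rightarrow> bool) \<Rightarrow> (nat \<Rightarrow> 'a) \<Rightarrow> nat \<Rightarrow> form \<Rightarrow> bool" where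
  "holds mem l d A \<longleftrightarrow> sat (=) mem (levels l d) (A d)"

lemma holds_fmem [simp]: "x < d \<Longrightarrow> y < d \<Longrightarrow> holds mem l d (x \<^bold>\<in> y) \<longleftrightarrow> mem (l x) (l y)"
  by (simp add: holds_def fmem_def levels_def Suc_diff_Suc)

lemma holds_feq [simp]: "x < d \<Longrightarrow> y < d \<Longrightarrow> holds mem l d (x \<^bold>= y) \<longleftrightarrow> l x = l y"
  by (simp add: holds_def feq_def levels_def Suc_diff_Suc)

lemma holds_fimp [simp]: "holds mem l d (A \<^bold>\<longrightarrow> B) \<longleftrightarrow> (holds mem l d A \<longrightarrow> holds mem l d B)"
  by (simp add: holds_def fimp_def)

lemma holds_fnot [simp]: "holds mem l d (\<^bold>\<not> A) \<longleftrightarrow> \<not> holds mem l d A"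
  by (simp add: holds_def fnot_def)

lemma holds_fconj [simp]: "holds mem l d (A \<^bold>\<and> B) \<longleftrightarrow> holds mem l d A \<and> holds mem l d B"
  by (simp add: fconj_def)

lemma holds_fdisj [simp]: "holds mem l d (A \<^bold>\<or> B) \<longleftrightarrow> holds mem l d A \<or> holds mem l d B"
  by (auto simp add: fdisj_def)

lemma holds_fiff [simp]: "holds mem l d (A \<^bold>\<longleftrightarrow> B) \<longleftrightarrow> (holds mem l d A \<longleftrightarrow> holds mem l d B)"
  by (auto simp add: fiff_def)

text \<open>A quantifier at depth \<open>d\<close> binds level \<open>d\<close>: pushing a value as
  index 0 shifts all indices but leaves the older levels in place.\<close>

lemma levels_Suc: "case_nat a (levels l d) = levels (l(d := a)) (Suc d)"
  by (rule ext) (auto simp: levels_def split: nat.splits)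

lemma holds_fall [simp]:
  "holds mem l d (\<^bold>\<forall>x. A x) \<longleftrightarrow> (\<forall>a. holds mem (l(d := a)) (Suc d) (A d))"
  by (simp add: holds_def fall_def levels_Suc)

lemma holds_fex [simp]:
  "holds mem l d (\<^bold>\<exists>x. A x) \<longleftrightarrow> (\<exists>a. holds mem (l(d := a)) (Suc d) (A d))"
  by (simp add: fex_def)

text \<open>The block of \<open>n\<close> quantifiers is instantiated with the first
  \<open>n\<close> entries of \<open>e'\<close>, whose remaining entries are those of
  \<open>e\<close>.\<close>

lemma sat_All_funpow:
  "sat (=) mem e ((All ^^ n) p) \<Longrightarrow> (\<And>i. e' (i + n) = e i) \<Longrightarrow> sat (=) mem e' p"
proof (induction n arbitrary: e' p)
  case 0
  then show ?case by (metis add.right_neutral ext funpow_0)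
next
  case (Suc n)
  have "sat (=) mem (\<lambda>i. e' (Suc i)) (All p)"
    by (rule Suc.IH) (use Suc.prems in \<open>simp_all add: funpow_Suc_right del: funpow.simps\<close>)
  moreover have "case_nat (e' 0) (\<lambda>i. e' (Suc i)) = e'" by (auto split: nat.splits)
  ultimately show ?case by (metis sat.simps(5))
qed

lemma holds_All_funpow:
  assumes "\<And>e. sat (=) mem e ((All ^^ n) (A n))" shows "holds mem l n A"
  unfolding holds_def by (rule sat_All_funpow[OF assms]) (auto simp: levels_def)

lemma holds_schematic:
  assumes "fv_below m p" "\<And>i. i < m \<Longrightarrow> v i < d"
  shows "holds mem l d (schematic p v) \<longleftrightarrow> sat (=) mem (\<lambda>i. l (v i)) p"
  unfolding holds_def schematic_def sat_ren
proof (rule sat_cong[OF assms(1)])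
  show "levels l d (d - Suc (v i)) = l (v i)" if "i < m" for i
    using assms(2)[OF that] by (simp add: levels_def Suc_diff_Suc)
qed


section \<open>Models of ZF and definability with parameters\<close>

text \<open>The universe is the whole type and equality is true equality, but \<open>mem\<close>
  need not be well-founded as a relation of HOL, and the natural numbers of the model may be
  nonstandard. Foundation is available only for sets of the model.\<close>

locale zf_model =
  fixes mem :: "'a \<Rightarrow> 'a \<Rightarrow> bool"
  assumes ZF: "p \<in> ZF \<Longrightarrow> sat (=) mem e p"
begin

text \<open>The even variables range over the environment, the odd ones over the parameters.\<close>

definition mix :: "(nat \<Rightarrow> 'a) \<Rightarrow> (nat \<Rightarrow> 'a) \<Rightarrow> nat \<Rightarrow> 'a" where
  "mix e c i = (if even i then e (i div 2) else c (i div 2))"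

text \<open>Parameters form an infinite sequence, so no arity has to be tracked; a formula mentions
  only finitely many of them, and these become the parameters of Separation and Replacement.\<close>

definition Def :: "((nat \<Rightarrow> 'a) \<Rightarrow> bool) \<Rightarrow> bool" where
  "Def P \<longleftrightarrow> (\<exists>p c. \<forall>e. P e \<longleftrightarrow> sat (=) mem (mix e c) p)"

text \<open>The graph of \<open>f\<close> is definable: entry 0 of the environment is the value, the
  shifted environment is the argument.\<close>

definition DefF :: "((nat \<Rightarrow> 'a) \<Rightarrow> 'a) \<Rightarrow> bool" where
  "DefF f \<longleftrightarrow> Def (\<lambda>e. e 0 = f (\<lambda>i. e (Suc i)))"

lemma DefI: "(\<And>e. P e \<longleftrightarrow> sat (=) mem (mix e c) p) \<Longrightarrow> Def P"
  unfolding Def_def by blast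

text \<open>These rules follow the shape of HOL terms, so that \<open>intro def_intros\<close> reads
  definability off the syntax of a predicate.\<close>

named_theorems def_intros

lemma Def_imp [def_intros]:
  assumes "Def P" "Def Q" shows "Def (\<lambda>e. P e \<longrightarrow> Q e)"
proof -
  obtain p c q d where P: "\<And>e. P e \<longleftrightarrow> sat (=) mem (mix e c) p"
    and Q: "\<And>e. Q e \<longleftrightarrow> sat (=) mem (mix e d) q"
    using assms unfolding Def_def by metis
  \<comment> \<open>The parameters of \<open>p\<close> go to the even places of \<open>b\<close>,
    those of \<open>q\<close> to the odd ones. The variable \<open>i = 2k+1\<close> of
    \<open>p\<close> thus becomes \<open>2(2k)+1 = 2i-1\<close>, that of \<open>q\<close> becomes
    \<open>2(2k+1)+1 = 2i+1\<close>.\<close>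
  define b where "b i = (if even i then c (i div 2) else d (i div 2))" for i :: nat
  have 1: "mix e c = (\<lambda>i. mix e b (if even i then i else 2 * i - 1))" for e
  proof
    fix i
    show "mix e c i = mix e b (if even i then i else 2 * i - 1)"
    proof (cases "even i")
      case False
      then obtain k where "i = Suc (2 * k)" by (auto elim: oddE)
      then show ?thesis by (simp add: mix_def b_def)
    qed (simp add: mix_def)
  qed
  have 2: "mix e d = (\<lambda>i. mix e b (if even i then i else 2 * i + 1))" for e
  proof
    show "mix e d i = mix e b (if even i then i else 2 * i + 1)" for i
      by (cases "even i") (auto simp: mix_def b_def)
  qed
  show ?thesis
    by (rule DefI[where c = b and p = "Imp (ren (\<lambda>i. if even i then i else 2 * i - 1) p)
          (ren (\<lambda>i. if even i then i else 2 * i + 1) q)"])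
      (simp add: sat_ren P Q 1 2)
qed

lemma Def_False [def_intros]: "Def (\<lambda>e. False)"
  by (rule DefI[where p = Fls]) simp

lemma Def_not [def_intros]: "Def P \<Longrightarrow> Def (\<lambda>e. \<not> P e)"
  using Def_imp[OF _ Def_False] by simp

lemma Def_disj [def_intros]: "Def P \<Longrightarrow> Def Q \<Longrightarrow> Def (\<lambda>e. P e \<or> Q e)"
  using Def_imp[OF Def_not] by (simp add: imp_conv_disj)

lemma Def_conj [def_intros]:
  assumes "Def P" "Def Q" shows "Def (\<lambda>e. P e \<and> Q e)"
  using Def_not[OF Def_imp[OF assms(1) Def_not[OF assms(2)]]] by simp

lemma Def_iff [def_intros]:
  assumes "Def P" "Def Q" shows "Def (\<lambda>e. P e \<longleftrightarrow> Q e)"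
proof -
  have "Def (\<lambda>e. (P e \<longrightarrow> Q e) \<and> (Q e \<longrightarrow> P e))" by (intro Def_conj Def_imp assms)
  then show ?thesis by (simp add: iff_conv_conj_imp)
qed

lemma Def_all [def_intros]:
  assumes "Def (\<lambda>e. Q (e 0) (\<lambda>i. e (Suc i)))" shows "Def (\<lambda>e. \<forall>x. Q x e)"
proof -
  obtain p c where P: "\<And>e. Q (e 0) (\<lambda>i. e (Suc i)) \<longleftrightarrow> sat (=) mem (mix e c) p"
    using assms unfolding Def_def by metis
  \<comment> \<open>The formula \<open>p\<close> expects the new value at the head of the even half,
    whereas \<open>All\<close> puts it before the whole interleaved sequence. So 0 stays, the other
    even variables move down by one and the odd ones up by one.\<close>
  define \<rho> where "\<rho> i = (if i = 0 then 0 else if even i then i - 1 else Suc i)" for i :: nat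
  have "mix (case_nat x e) c = (\<lambda>i. case_nat x (mix e c) (\<rho> i))" for x e
  proof
    fix i
    show "mix (case_nat x e) c i = case_nat x (mix e c) (\<rho> i)"
    proof (cases "even i")
      case True
      then obtain k where "i = 2 * k" by auto
      then show ?thesis by (cases k) (auto simp: mix_def \<rho>_def)
    next
      case False
      then obtain k where "i = 2 * k + 1" by (auto elim: oddE)
      then show ?thesis by (auto simp: mix_def \<rho>_def)
    qed
  qed
  then have "Q x e \<longleftrightarrow> sat (=) mem (case_nat x (mix e c)) (ren \<rho> p)" for x e
    using P[of "case_nat x e"] by (simp add: sat_ren)
  then show ?thesis by (intro DefI[where c = c and p = "All (ren \<rho> p)"]) simp
qed

lemma Def_ex [def_intros]:
  assumes "Def (\<lambda>e. Q (e 0) (\<lambda>i. e (Suc i)))" shows "Def (\<lambda>e. \<exists>x. Q x e)"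
proof -
  have "Def (\<lambda>e. \<not> (\<forall>x. \<not> Q x e))" by (intro Def_not Def_all assms)
  then show ?thesis by simp
qed

lemma Def_ren: "Def P \<Longrightarrow> Def (\<lambda>e. P (\<lambda>i. e (\<sigma> i)))"
proof -
  assume "Def P"
  then obtain p c where P: "\<And>e. P e \<longleftrightarrow> sat (=) mem (mix e c) p" unfolding Def_def by metis
  have "mix (\<lambda>i. e (\<sigma> i)) c = (\<lambda>i. mix e c (if even i then 2 * \<sigma> (i div 2) else i))" for e
    by (rule ext) (auto simp: mix_def)
  then show ?thesis
    by (intro DefI[where c = c and p = "ren (\<lambda>i. if even i then 2 * \<sigma> (i div 2) else i) p"])
      (simp add: P sat_ren)
qed

lemma Def_eq_var: "Def (\<lambda>e. e i = e j)"
  by (rule DefI[where p = "Eq (2 * i) (2 * j)"]) (simp add: mix_def)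

lemma Def_mem_var: "Def (\<lambda>e. mem (e i) (e j))"
  by (rule DefI[where p = "Mem (2 * i) (2 * j)"]) (simp add: mix_def)

lemma DefF_var [def_intros]: "DefF (\<lambda>e. e i)"
  unfolding DefF_def by (rule Def_eq_var)

lemma DefF_const [def_intros]: "DefF (\<lambda>e. a)"
  unfolding DefF_def by (rule DefI[where c = "\<lambda>_. a" and p = "Eq 0 1"]) (simp add: mix_def)

lemma DefF_Suc: "DefF f \<Longrightarrow> DefF (\<lambda>e. f (\<lambda>i. e (Suc i)))"
  unfolding DefF_def
  using Def_ren[of "\<lambda>e. e 0 = f (\<lambda>i. e (Suc i))" "case_nat 0 (\<lambda>i. Suc (Suc i))"] by simp

text \<open>Composition with a definable function reduces to a quantifier over its value.\<close>

lemma Def_subst: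
  assumes "Def (\<lambda>e. Q (e 0) (\<lambda>i. e (Suc i)))" "DefF f" shows "Def (\<lambda>e. Q (f e) e)"
proof -
  have "Def (\<lambda>e. \<exists>x. x = f e \<and> Q x e)"
    using assms unfolding DefF_def by (intro Def_ex Def_conj)
  then show ?thesis by simp
qed

lemma Def_subst1: "Def (\<lambda>e. P (e 0)) \<Longrightarrow> DefF f \<Longrightarrow> Def (\<lambda>e. P (f e))"
  by (rule Def_subst)

lemma Def_subst2:
  assumes P: "Def (\<lambda>e. P (e 0) (e 1))" and f: "DefF f" and g: "DefF g"
  shows "Def (\<lambda>e. P (f e) (g e))"
proof -
  have "Def (\<lambda>e. P (e 1) (e 0))"
    using Def_ren[OF P, of "\<lambda>i. if i = 0 then 1 else 0"] by simp
  then have "Def (\<lambda>e. P (e 0) (g (\<lambda>i. e (Suc i))))"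
    using Def_subst[of "\<lambda>x e. P (e 0) x"] DefF_Suc[OF g] by simp
  then show ?thesis using Def_subst[of "\<lambda>x e. P x (g e)"] f by simp
qed

lemma Def_subst3:
  assumes P: "Def (\<lambda>e. P (e 0) (e 1) (e 2))" and f: "DefF f" and g: "DefF g" and h: "DefF h"
  shows "Def (\<lambda>e. P (f e) (g e) (h e))"
proof -
  have "Def (\<lambda>e. P (e 1) (e 2) (e 0))"
    using Def_ren[OF P, of "\<lambda>i. if i = 0 then 1 else if i = 1 then 2 else 0"] by simp
  then have "Def (\<lambda>e. P (e 0) (e 1) (h (\<lambda>i. e (Suc (Suc i)))))"
    using Def_subst[of "\<lambda>x e. P (e 0) (e 1) x"] DefF_Suc[OF DefF_Suc[OF h]]
    by (simp add: numeral_2_eq_2)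
  then have "Def (\<lambda>e. P (e 1) (e 0) (h (\<lambda>i. e (Suc (Suc i)))))"
    using Def_ren[of _ "\<lambda>i. if i = 0 then 1 else if i = 1 then 0 else i"] by fastforce
  then have "Def (\<lambda>e. P (e 0) (g (\<lambda>i. e (Suc i))) (h (\<lambda>i. e (Suc i))))"
    using Def_subst[of "\<lambda>x e. P (e 0) x (h (\<lambda>i. e (Suc i)))"] DefF_Suc[OF g] by simp
  then show ?thesis using Def_subst[of "\<lambda>x e. P x (g e) (h e)"] f by simp
qed

lemma DefF_subst1: "DefF (\<lambda>e. F (e 0)) \<Longrightarrow> DefF f \<Longrightarrow> DefF (\<lambda>e. F (f e))"
  unfolding DefF_def
  using Def_subst2[of "\<lambda>x y. x = F y" "\<lambda>e. e 0" "\<lambda>e. f (\<lambda>i. e (Suc i))"] DefF_var[of 0]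
    DefF_Suc[of f] by (simp add: DefF_def)

lemma DefF_subst2: "DefF (\<lambda>e. F (e 0) (e 1)) \<Longrightarrow> DefF f \<Longrightarrow> DefF g \<Longrightarrow> DefF (\<lambda>e. F (f e) (g e))"
  unfolding DefF_def
  using Def_subst3[of "\<lambda>x y z. x = F y z" "\<lambda>e. e 0" "\<lambda>e. f (\<lambda>i. e (Suc i))"
    "\<lambda>e. g (\<lambda>i. e (Suc i))"] DefF_var[of 0] DefF_Suc[of f] DefF_Suc[of g]
  by (simp add: DefF_def numeral_2_eq_2)

definition elts :: "'a \<Rightarrow> 'a set" where
  "elts a = {x. mem x a}"

abbreviation sub :: "'a \<Rightarrow> 'a \<Rightarrow> bool" (infix "\<sqsubseteq>" 50) where
  "a \<sqsubseteq> b \<equiv> elts a \<subseteq> elts b"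

lemma Def_mem [def_intros]: "DefF f \<Longrightarrow> DefF g \<Longrightarrow> Def (\<lambda>e. f e \<in> elts (g e))"
  unfolding elts_def mem_Collect_eq by (rule Def_subst2[of mem, OF Def_mem_var])

lemma Def_eq [def_intros]: "DefF f \<Longrightarrow> DefF g \<Longrightarrow> Def (\<lambda>e. f e = g e)"
  by (rule Def_subst2[of "(=)", OF Def_eq_var])

lemma Def_ball [def_intros]:
  "Def (\<lambda>e. Q (e 0) (\<lambda>i. e (Suc i))) \<Longrightarrow> DefF f \<Longrightarrow> Def (\<lambda>e. \<forall>x\<in>elts (f e). Q x e)"
  unfolding Ball_def by (intro def_intros DefF_Suc)

lemma Def_bex [def_intros]:
  "Def (\<lambda>e. Q (e 0) (\<lambda>i. e (Suc i))) \<Longrightarrow> DefF f \<Longrightarrow> Def (\<lambda>e. \<exists>x\<in>elts (f e). Q x e)"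
  unfolding Bex_def by (intro def_intros DefF_Suc)

lemma Def_subset [def_intros]: "DefF f \<Longrightarrow> DefF g \<Longrightarrow> Def (\<lambda>e. f e \<sqsubseteq> g e)"
  unfolding subset_iff by (intro def_intros DefF_Suc)

lemma Def_ex1 [def_intros]:
  assumes "Def (\<lambda>e. Q (e 0) (\<lambda>i. e (Suc i)))" shows "Def (\<lambda>e. \<exists>!x. Q x e)"
proof -
  have 1: "Def (\<lambda>e. Q (e 0) (\<lambda>i. e (Suc (Suc i))))"
    using Def_ren[OF assms, of "case_nat 0 (\<lambda>i. Suc (Suc i))"] by simp
  show ?thesis unfolding Ex1_def by (intro def_intros assms 1)
qed


section \<open>The axioms in a model\<close>

lemma holds_axiom: "A 0 \<in> ZF \<Longrightarrow> holds mem l 0 A"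
  unfolding holds_def by (rule ZF)

lemma extensionality: "elts a = elts b \<Longrightarrow> a = b"
proof -
  have "holds mem undefined 0 Extensionality" by (rule holds_axiom) (simp add: ZF_def)
  then have "\<forall>x y. (\<forall>z. mem z x \<longleftrightarrow> mem z y) \<longrightarrow> x = y" by (simp add: Extensionality_def)
  then show "elts a = elts b \<Longrightarrow> a = b" unfolding elts_def set_eq_iff by simp
qed

lemma elts_eq_iff: "elts a = elts b \<longleftrightarrow> a = b"
  using extensionality by auto

lemma foundation: "elts a \<noteq> {} \<Longrightarrow> \<exists>b\<in>elts a. elts a \<inter> elts b = {}"
proof -
  have "holds mem undefined 0 Foundation" by (rule holds_axiom) (simp add: ZF_def)
  then have "\<forall>x. (\<exists>z. mem z x) \<longrightarrow> (\<exists>y. mem y x \<and> (\<forall>z. mem z x \<longrightarrow> \<not> mem z y))"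
    by (simp add: Foundation_def is_empty_def)
  then show "elts a \<noteq> {} \<Longrightarrow> \<exists>b\<in>elts a. elts a \<inter> elts b = {}" unfolding elts_def by fastforce
qed

lemma pairing_axiom: "\<exists>c. elts c = {a, b}"
proof -
  have "holds mem undefined 0 Pairing" by (rule holds_axiom) (simp add: ZF_def)
  then have "\<forall>x y. \<exists>p. \<forall>z. mem z p \<longleftrightarrow> z = x \<or> z = y" by (simp add: Pairing_def is_upair_def)
  then show ?thesis unfolding elts_def set_eq_iff by simp
qed

lemma union_axiom: "\<exists>u. elts u = \<Union>(elts ` elts a)"
proof -
  have "holds mem undefined 0 Union_axiom" by (rule holds_axiom) (simp add: ZF_def)
  then have "\<forall>x. \<exists>u. \<forall>z. mem z u \<longleftrightarrow> (\<exists>y. mem y x \<and> mem z y)" by (simp add: Union_axiom_def)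
  then show ?thesis unfolding elts_def set_eq_iff by simp
qed

lemma power_axiom: "\<exists>p. elts p = {b. b \<sqsubseteq> a}"
proof -
  have "holds mem undefined 0 Power_set" by (rule holds_axiom) (simp add: ZF_def)
  then have "\<forall>x. \<exists>p. \<forall>z. mem z p \<longleftrightarrow> (\<forall>y. mem y z \<longrightarrow> mem y x)"
    by (simp add: Power_set_def is_subset_def)
  then show ?thesis unfolding elts_def set_eq_iff subset_iff by simp
qed

lemma separation:
  assumes "Def (\<lambda>e. P (e 0))" shows "\<exists>b. elts b = {x \<in> elts a. P x}"
proof -
  obtain p c where P: "\<And>e. P (e 0) \<longleftrightarrow> sat (=) mem (mix e c) p"
    using assms unfolding Def_def by metis
  \<comment> \<open>Only entry 0 of the environment matters to \<open>P\<close>, so all even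
    variables may be read as \<open>x\<close>; the odd ones become the parameters.\<close>
  define q where "q = ren (\<lambda>i. if even i then 0 else Suc (i div 2)) p"
  have q: "P x \<longleftrightarrow> sat (=) mem (case_nat x c) q" for x
    using P[of "\<lambda>_. x"] unfolding q_def sat_ren mix_def
    by (auto simp: if_distrib cong: if_cong)
  obtain n where n: "fv_below n q" using fv_below_exists by blast
  then have n': "fv_below (Suc n) q" by (rule fv_below_mono) simp
  have "holds mem c n (\<^bold>\<forall>a. \<^bold>\<exists>b. \<^bold>\<forall>x. x \<^bold>\<in> b \<^bold>\<longleftrightarrow> x \<^bold>\<in> a \<^bold>\<and> schematic q (case_nat x (\<lambda>i. i)))"
    by (rule holds_All_funpow, rule ZF) (use n' in \<open>auto simp: ZF_def Separation_def\<close>)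
  moreover have "holds mem (c(n := a, Suc n := b, Suc (Suc n) := x)) (Suc (Suc (Suc n)))
      (schematic q (case_nat (Suc (Suc n)) (\<lambda>i. i))) \<longleftrightarrow> P x" for a b x
    unfolding q
    by (subst holds_schematic[OF n'], auto split: nat.splits, (rule sat_cong[OF n', THEN iffD1],
          auto split: nat.splits)+)
  ultimately have "\<forall>a. \<exists>b. \<forall>x. mem x b \<longleftrightarrow> mem x a \<and> P x" by simp
  then show ?thesis unfolding elts_def set_eq_iff by simp
qed

lemma replacement:
  assumes "Def (\<lambda>e. P (e 0) (e 1))" and func: "\<And>x y z. x \<in> elts a \<Longrightarrow> P x y \<Longrightarrow> P x z \<Longrightarrow> y = z"
  shows "\<exists>b. elts b = {y. \<exists>x\<in>elts a. P x y}"
proof -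
  obtain p c where P: "\<And>e. P (e 0) (e 1) \<longleftrightarrow> sat (=) mem (mix e c) p"
    using assms(1) unfolding Def_def by metis
  \<comment> \<open>As for Separation, with entry 0 read as \<open>x\<close> and every later
    environment entry as \<open>y\<close>.\<close>
  define q where
    "q = ren (\<lambda>i. if i = 0 then 0 else if even i then 1 else Suc (Suc (i div 2))) p"
  have q: "P x y \<longleftrightarrow> sat (=) mem (case_nat x (case_nat y c)) q" for x y
  proof -
    have "(\<lambda>i. case_nat x (case_nat y c)
        (if i = 0 then 0 else if even i then 1 else Suc (Suc (i div 2))))
      = mix (case_nat x (\<lambda>_. y)) c"
      by (rule ext) (auto simp: mix_def split: nat.splits elim!: evenE)
    then show ?thesis using P[of "case_nat x (\<lambda>_. y)"] by (simp add: q_def sat_ren)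
  qed
  obtain n where n: "fv_below n q" using fv_below_exists by blast
  then have n': "fv_below (Suc (Suc n)) q" by (rule fv_below_mono) simp
  let ?P = "\<lambda>x y. schematic q (case_nat x (case_nat y (\<lambda>i. i)))"
  have ax: "holds mem c n (\<^bold>\<forall>a. (\<^bold>\<forall>x. \<^bold>\<forall>y. \<^bold>\<forall>z. x \<^bold>\<in> a \<^bold>\<and> ?P x y \<^bold>\<and> ?P x z \<^bold>\<longrightarrow> y \<^bold>= z) \<^bold>\<longrightarrow>
        (\<^bold>\<exists>b. \<^bold>\<forall>y. y \<^bold>\<in> b \<^bold>\<longleftrightarrow> (\<^bold>\<exists>x. x \<^bold>\<in> a \<^bold>\<and> ?P x y)))"
    by (rule holds_All_funpow, rule ZF) (use n' in \<open>auto simp: ZF_def Replacement_def Let_def\<close>)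
  have sch: "holds mem l d (?P i j) \<longleftrightarrow> P (l i) (l j)"
    if "i < d" "j < d" "n < d" "\<And>k. k < n \<Longrightarrow> l k = c k" for l d i j
  proof -
    have "holds mem l d (?P i j) \<longleftrightarrow> sat (=) mem (\<lambda>k. l (case_nat i (case_nat j (\<lambda>i. i)) k)) q"
      by (rule holds_schematic[OF n']) (use that in \<open>auto split: nat.splits\<close>)
    also have "\<dots> \<longleftrightarrow> sat (=) mem (case_nat (l i) (case_nat (l j) c)) q"
      by (rule sat_cong[OF n']) (use that in \<open>auto split: nat.splits\<close>)
    finally show ?thesis by (simp add: q)
  qed
  have "(\<forall>x y z. mem x a \<and> P x y \<and> P x z \<longrightarrow> y = z) \<longrightarrow>
      (\<exists>b. \<forall>y. mem y b \<longleftrightarrow> (\<exists>x. mem x a \<and> P x y))"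
    using ax by (simp add: sch)
  then have "\<exists>b. \<forall>y. mem y b \<longleftrightarrow> (\<exists>x. mem x a \<and> P x y)"
    using func by (simp add: elts_def) blast
  then show ?thesis unfolding elts_def set_eq_iff by simp
qed


text \<open>The premise on \<open>b\<close> comes first so that elimination against an
  \<open>obtain\<close> goal fixes \<open>P\<close> by unification and leaves only the definability
  of \<open>P\<close>.\<close>

lemma sepE:
  assumes "\<And>b. elts b = {x \<in> elts a. P x} \<Longrightarrow> thesis" "Def (\<lambda>e. P (e 0))" shows thesis
  using separation[OF assms(2)] assms(1) by blast


section \<open>Elementary set theory in a model\<close>

definition mk :: "'a set \<Rightarrow> 'a" where
  "mk S = (THE a. elts a = S)"

lemma elts_mk: "\<exists>a. elts a = S \<Longrightarrow> elts (mk S) = S"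
  unfolding mk_def by (rule theI') (metis extensionality)

text \<open>By extensionality, equality with \<open>mk (S e)\<close> is a condition on elements;
  hence a set-forming operation is a definable function as soon as membership in its value is
  definable.\<close>

lemma DefF_mk:
  assumes "\<And>e. \<exists>a. elts a = S e" "Def (\<lambda>e. \<forall>x. x \<in> elts (e 0) \<longleftrightarrow> x \<in> S (\<lambda>i. e (Suc i)))"
  shows "DefF (\<lambda>e. mk (S e))"
proof -
  have "a = mk (S e) \<longleftrightarrow> (\<forall>x. x \<in> elts a \<longleftrightarrow> x \<in> S e)" for a e
    using elts_mk[OF assms(1)[of e]] by (metis elts_eq_iff set_eqI)
  then show ?thesis unfolding DefF_def using assms(2) by simp
qed

lemmas DefF_mk1 = DefF_subst1[OF DefF_mk]
lemmas DefF_mk2 = DefF_subst2[OF DefF_mk]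

definition sep :: "'a \<Rightarrow> ('a \<Rightarrow> bool) \<Rightarrow> 'a" where
  "sep a P = mk {x \<in> elts a. P x}"

lemma elts_sep: "Def (\<lambda>e. P (e 0)) \<Longrightarrow> elts (sep a P) = {x \<in> elts a. P x}"
  unfolding sep_def by (rule elts_mk[OF separation])

definition upair :: "'a \<Rightarrow> 'a \<Rightarrow> 'a" where
  "upair x y = mk {x, y}"

lemma elts_upair [simp]: "elts (upair x y) = {x, y}"
  unfolding upair_def by (rule elts_mk[OF pairing_axiom])

lemma DefF_upair [def_intros]: "DefF f \<Longrightarrow> DefF g \<Longrightarrow> DefF (\<lambda>e. upair (f e) (g e))"
  unfolding upair_def
  by (rule DefF_mk2[OF pairing_axiom]) (simp, intro def_intros)

definition pair :: "'a \<Rightarrow> 'a \<Rightarrow> 'a" where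
  "pair x y = upair (upair x x) (upair x y)"

lemma DefF_pair [def_intros]: "DefF f \<Longrightarrow> DefF g \<Longrightarrow> DefF (\<lambda>e. pair (f e) (g e))"
  unfolding pair_def by (intro def_intros)

lemma upair_eq_iff: "upair a b = upair c d \<longleftrightarrow> a = c \<and> b = d \<or> a = d \<and> b = c"
  using elts_eq_iff[of "upair a b" "upair c d"] by (auto simp: doubleton_eq_iff)

lemma pair_eq_iff [simp]: "pair a b = pair c d \<longleftrightarrow> a = c \<and> b = d"
  unfolding pair_def by (auto simp: upair_eq_iff)

definition union :: "'a \<Rightarrow> 'a" where
  "union a = mk (\<Union>(elts ` elts a))"

lemma elts_union [simp]: "elts (union a) = \<Union>(elts ` elts a)"
  unfolding union_def by (rule elts_mk[OF union_axiom])

lemma DefF_union [def_intros]: "DefF f \<Longrightarrow> DefF (\<lambda>e. union (f e))"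
  unfolding union_def
  by (rule DefF_mk1[OF union_axiom]) (simp only: UN_iff, intro def_intros)

definition un :: "'a \<Rightarrow> 'a \<Rightarrow> 'a" where
  "un a b = union (upair a b)"

lemma elts_un [simp]: "elts (un a b) = elts a \<union> elts b"
  by (simp add: un_def)

lemma DefF_un [def_intros]: "DefF f \<Longrightarrow> DefF g \<Longrightarrow> DefF (\<lambda>e. un (f e) (g e))"
  unfolding un_def by (intro def_intros)

definition emptyset :: "'a" where
  "emptyset = sep undefined (\<lambda>_. False)"

lemma elts_emptyset [simp]: "elts emptyset = {}"
  unfolding emptyset_def by (subst elts_sep) (auto intro: def_intros)

lemma elts_emptyset_iff: "elts a = {} \<longleftrightarrow> a = emptyset"
  using elts_eq_iff[of a emptyset] by simp

definition pow :: "'a \<Rightarrow> 'a" where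
  "pow a = mk {b. b \<sqsubseteq> a}"

lemma elts_pow [simp]: "elts (pow a) = {b. b \<sqsubseteq> a}"
  unfolding pow_def by (rule elts_mk[OF power_axiom])

definition suc :: "'a \<Rightarrow> 'a" where
  "suc a = un a (upair a a)"

lemma elts_suc [simp]: "elts (suc a) = insert a (elts a)"
  by (simp add: suc_def)

lemma DefF_suc [def_intros]: "DefF f \<Longrightarrow> DefF (\<lambda>e. suc (f e))"
  unfolding suc_def by (intro def_intros)

definition diff :: "'a \<Rightarrow> 'a \<Rightarrow> 'a" where
  "diff a b = mk (elts a - elts b)"

lemma diff_axiom: "\<exists>c. elts c = elts a - elts b"
  using separation[of "\<lambda>x. x \<notin> elts b" a] by (simp add: set_diff_eq def_intros)

lemma elts_diff [simp]: "elts (diff a b) = elts a - elts b"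
  unfolding diff_def by (rule elts_mk[OF diff_axiom])

lemma DefF_diff [def_intros]: "DefF f \<Longrightarrow> DefF g \<Longrightarrow> DefF (\<lambda>e. diff (f e) (g e))"
  unfolding diff_def by (rule DefF_mk2[OF diff_axiom]) (simp, intro def_intros)

definition inter :: "'a \<Rightarrow> 'a \<Rightarrow> 'a" where
  "inter a b = diff a (diff a b)"

lemma elts_inter [simp]: "elts (inter a b) = elts a \<inter> elts b"
  by (auto simp: inter_def)

lemma DefF_inter [def_intros]: "DefF f \<Longrightarrow> DefF g \<Longrightarrow> DefF (\<lambda>e. inter (f e) (g e))"
  unfolding inter_def by (intro def_intros)

definition product :: "'a \<Rightarrow> 'a \<Rightarrow> 'a" where
  "product a b = mk {pair x y | x y. x \<in> elts a \<and> y \<in> elts b}"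

lemma product_axiom: "\<exists>c. elts c = {pair x y | x y. x \<in> elts a \<and> y \<in> elts b}"
proof -
  have "\<exists>c. elts c = {p \<in> elts (pow (pow (un a b))). \<exists>x\<in>elts a. \<exists>y\<in>elts b. p = pair x y}"
    by (intro separation def_intros)
  moreover have "{p \<in> elts (pow (pow (un a b))). \<exists>x\<in>elts a. \<exists>y\<in>elts b. p = pair x y}
      = {pair x y | x y. x \<in> elts a \<and> y \<in> elts b}"
    by (auto simp: pair_def)
  ultimately show ?thesis by simp
qed

lemma elts_product: "elts (product a b) = {pair x y | x y. x \<in> elts a \<and> y \<in> elts b}"
  unfolding product_def by (rule elts_mk[OF product_axiom])

lemma pair_in_product [simp]: "pair x y \<in> elts (product a b) \<longleftrightarrow> x \<in> elts a \<and> y \<in> elts b"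
  by (auto simp: elts_product)

lemma in_productE:
  assumes "p \<in> elts (product a b)" obtains x y where "p = pair x y" "x \<in> elts a" "y \<in> elts b"
  using assms by (auto simp: elts_product)

lemma DefF_product [def_intros]: "DefF f \<Longrightarrow> DefF g \<Longrightarrow> DefF (\<lambda>e. product (f e) (g e))"
  unfolding product_def by (rule DefF_mk2[OF product_axiom]) (simp, intro def_intros)

lemma not_mem_self: "a \<notin> elts a"
  using foundation[of "upair a a"] by auto

lemma not_mem_sym: "a \<in> elts b \<Longrightarrow> b \<notin> elts a"
  using foundation[of "upair a b"] by auto

lemma Def_minimal:
  assumes "Def (\<lambda>e. P (e 0))" "x \<in> elts a" "P x"
  obtains y where "y \<in> elts a" "P y" "\<And>z. z \<in> elts a \<Longrightarrow> z \<in> elts y \<Longrightarrow> \<not> P z"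
proof -
  have "elts (sep a P) \<noteq> {}" using assms(2,3) by (auto simp: elts_sep[OF assms(1)])
  then show ?thesis using foundation[of "sep a P"] that by (auto simp: elts_sep[OF assms(1)])
qed


section \<open>Functions and cardinalities in a model\<close>

text \<open>The default \<open>emptyset\<close> makes application total, hence a definable function
  of both arguments without side conditions.\<close>

definition app :: "'a \<Rightarrow> 'a \<Rightarrow> 'a" where
  "app f x = (if \<exists>!y. pair x y \<in> elts f then THE y. pair x y \<in> elts f else emptyset)"

lemma app_graph: "y = app f x \<longleftrightarrow>
    (\<exists>!y. pair x y \<in> elts f) \<and> pair x y \<in> elts f \<or> \<not> (\<exists>!y. pair x y \<in> elts f) \<and> y = emptyset"
proof (cases "\<exists>!y. pair x y \<in> elts f")
  case True
  then have "app f x = (THE y. pair x y \<in> elts f)" by (simp add: app_def)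
  then show ?thesis using True theI'[OF True] by metis
qed (auto simp: app_def)

lemma DefF_app [def_intros]: "DefF f \<Longrightarrow> DefF g \<Longrightarrow> DefF (\<lambda>e. app (f e) (g e))"
  by (rule DefF_subst2[where F = app]) (unfold DefF_def app_graph, intro def_intros)

definition func :: "'a \<Rightarrow> 'a \<Rightarrow> 'a \<Rightarrow> bool" where
  "func f X Y \<longleftrightarrow> f \<sqsubseteq> product X Y \<and> (\<forall>x\<in>elts X. \<exists>!y. pair x y \<in> elts f)"

lemma Def_func [def_intros]:
  "DefF f \<Longrightarrow> DefF g \<Longrightarrow> DefF h \<Longrightarrow> Def (\<lambda>e. func (f e) (g e) (h e))"
  by (rule Def_subst3[where P = func]) (unfold func_def, intro def_intros)

lemma func_pair_iff: "func f X Y \<Longrightarrow> pair x y \<in> elts f \<longleftrightarrow> x \<in> elts X \<and> y = app f x"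
proof -
  assume f: "func f X Y"
  have 1: "x \<in> elts X" if "pair x y \<in> elts f"
    using subsetD[of "elts f" "elts (product X Y)", OF _ that] f by (simp add: func_def)
  have 2: "\<exists>!y. pair x y \<in> elts f" if "x \<in> elts X" using f that by (simp add: func_def)
  show ?thesis using 1 2 app_graph[of y f x] by auto
qed

lemma func_app [simp]: "func f X Y \<Longrightarrow> x \<in> elts X \<Longrightarrow> app f x \<in> elts Y"
  using func_pair_iff[of f X Y x "app f x"] by (auto simp: func_def)

lemma func_elts: "func f X Y \<Longrightarrow> elts f = {pair x (app f x) | x. x \<in> elts X}"
proof
  assume f: "func f X Y"
  show "{pair x (app f x) | x. x \<in> elts X} \<subseteq> elts f" using f func_pair_iff by auto
  show "elts f \<subseteq> {pair x (app f x) | x. x \<in> elts X}"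
  proof
    fix p assume p: "p \<in> elts f"
    then obtain x y where "p = pair x y" using f unfolding func_def by (meson in_productE subsetD)
    then show "p \<in> {pair x (app f x) | x. x \<in> elts X}" using p f func_pair_iff by auto
  qed
qed

lemma func_eqI:
  assumes "func f X Y" "func g X Z" "\<And>x. x \<in> elts X \<Longrightarrow> app f x = app g x" shows "f = g"
  by (rule extensionality) (use assms in \<open>auto simp: func_elts\<close>)

text \<open>The bound \<open>Y\<close> on the values lets Separation carve the graph out of
  \<open>product X Y\<close>.\<close>

lemma func_exists:
  assumes "Def (\<lambda>e. P (e 0) (e 1))" "\<And>x. x \<in> elts X \<Longrightarrow> \<exists>!y. P x y"
    "\<And>x y. x \<in> elts X \<Longrightarrow> P x y \<Longrightarrow> y \<in> elts Y"
  obtains f where "func f X Y" "\<And>x. x \<in> elts X \<Longrightarrow> P x (app f x)"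
proof -
  have "Def (\<lambda>e. \<exists>x y. e 0 = pair x y \<and> P x y)"
    by (intro def_intros) (rule Def_subst2[OF assms(1)]; intro def_intros)
  then obtain f where f: "elts f = {p \<in> elts (product X Y). \<exists>x y. p = pair x y \<and> P x y}"
    using separation[of "\<lambda>p. \<exists>x y. p = pair x y \<and> P x y"] by blast
  have "\<exists>!y. pair x y \<in> elts f" if "x \<in> elts X" for x
    using assms(2)[OF that] assms(3)[OF that] that unfolding f by auto
  then have "func f X Y" unfolding func_def f by auto
  moreover have "P x (app f x)" if "x \<in> elts X" for x
    using that func_pair_iff[OF calculation, of x "app f x"] by (auto simp: f)
  ultimately show ?thesis using that by blast
qed

lemma lam_exists:
  assumes F: "DefF (\<lambda>e. F (e 0))" and Y: "\<And>x. x \<in> elts X \<Longrightarrow> F x \<in> elts Y"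
  obtains f where "func f X Y" "\<And>x. x \<in> elts X \<Longrightarrow> app f x = F x"
proof -
  have "Def (\<lambda>e. e 1 = F (e 0))" by (intro Def_eq DefF_var DefF_subst1[OF F])
  then show ?thesis using func_exists[of "\<lambda>x y. y = F x" X Y] Y that by blast
qed

text \<open>The injection must be an element of the model. Comparing the HOL sets
  \<open>elts X\<close> and \<open>elts Y\<close> instead would be pointless: over the universe
  \<open>nat\<close> all of them are countable.\<close>

definition lepoll :: "'a \<Rightarrow> 'a \<Rightarrow> bool" (infix "\<lesssim>" 50) where
  "X \<lesssim> Y \<longleftrightarrow> (\<exists>f. func f X Y \<and> inj_on (app f) (elts X))"

definition eqpoll :: "'a \<Rightarrow> 'a \<Rightarrow> bool" (infix "\<approx>" 50) where
  "X \<approx> Y \<longleftrightarrow> (\<exists>f. func f X Y \<and> bij_betw (app f) (elts X) (elts Y))"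

lemma Def_lepoll [def_intros]: "DefF f \<Longrightarrow> DefF g \<Longrightarrow> Def (\<lambda>e. f e \<lesssim> g e)"
  by (rule Def_subst2[where P = lepoll]) (unfold lepoll_def inj_on_def, intro def_intros)

lemma Def_bij: "Def (\<lambda>e. bij_betw (app (e 0)) (elts (e 1)) (elts (e 2)))"
proof -
  have "bij_betw (app f) (elts X) (elts Y) \<longleftrightarrow> (\<forall>x\<in>elts X. app f x \<in> elts Y) \<and>
      (\<forall>x\<in>elts X. \<forall>y\<in>elts X. app f x = app f y \<longrightarrow> x = y) \<and>
      (\<forall>y\<in>elts Y. \<exists>x\<in>elts X. y = app f x)" for f X Y
    unfolding bij_betw_def inj_on_def by auto
  then show ?thesis by (simp only:) (intro def_intros)
qed

lemma Def_eqpoll [def_intros]: "DefF f \<Longrightarrow> DefF g \<Longrightarrow> Def (\<lambda>e. f e \<approx> g e)"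
proof (rule Def_subst2[where P = eqpoll])
  show "Def (\<lambda>e. e 0 \<approx> e 1)"
    unfolding eqpoll_def
    using Def_subst3[OF Def_bij, of "\<lambda>e. e 0" "\<lambda>e. e 1" "\<lambda>e. e 2"]
    by (intro def_intros) (simp_all add: def_intros numeral_2_eq_2)
qed

lemma lepollI:
  assumes F: "DefF (\<lambda>e. F (e 0))" and "inj_on F (elts X)" and Y: "F ` elts X \<subseteq> elts Y"
  shows "X \<lesssim> Y"
proof -
  obtain f where "func f X Y" "\<And>x. x \<in> elts X \<Longrightarrow> app f x = F x"
    using lam_exists[OF F, of X Y] Y by blast
  then show ?thesis using assms(2) unfolding lepoll_def inj_on_def by metis
qed

lemma lepollE:
  assumes "X \<lesssim> Y" obtains f where "func f X Y" "inj_on (app f) (elts X)"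
  using assms lepoll_def by blast

lemma eqpollE:
  assumes "X \<approx> Y" obtains f where "func f X Y" "bij_betw (app f) (elts X) (elts Y)"
  using assms eqpoll_def by blast

lemma eqpollI:
  assumes F: "DefF (\<lambda>e. F (e 0))" and b: "bij_betw F (elts X) (elts Y)" shows "X \<approx> Y"
proof -
  obtain f where f: "func f X Y" "\<And>x. x \<in> elts X \<Longrightarrow> app f x = F x"
    using lam_exists[OF F, of X Y] b bij_betwE by metis
  then have "bij_betw (app f) (elts X) (elts Y)" using b bij_betw_cong by metis
  then show ?thesis using f(1) unfolding eqpoll_def by blast
qed

lemma subset_lepoll: "X \<sqsubseteq> Y \<Longrightarrow> X \<lesssim> Y"
  by (rule lepollI[where F = "\<lambda>x. x"]) (auto intro: def_intros)

lemma lepoll_refl [simp]: "X \<lesssim> X"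
  by (rule subset_lepoll) simp

lemma eqpoll_imp_lepoll: "X \<approx> Y \<Longrightarrow> X \<lesssim> Y"
  unfolding eqpoll_def lepoll_def bij_betw_def by blast

lemma lepoll_trans [trans]: "X \<lesssim> Y \<Longrightarrow> Y \<lesssim> Z \<Longrightarrow> X \<lesssim> Z"
proof -
  assume "X \<lesssim> Y" "Y \<lesssim> Z"
  then obtain f g where fg: "func f X Y" "inj_on (app f) (elts X)"
      "func g Y Z" "inj_on (app g) (elts Y)"
    by (meson lepollE)
  show ?thesis
    by (rule lepollI[where F = "\<lambda>x. app g (app f x)"])
      (intro def_intros, use fg in \<open>auto simp: inj_on_def\<close>)
qed

lemma inverse_exists:
  assumes "func f X Y" "inj_on (app f) (elts X)"
  obtains g where "\<And>x. x \<in> elts X \<Longrightarrow> app g (app f x) = x"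
proof -
  obtain R where R: "elts R = {y \<in> elts Y. \<exists>x\<in>elts X. y = app f x}"
    by (erule sepE) (intro def_intros)
  have ex: "\<exists>!x. x \<in> elts X \<and> y = app f x" if "y \<in> elts R" for y
    using that assms(2) unfolding R inj_on_def by auto
  have "Def (\<lambda>e. e 1 \<in> elts X \<and> e 0 = app f (e 1))" by (intro def_intros)
  then obtain g where g: "\<And>y. y \<in> elts R \<Longrightarrow> app g y \<in> elts X \<and> y = app f (app g y)"
    by (rule func_exists[of "\<lambda>y x. x \<in> elts X \<and> y = app f x" R X]) (use ex in blast)+
  have "app g (app f x) = x" if "x \<in> elts X" for x
  proof -
    have "app f x \<in> elts R" using that assms(1) by (auto simp: R)
    then show ?thesis using g that assms(2) by (metis inj_onD)
  qed
  then show ?thesis using that by blast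
qed

lemma eqpoll_sym: "X \<approx> Y \<Longrightarrow> Y \<approx> X"
proof -
  assume "X \<approx> Y"
  then obtain f where f: "func f X Y" "bij_betw (app f) (elts X) (elts Y)" by (rule eqpollE)
  then obtain g where g: "\<And>x. x \<in> elts X \<Longrightarrow> app g (app f x) = x"
    using inverse_exists by (metis bij_betw_def)
  have "bij_betw (app g) (elts Y) (elts X)"
    by (rule bij_betw_byWitness[where f' = "app f"])
      (use g in \<open>auto simp: bij_betw_imp_surj_on[OF f(2), symmetric]\<close>)
  then show ?thesis by (rule eqpollI[rotated]) (intro def_intros)
qed

lemma eqpoll_trans [trans]: "X \<approx> Y \<Longrightarrow> Y \<approx> Z \<Longrightarrow> X \<approx> Z"
proof -
  assume "X \<approx> Y" "Y \<approx> Z"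
  then obtain f g where "bij_betw (app f) (elts X) (elts Y)" "bij_betw (app g) (elts Y) (elts Z)"
    by (meson eqpollE)
  then have "bij_betw (\<lambda>x. app g (app f x)) (elts X) (elts Z)"
    using bij_betw_trans by (fastforce simp: comp_def)
  then show ?thesis by (rule eqpollI[rotated]) (intro def_intros)
qed

text \<open>The set \<open>S\<close> in the proof is the largest fixed point of \<open>S \<mapsto> X - g (Y - f S)\<close>.\<close>

theorem schroeder_bernstein:
  assumes "X \<lesssim> Y" "Y \<lesssim> X" shows "X \<approx> Y"
proof -
  obtain f g where f: "func f X Y" "inj_on (app f) (elts X)"
    and g: "func g Y X" "inj_on (app g) (elts Y)"
    using assms by (meson lepollE)
  obtain g' where g': "\<And>y. y \<in> elts Y \<Longrightarrow> app g' (app g y) = y" using inverse_exists[OF g] by blast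
  \<comment> \<open>\<open>Q T\<close> describes g (Y - f T). The sets \<open>T\<close> without an
    element satisfying \<open>Q T\<close> are closed under unions, since \<open>Q\<close> is
    antitone in \<open>T\<close>; \<open>S\<close> is the largest of them inside
    \<open>X\<close>.\<close>
  define Q where "Q T x \<longleftrightarrow> (\<exists>y\<in>elts Y. x = app g y \<and> \<not> (\<exists>t\<in>elts T. y = app f t))" for T x
  obtain S where S: "elts S = {x \<in> elts X. \<exists>T\<in>elts (pow X). x \<in> elts T \<and> (\<forall>t\<in>elts T. \<not> Q T t)}"
  proof -
    have "Def (\<lambda>e. \<exists>T\<in>elts (pow X). e 0 \<in> elts T \<and> (\<forall>t\<in>elts T. \<not> Q T t))"
      unfolding Q_def by (intro def_intros)
    from separation[OF this, of X] show ?thesis using that by blast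
  qed
  have mono: "Q S x \<Longrightarrow> T \<sqsubseteq> S \<Longrightarrow> Q T x" for x T
    unfolding Q_def by blast
  have S1: "\<not> Q S x" if "x \<in> elts S" for x
  proof -
    obtain T where T: "T \<sqsubseteq> X" "x \<in> elts T" "\<forall>t\<in>elts T. \<not> Q T t"
      using \<open>x \<in> elts S\<close> unfolding S by auto
    then have "T \<sqsubseteq> S" by (auto simp: S)
    then show ?thesis using T mono by blast
  qed
  have S2: "x \<in> elts S" if "x \<in> elts X" "\<not> Q S x" for x
  proof -
    let ?T = "un S (upair x x)"
    have "\<not> Q ?T t" if "t \<in> elts ?T" for t
      using that S1 \<open>\<not> Q S x\<close> unfolding Q_def by auto
    moreover have "?T \<sqsubseteq> X" using that(1) S by auto
    ultimately have "\<exists>T\<in>elts (pow X). x \<in> elts T \<and> (\<forall>t\<in>elts T. \<not> Q T t)"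
      by (intro bexI[of _ ?T]) auto
    then show ?thesis using that(1) S by auto
  qed
  have out: "\<exists>y\<in>elts Y. x = app g y \<and> \<not> (\<exists>t\<in>elts S. y = app f t)"
    if "x \<in> elts X" "x \<notin> elts S" for x
    using that S2 unfolding Q_def by blast
  have SX: "S \<sqsubseteq> X" using S by auto
  \<comment> \<open>The bijection is \<open>f\<close> on \<open>S\<close> and inverts
    \<open>g\<close> elsewhere, which is possible because a point of \<open>X\<close> outside
    \<open>S\<close> is a value of \<open>g\<close> at a point outside the image of \<open>S\<close>
    under \<open>f\<close>.\<close>
  have "Def (\<lambda>e. e 0 \<in> elts S \<and> e 1 = app f (e 0) \<or> e 0 \<notin> elts S \<and> e 1 = app g' (e 0))"
    by (intro def_intros)
  then obtain h where h: "func h X Y"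
      "\<And>x. x \<in> elts X \<Longrightarrow> x \<in> elts S \<and> app h x = app f x \<or> x \<notin> elts S \<and> app h x = app g' x"
  proof (rule func_exists[where X = X and Y = Y])
    show "y \<in> elts Y" if "x \<in> elts X" "x \<in> elts S \<and> y = app f x \<or> x \<notin> elts S \<and> y = app g' x"
      for x y
      using that f(1) out g' by fastforce
  qed auto
  have "inj_on (app h) (elts X)"
  proof (rule inj_onI)
    fix x x' assume x: "x \<in> elts X" "x' \<in> elts X" and e: "app h x = app h x'"
    have *: "app f a \<noteq> app g' b" if "a \<in> elts S" "b \<in> elts X" "b \<notin> elts S" for a b
      using out[OF that(2,3)] that(1) g' by metis
    have **: "b = app g (app g' b)" if "b \<in> elts X" "b \<notin> elts S" for b
      using out[OF that] g' by metis
    show "x = x'"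
      using h(2)[OF x(1)] h(2)[OF x(2)] e * ** x f(2) by (metis inj_onD)
  qed
  moreover have "elts Y \<subseteq> app h ` elts X"
  proof
    fix y assume y: "y \<in> elts Y"
    show "y \<in> app h ` elts X"
    proof (cases "\<exists>t\<in>elts S. y = app f t")
      case True
      then show ?thesis using h(2) SX by (metis image_eqI subsetD)
    next
      case False
      then have "app g y \<notin> elts S" using S1 y unfolding Q_def by blast
      moreover have "app g y \<in> elts X" using g y by simp
      ultimately have "app h (app g y) = y" using h(2)[of "app g y"] g'[OF y] by auto
      then show ?thesis using \<open>app g y \<in> elts X\<close> by (metis imageI)
    qed
  qed
  ultimately have "bij_betw (app h) (elts X) (elts Y)" using h(1) by (auto simp: bij_betw_def)
  then show ?thesis using h(1) by (auto simp: eqpoll_def)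
qed


section \<open>Ordinals in a model\<close>

lemma DefF_if [def_intros]:
  assumes "Def P" "DefF f" "DefF g" shows "DefF (\<lambda>e. if P e then f e else g e)"
proof -
  have "Def (\<lambda>e. P (\<lambda>i. e (Suc i)))" by (rule Def_ren[OF assms(1)])
  then have "Def (\<lambda>e. P (\<lambda>i. e (Suc i)) \<and> e 0 = f (\<lambda>i. e (Suc i)) \<or>
      \<not> P (\<lambda>i. e (Suc i)) \<and> e 0 = g (\<lambda>i. e (Suc i)))" (is "Def ?Q")
    by (intro def_intros DefF_Suc assms(2,3))
  moreover have "?Q = (\<lambda>e. e 0 =
      (if P (\<lambda>i. e (Suc i)) then f (\<lambda>i. e (Suc i)) else g (\<lambda>i. e (Suc i))))"
    by (rule ext) auto
  ultimately show ?thesis unfolding DefF_def by simp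
qed

definition pfst :: "'a \<Rightarrow> 'a" where
  "pfst p = (if \<exists>x y. p = pair x y then THE x. \<exists>y. p = pair x y else emptyset)"

definition psnd :: "'a \<Rightarrow> 'a" where
  "psnd p = (if \<exists>x y. p = pair x y then THE y. \<exists>x. p = pair x y else emptyset)"

lemma pfst_pair [simp]: "pfst (pair x y) = x"
  and psnd_pair [simp]: "psnd (pair x y) = y"
  by (auto simp: pfst_def psnd_def)

lemma DefF_pfst [def_intros]: "DefF f \<Longrightarrow> DefF (\<lambda>e. pfst (f e))"
proof (rule DefF_subst1[where F = pfst])
  have "a = pfst p \<longleftrightarrow> (\<exists>y. p = pair a y) \<or> \<not> (\<exists>x y. p = pair x y) \<and> a = emptyset" for a p
    by (cases "\<exists>x y. p = pair x y") (auto simp: pfst_def)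
  then show "DefF (\<lambda>e. pfst (e 0))" unfolding DefF_def by (simp only:) (intro def_intros)
qed

lemma DefF_psnd [def_intros]: "DefF f \<Longrightarrow> DefF (\<lambda>e. psnd (f e))"
proof (rule DefF_subst1[where F = psnd])
  have "a = psnd p \<longleftrightarrow> (\<exists>x. p = pair x a) \<or> \<not> (\<exists>x y. p = pair x y) \<and> a = emptyset" for a p
    by (cases "\<exists>x y. p = pair x y") (auto simp: psnd_def)
  then show "DefF (\<lambda>e. psnd (e 0))" unfolding DefF_def by (simp only:) (intro def_intros)
qed

text \<open>Under Foundation hereditary transitivity suffices; that membership is linear on such a
  set is proved in \<open>Ord_linear\<close>.\<close>

definition Ord :: "'a \<Rightarrow> bool" where
  "Ord a \<longleftrightarrow> (\<forall>x\<in>elts a. x \<sqsubseteq> a) \<and> (\<forall>x\<in>elts a. \<forall>y\<in>elts x. y \<sqsubseteq> x)"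

lemma Def_Ord [def_intros]: "DefF f \<Longrightarrow> Def (\<lambda>e. Ord (f e))"
  by (rule Def_subst1[where P = Ord]) (unfold Ord_def, intro def_intros)

lemma Ord_mem: "Ord a \<Longrightarrow> b \<in> elts a \<Longrightarrow> Ord b"
  unfolding Ord_def by blast

lemma Ord_subset: "Ord a \<Longrightarrow> b \<in> elts a \<Longrightarrow> b \<sqsubseteq> a"
  unfolding Ord_def by blast

lemma Ord_trans: "Ord a \<Longrightarrow> b \<in> elts a \<Longrightarrow> c \<in> elts b \<Longrightarrow> c \<in> elts a"
  unfolding Ord_def by blast

lemma Ord_I: "(\<And>x. x \<in> elts a \<Longrightarrow> Ord x) \<Longrightarrow> (\<And>x. x \<in> elts a \<Longrightarrow> x \<sqsubseteq> a) \<Longrightarrow> Ord a"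
  unfolding Ord_def by blast

lemma Ord_suc: "Ord a \<Longrightarrow> Ord (suc a)"
  by (rule Ord_I) (auto intro: Ord_mem Ord_trans)

lemma Ord_emptyset: "Ord emptyset"
  by (rule Ord_I) auto

lemma Ord_minimal:
  assumes P: "Def (\<lambda>e. P (e 0))" and "Ord a" "P a"
  obtains b where "Ord b" "P b" "\<And>c. c \<in> elts b \<Longrightarrow> \<not> P c" "b \<sqsubseteq> a"
proof -
  \<comment> \<open>Searching in \<open>suc a\<close> allows \<open>a\<close> itself to be the
    answer.\<close>
  obtain b where b: "b \<in> elts (suc a)" "P b" "\<And>z. z \<in> elts (suc a) \<Longrightarrow> z \<in> elts b \<Longrightarrow> \<not> P z"
    using Def_minimal[OF P, of a "suc a"] \<open>P a\<close> by auto
  have 1: "b \<sqsubseteq> a" "Ord b"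
    using b(1) \<open>Ord a\<close> by (auto intro: Ord_mem Ord_trans)
  then have "\<not> P c" if "c \<in> elts b" for c using b(3)[of c] that by auto
  then show ?thesis using that b 1 by blast
qed

lemma Ord_induct [consumes 2, case_names step]:
  assumes P: "Def (\<lambda>e. P (e 0))" and a: "Ord a"
    and step: "\<And>a. Ord a \<Longrightarrow> (\<And>b. b \<in> elts a \<Longrightarrow> P b) \<Longrightarrow> P a"
  shows "P a"
proof (rule ccontr)
  assume n: "\<not> P a"
  obtain b where "Ord b" "\<not> P b" "\<And>c. c \<in> elts b \<Longrightarrow> P c"
    by (rule Ord_minimal[OF Def_not[OF P] a n]) blast
  then show False using step by blast
qed

text \<open>Double induction, outside on \<open>a\<close> for all \<open>b\<close>, inside on
  \<open>b\<close>. If neither ordinal belongs to the other, the two induction hypotheses force them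
  to have the same elements.\<close>

lemma Ord_linear: "Ord a \<Longrightarrow> Ord b \<Longrightarrow> a \<in> elts b \<or> a = b \<or> b \<in> elts a"
proof -
  assume "Ord a" "Ord b"
  define T where "T a b \<longleftrightarrow> a \<in> elts b \<or> a = b \<or> b \<in> elts a" for a b
  have "Def (\<lambda>e. \<forall>b. Ord b \<longrightarrow> T (e 0) b)" unfolding T_def by (intro def_intros)
  then have "\<forall>b. Ord b \<longrightarrow> T a b" using \<open>Ord a\<close>
  proof (induction rule: Ord_induct)
    case (step a)
    show ?case
    proof (intro allI impI)
      fix b assume "Ord b"
      have "Def (\<lambda>e. T a (e 0))" unfolding T_def by (intro def_intros)
      then show "T a b" using \<open>Ord b\<close>
      proof (induction rule: Ord_induct)
        case (step b)
        have "a = b" if "a \<notin> elts b" "b \<notin> elts a"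
        proof (rule extensionality, rule set_eqI)
          fix c
          have "c \<in> elts b" if "c \<in> elts a"
          proof -
            have "T c b" using \<open>\<And>c. c \<in> elts a \<Longrightarrow> \<forall>b. Ord b \<longrightarrow> T c b\<close> that \<open>Ord b\<close> by blast
            then show ?thesis
              using that \<open>b \<notin> elts a\<close> Ord_trans[OF \<open>Ord a\<close> that] unfolding T_def by blast
          qed
          moreover have "c \<in> elts a" if "c \<in> elts b"
            using step.IH[OF that] that \<open>a \<notin> elts b\<close> Ord_trans[OF \<open>Ord b\<close> that]
            unfolding T_def by blast
          ultimately show "c \<in> elts a \<longleftrightarrow> c \<in> elts b" by blast
        qed
        then show ?case unfolding T_def by blast
      qed
    qed
  qed
  then show ?thesis using \<open>Ord b\<close> unfolding T_def by blast
qed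

lemma Ord_subset_iff: "Ord a \<Longrightarrow> Ord b \<Longrightarrow> a \<sqsubseteq> b \<longleftrightarrow> a \<in> elts b \<or> a = b"
  using Ord_linear[of a b] Ord_subset[of b a] not_mem_self[of b] by blast

lemma Ord_not_mem: "Ord a \<Longrightarrow> Ord b \<Longrightarrow> a \<notin> elts b \<Longrightarrow> b \<sqsubseteq> a"
  using Ord_linear Ord_subset by blast

subsection \<open>Hartogs' theorem\<close>

text \<open>\<open>R\<close> is the order of the ordinal carried over by an injection. It is taken
  reflexive so that \<open>R\<close> determines the range of the injection even when there is just
  one point. By induction, elements of \<open>a\<close> and \<open>b\<close> with the same image
  coincide, so \<open>R\<close> determines the ordinal.\<close>

lemma order_code_unique:
  assumes ab: "Ord a" "Ord b"
    and inj: "inj_on (app f) (elts a)" "inj_on (app g) (elts b)"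
    and f: "\<And>p. p \<in> elts R \<longleftrightarrow>
      (\<exists>x\<in>elts a. \<exists>y\<in>elts a. p = pair (app f x) (app f y) \<and> (x \<in> elts y \<or> x = y))"
    and g: "\<And>p. p \<in> elts R \<longleftrightarrow>
      (\<exists>x\<in>elts b. \<exists>y\<in>elts b. p = pair (app g x) (app g y) \<and> (x \<in> elts y \<or> x = y))"
  shows "a = b"
proof -
  have F: "pair (app f x) (app f y) \<in> elts R \<longleftrightarrow> x \<in> elts y \<or> x = y"
    if "x \<in> elts a" "y \<in> elts a" for x y
    using inj(1) that unfolding f by (auto simp: inj_on_def)
  have G: "pair (app g x) (app g y) \<in> elts R \<longleftrightarrow> x \<in> elts y \<or> x = y"
    if "x \<in> elts b" "y \<in> elts b" for x y
    using inj(2) that unfolding g by (auto simp: inj_on_def)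
  have fg: "\<exists>y\<in>elts b. app f x = app g y" if "x \<in> elts a" for x
    using F[OF that that] unfolding g by auto
  have gf: "\<exists>x\<in>elts a. app f x = app g y" if "y \<in> elts b" for y
    using G[OF that that] unfolding f by auto
  have eq: "\<forall>y\<in>elts b. x \<in> elts a \<and> app f x = app g y \<longrightarrow> x = y" if "Ord x" for x
  proof -
    have "Def (\<lambda>e. \<forall>y\<in>elts b. e 0 \<in> elts a \<and> app f (e 0) = app g y \<longrightarrow> e 0 = y)"
      by (intro def_intros)
    then show ?thesis using that
    proof (induction rule: Ord_induct)
      case (step x)
      show ?case
      proof (intro ballI impI, elim conjE)
        fix y assume y: "y \<in> elts b" and x: "x \<in> elts a" and xy: "app f x = app g y"
        show "x = y"
        proof (rule extensionality, rule set_eqI)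
          fix z
          have "z \<in> elts y" if z: "z \<in> elts x"
          proof -
            have za: "z \<in> elts a" using ab(1) x z Ord_trans by blast
            obtain u where u: "u \<in> elts b" "app f z = app g u" using fg[OF za] by blast
            have "z = u" using step.IH[OF z] u za by blast
            moreover have "u \<in> elts y \<or> u = y" using F[OF za x] G[OF u(1) y] z u(2) xy by simp
            moreover have "u \<noteq> y" using u(2) xy inj(1) za x z not_mem_self by (metis inj_onD)
            ultimately show ?thesis by simp
          qed
          moreover have "z \<in> elts x" if z: "z \<in> elts y"
          proof -
            have zb: "z \<in> elts b" using ab(2) y z Ord_trans by blast
            obtain u where u: "u \<in> elts a" "app f u = app g z" using gf[OF zb] by blast
            have "u \<in> elts x \<or> u = x" using F[OF u(1) x] G[OF zb y] z u(2) xy by simp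
            moreover have "u \<noteq> x" using u(2) xy inj(2) zb y z not_mem_self by (metis inj_onD)
            ultimately have "u \<in> elts x" by simp
            then show ?thesis using step.IH[of u] u zb by blast
          qed
          ultimately show "z \<in> elts x \<longleftrightarrow> z \<in> elts y" by blast
        qed
      qed
    qed
  qed
  show ?thesis
  proof (rule extensionality, rule set_eqI)
    fix x
    show "x \<in> elts a \<longleftrightarrow> x \<in> elts b"
    proof
      assume x: "x \<in> elts a"
      then obtain y where "y \<in> elts b" "app f x = app g y" using fg by blast
      then show "x \<in> elts b" using eq[OF Ord_mem[OF ab(1) x]] x by blast
    next
      assume x: "x \<in> elts b"
      then obtain y where "y \<in> elts a" "app f y = app g x" using gf by blast
      then show "x \<in> elts a" using eq[OF Ord_mem[OF ab(1)]] x by blast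
    qed
  qed
qed

text \<open>The ordinals embedding in \<open>A\<close> form a set by Replacement, since each is
  determined by a code among the subsets of \<open>product A A\<close>. That set is an ordinal, and
  if it embedded in \<open>A\<close> it would be an element of itself.\<close>

theorem hartogs: obtains h where "Ord h" "\<not> h \<lesssim> A"
proof -
  define C where "C R a f \<longleftrightarrow> func f a A \<and> inj_on (app f) (elts a) \<and> (\<forall>p. p \<in> elts R \<longleftrightarrow>
      (\<exists>x\<in>elts a. \<exists>y\<in>elts a. p = pair (app f x) (app f y) \<and> (x \<in> elts y \<or> x = y)))" for R a f
  have "Def (\<lambda>e. Ord (e 1) \<and> (\<exists>f. C (e 0) (e 1) f))"
    unfolding C_def inj_on_def by (intro def_intros)
  moreover have "a = b"
    if *: "Ord a \<and> (\<exists>f. C R a f)" "Ord b \<and> (\<exists>f. C R b f)" for R a b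
  proof -
    obtain f g where fg: "C R a f" "C R b g" using * by blast
    note c = fg[unfolded C_def, THEN conjunct2, THEN conjunct2, rule_format]
    show ?thesis
      by (rule order_code_unique[OF _ _ _ _ c]) (use * fg in \<open>auto simp: C_def\<close>)
  qed
  ultimately have "\<exists>h. elts h = {a. \<exists>R\<in>elts (pow (product A A)). Ord a \<and> (\<exists>f. C R a f)}"
    by (rule replacement)
  then obtain h where h: "elts h = {a. \<exists>R\<in>elts (pow (product A A)). Ord a \<and> (\<exists>f. C R a f)}" ..
  have h: "a \<in> elts h \<longleftrightarrow> Ord a \<and> a \<lesssim> A" for a
  proof
    show "a \<in> elts h \<Longrightarrow> Ord a \<and> a \<lesssim> A" unfolding h C_def lepoll_def by blast
    assume a: "Ord a \<and> a \<lesssim> A"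
    then obtain f where f: "func f a A" "inj_on (app f) (elts a)" by (meson lepollE)
    obtain R where R: "elts R = {p \<in> elts (product A A).
        \<exists>x\<in>elts a. \<exists>y\<in>elts a. p = pair (app f x) (app f y) \<and> (x \<in> elts y \<or> x = y)}"
      by (erule sepE) (intro def_intros)
    have "C R a f" using f unfolding C_def R by auto
    moreover have "R \<in> elts (pow (product A A))" using R by auto
    ultimately show "a \<in> elts h" using a unfolding h by blast
  qed
  have "Ord h"
  proof (rule Ord_I)
    show "Ord x" if "x \<in> elts h" for x using that h by blast
    show "x \<sqsubseteq> h" if "x \<in> elts h" for x
    proof
      fix y assume y: "y \<in> elts x"
      have x: "Ord x" "x \<lesssim> A" using that h by blast+
      have "y \<lesssim> A" by (rule lepoll_trans[OF subset_lepoll[OF Ord_subset[OF x(1) y]] x(2)])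
      then show "y \<in> elts h" using h Ord_mem[OF x(1) y] by blast
    qed
  qed
  moreover have "\<not> h \<lesssim> A" using h calculation not_mem_self by blast
  ultimately show ?thesis using that by blast
qed

text \<open>The element with the least image under \<open>h\<close>. Uniqueness makes it the value
  of a definable relation, so that choice functions arise without the axiom of choice.\<close>

lemma lepoll_Ord_least_element:
  assumes h: "func h X a" "inj_on (app h) (elts X)" and a: "Ord a"
    and x: "elts x \<noteq> {}" "x \<sqsubseteq> X"
  shows "\<exists>!y. y \<in> elts x \<and> (\<forall>z\<in>elts x. z \<noteq> y \<longrightarrow> app h y \<in> elts (app h z))"
proof -
  have m: "app h z \<in> elts a" if "z \<in> elts x" for z using that h x by auto
  obtain z where "z \<in> elts x" using x by blast
  have D: "Def (\<lambda>e. \<exists>y\<in>elts x. e 0 = app h y)" by (intro def_intros)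
  obtain b where b: "\<exists>y\<in>elts x. b = app h y"
      "\<And>c. c \<in> elts a \<Longrightarrow> c \<in> elts b \<Longrightarrow> \<not> (\<exists>y\<in>elts x. c = app h y)"
    by (rule Def_minimal[where P = "\<lambda>c. \<exists>y\<in>elts x. c = app h y", OF D m[OF \<open>z \<in> elts x\<close>]])
      (use \<open>z \<in> elts x\<close> in blast)+
  then obtain y where y: "y \<in> elts x" "b = app h y" by blast
  have "app h y \<in> elts (app h z)" if "z \<in> elts x" "z \<noteq> y" for z
  proof -
    have "app h z \<noteq> app h y" using that y h(2) x by (metis inj_onD subsetD)
    moreover have "app h z \<notin> elts (app h y)" using b(2) m y that by blast
    ultimately show ?thesis
      using Ord_linear[OF Ord_mem[OF a m[OF y(1)]] Ord_mem[OF a m[OF that(1)]]] by auto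
  qed
  note least = this
  show ?thesis
  proof (rule ex1I[of _ y])
    show "y \<in> elts x \<and> (\<forall>z\<in>elts x. z \<noteq> y \<longrightarrow> app h y \<in> elts (app h z))"
      using y least by blast
    show "w = y" if "w \<in> elts x \<and> (\<forall>z\<in>elts x. z \<noteq> w \<longrightarrow> app h w \<in> elts (app h z))" for w
      using that least[of w] y(1) not_mem_sym by metis
  qed
qed

definition choice :: "'a \<Rightarrow> bool" where
  "choice Y \<longleftrightarrow> (\<exists>f U. func f Y U \<and> (\<forall>y\<in>elts Y. app f y \<in> elts y))"

lemma choiceI:
  assumes "Def (\<lambda>e. P (e 0) (e 1))" "\<And>x. x \<in> elts X \<Longrightarrow> \<exists>!y. P x y"
    "\<And>x y. x \<in> elts X \<Longrightarrow> P x y \<Longrightarrow> y \<in> elts x"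
  shows "choice X"
proof -
  obtain f where "func f X (union X)" "\<And>x. x \<in> elts X \<Longrightarrow> P x (app f x)"
    by (rule func_exists[OF assms(1), of X "union X"]) (use assms(2,3) in fastforce)+
  then show ?thesis unfolding choice_def using assms(3) by blast
qed

lemma choice_lepoll_Ord:
  assumes "union X \<lesssim> a" "Ord a" "\<And>x. x \<in> elts X \<Longrightarrow> elts x \<noteq> {}" shows "choice X"
proof -
  obtain h where h: "func h (union X) a" "inj_on (app h) (elts (union X))"
    using assms(1) by (rule lepollE)
  show ?thesis
  proof (rule choiceI)
    show "Def (\<lambda>e. e 1 \<in> elts (e 0) \<and> (\<forall>z\<in>elts (e 0). z \<noteq> e 1 \<longrightarrow> app h (e 1) \<in> elts (app h z)))"
      by (intro def_intros)
    show "\<exists>!y. y \<in> elts x \<and> (\<forall>z\<in>elts x. z \<noteq> y \<longrightarrow> app h y \<in> elts (app h z))"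
      if "x \<in> elts X" for x
      by (rule lepoll_Ord_least_element[OF h assms(2)]) (use that assms(3) in auto)
  qed auto
qed

subsection \<open>The natural numbers\<close>

definition ind_set :: "'a \<Rightarrow> bool" where
  "ind_set w \<longleftrightarrow> emptyset \<in> elts w \<and> (\<forall>x\<in>elts w. suc x \<in> elts w)"

lemma Def_ind_set [def_intros]: "DefF f \<Longrightarrow> Def (\<lambda>e. ind_set (f e))"
  by (rule Def_subst1[where P = ind_set]) (unfold ind_set_def, intro def_intros)

lemma is_empty_iff [simp]: "x < d \<Longrightarrow> holds mem l d (is_empty x) \<longleftrightarrow> l x = emptyset"
  unfolding is_empty_def elts_emptyset_iff[symmetric] by (auto simp: elts_def)

lemma is_upair_iff [simp]:
  "p < d \<Longrightarrow> x < d \<Longrightarrow> y < d \<Longrightarrow> holds mem l d (is_upair p x y) \<longleftrightarrow> l p = upair (l x) (l y)"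
  unfolding is_upair_def elts_eq_iff[symmetric, of "l p"] by (auto simp: elts_def[of "l p"])

lemma is_pair_iff [simp]:
  "p < d \<Longrightarrow> x < d \<Longrightarrow> y < d \<Longrightarrow> holds mem l d (is_pair p x y) \<longleftrightarrow> l p = pair (l x) (l y)"
  unfolding is_pair_def pair_def elts_eq_iff[symmetric, of "l p"] by (auto simp: elts_def[of "l p"])

lemma is_succ_iff [simp]:
  "s < d \<Longrightarrow> x < d \<Longrightarrow> holds mem l d (is_succ s x) \<longleftrightarrow> l s = suc (l x)"
  unfolding is_succ_def elts_eq_iff[symmetric, of "l s"]
  by (auto simp: elts_def[of "l s"] elts_def[of "l x"])

lemma is_inductive_iff [simp]:
  "w < d \<Longrightarrow> holds mem l d (is_inductive w) \<longleftrightarrow> ind_set (l w)"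
  unfolding is_inductive_def ind_set_def by (simp add: elts_def)

lemma is_subset_iff [simp]:
  "x < d \<Longrightarrow> y < d \<Longrightarrow> holds mem l d (x \<^bold>\<subseteq> y) \<longleftrightarrow> l x \<sqsubseteq> l y"
  unfolding is_subset_def by (auto simp: elts_def)

definition omega :: "'a" where
  "omega = (THE w. ind_set w \<and> (\<forall>v. ind_set v \<longrightarrow> w \<sqsubseteq> v))"

lemma omega_unique: "\<exists>!w. ind_set w \<and> (\<forall>v. ind_set v \<longrightarrow> w \<sqsubseteq> v)"
proof -
  have "holds mem undefined 0 Infinity" by (rule holds_axiom) (simp add: ZF_def)
  then obtain i where i: "ind_set i" by (auto simp: Infinity_def)
  obtain w where w: "elts w = {n \<in> elts i. \<forall>v. ind_set v \<longrightarrow> n \<in> elts v}"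
    by (erule sepE) (intro def_intros)
  have "ind_set w" using i unfolding ind_set_def[of w] w by (auto simp: ind_set_def)
  moreover have "w \<sqsubseteq> v" if "ind_set v" for v using that w by auto
  ultimately show ?thesis using extensionality by (metis subset_antisym)
qed

lemma omega: "ind_set omega" "ind_set v \<Longrightarrow> omega \<sqsubseteq> v"
  using theI'[OF omega_unique] unfolding omega_def by auto

lemma omega_iff: "ind_set w \<and> (\<forall>v. ind_set v \<longrightarrow> w \<sqsubseteq> v) \<longleftrightarrow> w = omega"
  using omega omega_unique by metis

lemma is_omega_iff [simp]: "w < d \<Longrightarrow> holds mem l d (is_omega w) \<longleftrightarrow> l w = omega"
  unfolding is_omega_def by (simp add: omega_iff)

lemma emptyset_in_omega [simp]: "emptyset \<in> elts omega"
  and suc_in_omega [simp]: "n \<in> elts omega \<Longrightarrow> suc n \<in> elts omega"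
  using omega(1) by (auto simp: ind_set_def)

lemma omega_induct [consumes 2, case_names zero suc]:
  assumes "Def (\<lambda>e. P (e 0))" "n \<in> elts omega" "P emptyset"
    "\<And>n. n \<in> elts omega \<Longrightarrow> P n \<Longrightarrow> P (suc n)"
  shows "P n"
proof -
  obtain v where v: "elts v = {n \<in> elts omega. P n}" using separation[OF assms(1)] by blast
  have "ind_set v" using assms(3,4) by (auto simp: ind_set_def v)
  then show ?thesis using omega(2) assms(2) v by blast
qed

lemma omega_Ord_mem: "n \<in> elts omega \<Longrightarrow> Ord n"
proof -
  assume n: "n \<in> elts omega"
  have "Def (\<lambda>e. Ord (e 0))" by (intro def_intros)
  then show ?thesis using n by (induction rule: omega_induct) (auto intro: Ord_emptyset Ord_suc)
qed

lemma omega_transitive: "n \<in> elts omega \<Longrightarrow> n \<sqsubseteq> omega"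
proof -
  assume n: "n \<in> elts omega"
  have "Def (\<lambda>e. e 0 \<sqsubseteq> omega)" by (intro def_intros)
  then show ?thesis using n by (induction rule: omega_induct) auto
qed

lemma Ord_omega: "Ord omega"
  using omega_Ord_mem omega_transitive by (rule Ord_I)

lemma omega_cases:
  assumes "n \<in> elts omega" obtains "n = emptyset" | m where "m \<in> elts omega" "n = suc m"
proof -
  have "Def (\<lambda>e. e 0 = emptyset \<or> (\<exists>m\<in>elts omega. e 0 = suc m))" by (intro def_intros)
  then have "n = emptyset \<or> (\<exists>m\<in>elts omega. n = suc m)" using assms
    by (induction rule: omega_induct) auto
  then show ?thesis using that by blast
qed

lemma not_suc_lepoll: "n \<in> elts omega \<Longrightarrow> \<not> suc n \<lesssim> n"
proof -
  assume n: "n \<in> elts omega"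
  have "Def (\<lambda>e. \<not> suc (e 0) \<lesssim> e 0)" by (intro def_intros)
  then show ?thesis using n
  proof (induction rule: omega_induct)
    case zero
    then show ?case by (auto elim!: lepollE dest: func_app[of _ "suc emptyset" emptyset emptyset])
  next
    case (suc n)
    have "suc n \<lesssim> n" if "suc (suc n) \<lesssim> suc n"
    proof -
      from that obtain f where f: "func f (suc (suc n)) (suc n)" "inj_on (app f) (elts (suc (suc n)))"
        by (rule lepollE)
      have m: "app f x = n \<or> app f x \<in> elts n" if "x \<in> elts (suc (suc n))" for x
        using func_app[OF f(1) that] by simp
      have sn: "suc n \<noteq> n" "suc n \<notin> elts n"
        using not_mem_self[of n] not_mem_sym[of "suc n" n] by (metis elts_suc insertI1)+
      have i: "app f x = app f y \<longleftrightarrow> x = y" if "x \<in> elts (suc (suc n))" "y \<in> elts (suc (suc n))" for x y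
        using f(2) that by (metis inj_onD)
      have n0: "app f (suc n) \<in> elts n" if "x \<in> elts (suc n)" "app f x = n" for x
        using m[of "suc n"] i[of x "suc n"] that sn by auto
      have ne: "app f x \<noteq> app f (suc n)" if "x \<in> elts (suc n)" for x
        using i[of x "suc n"] that sn by auto
      \<comment> \<open>The point \<open>suc n\<close> is dropped from the domain, which frees its
        value to replace the forbidden value \<open>n\<close>.\<close>
      show ?thesis
      proof (rule lepollI[where F = "\<lambda>x. if app f x = n then app f (suc n) else app f x"])
        show "DefF (\<lambda>e. if app f (e 0) = n then app f (suc n) else app f (e 0))"
          by (intro def_intros)
        show "inj_on (\<lambda>x. if app f x = n then app f (suc n) else app f x) (elts (suc n))"
        proof (rule inj_onI)
          fix x y assume "x \<in> elts (suc n)" "y \<in> elts (suc n)"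
            "(if app f x = n then app f (suc n) else app f x)
             = (if app f y = n then app f (suc n) else app f y)"
          then show "x = y" using i[of x y] ne[of x] ne[of y] by (auto split: if_splits)
        qed
        show "(\<lambda>x. if app f x = n then app f (suc n) else app f x) ` elts (suc n) \<subseteq> elts n"
          using m n0 by auto
      qed
    qed
    then show ?case using suc by blast
  qed
qed

lemma not_omega_lepoll: "n \<in> elts omega \<Longrightarrow> \<not> omega \<lesssim> n"
  using not_suc_lepoll lepoll_trans[OF subset_lepoll, of "suc n" omega n]
    omega_transitive[of "suc n"] by auto

lemma lepoll_omega_cases:
  assumes "Ord a" "\<not> omega \<lesssim> a" shows "a \<in> elts omega"
  using assms Ord_not_mem[OF assms(1) Ord_omega] subset_lepoll by blast

text \<open>A bound by a natural number, suited to cardinal arithmetic. The finiteness of the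
  statement, |X| < aleph_0, stays in the form
  \<open>X \<lesssim> omega \<and> \<not> X \<approx> omega\<close> where families of finite sets
  are treated.\<close>

definition Fin :: "'a \<Rightarrow> bool" where
  "Fin X \<longleftrightarrow> (\<exists>n\<in>elts omega. X \<lesssim> n)"

lemma Def_Fin [def_intros]: "DefF f \<Longrightarrow> Def (\<lambda>e. Fin (f e))"
  by (rule Def_subst1[where P = Fin]) (unfold Fin_def, intro def_intros)

lemma Fin_not_omega: "Fin X \<Longrightarrow> \<not> omega \<lesssim> X"
  using not_omega_lepoll lepoll_trans unfolding Fin_def by blast

lemma Fin_lepoll: "Fin Y \<Longrightarrow> X \<lesssim> Y \<Longrightarrow> Fin X"
  using lepoll_trans unfolding Fin_def by blast

lemma Fin_emptyset: "Fin emptyset"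
  unfolding Fin_def by (rule bexI[of _ emptyset]) auto

lemma Fin_insert: "Fin X \<Longrightarrow> Fin (un X (upair x x))"
proof -
  assume "Fin X"
  then obtain n f where n: "n \<in> elts omega" and f: "func f X n" "inj_on (app f) (elts X)"
    unfolding Fin_def by (meson lepollE)
  have "un X (upair x x) \<lesssim> suc n"
  proof (rule lepollI[where F = "\<lambda>y. if y \<in> elts X then app f y else n"])
    show "DefF (\<lambda>e. if e 0 \<in> elts X then app f (e 0) else n)" by (intro def_intros)
    have "app f y \<noteq> n" if "y \<in> elts X" for y using func_app[OF f(1) that] not_mem_self by metis
    then show "inj_on (\<lambda>y. if y \<in> elts X then app f y else n) (elts (un X (upair x x)))"
      using f(2) unfolding inj_on_def by (auto split: if_splits)
    show "(\<lambda>y. if y \<in> elts X then app f y else n) ` elts (un X (upair x x)) \<subseteq> elts (suc n)"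
      using f(1) by auto
  qed
  then show ?thesis using n unfolding Fin_def by (meson suc_in_omega)
qed

lemma Fin_un: "Fin X \<Longrightarrow> Fin Y \<Longrightarrow> Fin (un X Y)"
proof -
  assume X: "Fin X" and "Fin Y"
  then obtain n where n: "n \<in> elts omega" "Y \<lesssim> n" unfolding Fin_def by blast
  have "Def (\<lambda>e. \<forall>Y. Y \<lesssim> e 0 \<longrightarrow> Fin (un X Y))" by (intro def_intros)
  then have "\<forall>Y. Y \<lesssim> n \<longrightarrow> Fin (un X Y)" using n(1)
  proof (induction rule: omega_induct)
    case zero
    have "elts Y = {}" if "Y \<lesssim> emptyset" for Y
      using that by (auto elim!: lepollE dest: func_app)
    then have "un X Y = X" if "Y \<lesssim> emptyset" for Y using that by (intro extensionality) simp
    then show ?case using X by simp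
  next
    case (suc n)
    show ?case
    proof (intro allI impI)
      fix Y assume "Y \<lesssim> suc n"
      then obtain f where f: "func f Y (suc n)" "inj_on (app f) (elts Y)" by (rule lepollE)
      \<comment> \<open>At most one element of \<open>Y\<close> is sent to \<open>n\<close>; without
        it, \<open>Y\<close> embeds in \<open>n\<close>.\<close>
      obtain Z where Z: "elts Z = {y \<in> elts Y. app f y \<noteq> n}"
        by (erule sepE) (intro def_intros)
      have "Z \<lesssim> n"
        by (rule lepollI[where F = "app f"])
          (intro def_intros, use f in \<open>auto simp: Z inj_on_def dest: func_app\<close>)
      then have "Fin (un X Z)" using suc by blast
      moreover have "\<exists>y. Y \<sqsubseteq> un Z (upair y y)"
      proof (cases "\<exists>y\<in>elts Y. app f y = n")
        case True
        then obtain y where "y \<in> elts Y" "app f y = n" by blast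
        then show ?thesis using f(2) by (intro exI[of _ y]) (auto simp: Z inj_on_def)
      qed (auto simp: Z)
      then obtain y where "Y \<sqsubseteq> un Z (upair y y)" ..
      then have "un X Y \<lesssim> un (un X Z) (upair y y)" by (intro subset_lepoll) auto
      ultimately show "Fin (un X Y)" using Fin_insert Fin_lepoll by blast
    qed
  qed
  then show ?thesis using n(2) by blast
qed

lemma Fin_product: "Fin X \<Longrightarrow> n \<in> elts omega \<Longrightarrow> Fin (product X n)"
proof -
  assume X: "Fin X" and n: "n \<in> elts omega"
  have "Def (\<lambda>e. Fin (product X (e 0)))" by (intro def_intros)
  then show ?thesis using n
  proof (induction rule: omega_induct)
    case zero
    have "product X emptyset = emptyset" by (rule extensionality) (auto elim: in_productE)
    then show ?case using Fin_emptyset by simp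
  next
    case (suc n)
    have "product X (upair n n) \<lesssim> X"
    proof (rule lepollI[where F = pfst])
      show "DefF (\<lambda>e. pfst (e 0))" by (intro def_intros)
    qed (auto simp: inj_on_def elim!: in_productE)
    then have "Fin (un (product X n) (product X (upair n n)))"
      using Fin_un suc X Fin_lepoll by blast
    moreover have "un (product X n) (product X (upair n n)) = product X (suc n)"
      by (rule extensionality) (auto elim!: in_productE)
    ultimately show ?case by simp
  qed
qed


section \<open>The vocabulary of the statement in a model\<close>

lemma holds_mem [simp]: "x < d \<Longrightarrow> y < d \<Longrightarrow> holds mem l d (x \<^bold>\<in> y) \<longleftrightarrow> l x \<in> elts (l y)"
  by (simp add: elts_def)

declare holds_fmem [simp del]

lemma maps_iff [simp]: "f < d \<Longrightarrow> x < d \<Longrightarrow> y < d \<Longrightarrow>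
    holds mem l d (maps f x y) \<longleftrightarrow> pair (l x) (l y) \<in> elts (l f)"
  by (simp add: maps_def)

lemma func_alt: "func f X Y \<longleftrightarrow>
    (\<forall>p. p \<in> elts f \<longrightarrow> (\<exists>x y. x \<in> elts X \<and> y \<in> elts Y \<and> p = pair x y)) \<and>
    (\<forall>x. x \<in> elts X \<longrightarrow> (\<exists>y. \<forall>z. pair x z \<in> elts f \<longleftrightarrow> z = y))"
proof -
  have "f \<sqsubseteq> product X Y \<longleftrightarrow>
      (\<forall>p. p \<in> elts f \<longrightarrow> (\<exists>x y. x \<in> elts X \<and> y \<in> elts Y \<and> p = pair x y))"
    by (auto simp: elts_product)
  moreover have "(\<exists>!y. pair x y \<in> elts f) \<longleftrightarrow> (\<exists>y. \<forall>z. pair x z \<in> elts f \<longleftrightarrow> z = y)" for x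
    by auto
  ultimately show ?thesis unfolding func_def by auto
qed

lemma is_fun_iff [simp]: "f < d \<Longrightarrow> X < d \<Longrightarrow> Y < d \<Longrightarrow>
    holds mem l d (is_fun f X Y) \<longleftrightarrow> func (l f) (l X) (l Y)"
  unfolding is_fun_def func_alt by simp

lemma is_inj_iff [simp]: "f < d \<Longrightarrow> X < d \<Longrightarrow> Y < d \<Longrightarrow> holds mem l d (is_inj f X Y) \<longleftrightarrow>
    func (l f) (l X) (l Y) \<and> inj_on (app (l f)) (elts (l X))"
  unfolding is_inj_def by (auto simp: func_pair_iff inj_on_def cong: conj_cong)

lemma is_bij_iff [simp]: "f < d \<Longrightarrow> X < d \<Longrightarrow> Y < d \<Longrightarrow> holds mem l d (is_bij f X Y) \<longleftrightarrow>
    func (l f) (l X) (l Y) \<and> bij_betw (app (l f)) (elts (l X)) (elts (l Y))"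
  unfolding is_bij_def bij_betw_def
  by (auto simp: func_pair_iff image_iff cong: conj_cong)

lemma card_le_iff [simp]: "X < d \<Longrightarrow> Y < d \<Longrightarrow> holds mem l d (card_le X Y) \<longleftrightarrow> l X \<lesssim> l Y"
  by (simp add: card_le_def lepoll_def)

lemma card_eq_iff [simp]: "X < d \<Longrightarrow> Y < d \<Longrightarrow> holds mem l d (card_eq X Y) \<longleftrightarrow> l X \<approx> l Y"
  by (simp add: card_eq_def eqpoll_def)

lemma card_aleph0_iff [simp]:
  "X < d \<Longrightarrow> holds mem l d (card_le_aleph0 X) \<longleftrightarrow> l X \<lesssim> omega"
  "X < d \<Longrightarrow> holds mem l d (card_ge_aleph0 X) \<longleftrightarrow> omega \<lesssim> l X"
  "X < d \<Longrightarrow> holds mem l d (card_less_aleph0 X) \<longleftrightarrow> l X \<lesssim> omega \<and> \<not> l X \<approx> omega"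
  "X < d \<Longrightarrow> holds mem l d (card_greater_aleph0 X) \<longleftrightarrow> omega \<lesssim> l X \<and> \<not> omega \<approx> l X"
  by (simp_all add: card_le_aleph0_def card_ge_aleph0_def card_less_aleph0_def
      card_greater_aleph0_def card_less_def)

lemma has_choice_function_iff [simp]:
  "Y < d \<Longrightarrow> holds mem l d (has_choice_function Y) \<longleftrightarrow> choice (l Y)"
  unfolding has_choice_function_def choice_def
  by (auto simp: func_pair_iff cong: conj_cong)

lemma AC_iff: "holds mem l 0 AC \<longleftrightarrow> (\<forall>X. (\<forall>x\<in>elts X. x \<noteq> emptyset) \<longrightarrow> choice X)"
  by (simp add: AC_def Ball_def)

definition finite_family :: "'a \<Rightarrow> bool" where
  "finite_family X \<longleftrightarrow> (\<forall>x\<in>elts X. x \<noteq> emptyset \<and> x \<lesssim> omega \<and> \<not> x \<approx> omega)"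

lemma nonempty_finite_family_iff [simp]:
  "X < d \<Longrightarrow> holds mem l d (nonempty_finite_family X) \<longleftrightarrow> finite_family (l X)"
  by (simp add: nonempty_finite_family_def finite_family_def Ball_def)

lemma PC_greater_iff: "holds mem l 0 PC_greater \<longleftrightarrow>
    (\<forall>X. finite_family X \<and> omega \<lesssim> X \<and> \<not> omega \<approx> X \<longrightarrow>
      (\<exists>Y. Y \<sqsubseteq> X \<and> (omega \<lesssim> Y \<and> \<not> omega \<approx> Y) \<and> choice Y))"
  by (simp add: PC_greater_def)

lemma PC_not_le_iff: "holds mem l 0 PC_not_le \<longleftrightarrow>
    (\<forall>X. finite_family X \<and> \<not> X \<lesssim> omega \<longrightarrow>
      (\<exists>Y. Y \<sqsubseteq> X \<and> (omega \<lesssim> Y \<and> \<not> omega \<approx> Y) \<and> choice Y))"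
  by (simp add: PC_not_le_def)

definition graph :: "'a \<Rightarrow> 'a \<Rightarrow> bool" where
  "graph V E \<longleftrightarrow> (\<forall>e\<in>elts E. \<exists>x\<in>elts V. \<exists>y\<in>elts V. x \<noteq> y \<and> e = upair x y)"

definition clique :: "'a \<Rightarrow> 'a \<Rightarrow> bool" where
  "clique E C \<longleftrightarrow> (\<forall>x\<in>elts C. \<forall>y\<in>elts C. x \<noteq> y \<longrightarrow> upair x y \<in> elts E)"

definition independent :: "'a \<Rightarrow> 'a \<Rightarrow> bool" where
  "independent E I \<longleftrightarrow> (\<forall>x\<in>elts I. \<forall>y\<in>elts I. x \<noteq> y \<longrightarrow> upair x y \<notin> elts E)"

lemma is_graph_iff [simp]:
  "V < d \<Longrightarrow> E < d \<Longrightarrow> holds mem l d (is_graph V E) \<longleftrightarrow> graph (l V) (l E)"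
  by (simp add: is_graph_def graph_def Ball_def Bex_def)

lemma adjacent_iff [simp]: "E < d \<Longrightarrow> x < d \<Longrightarrow> y < d \<Longrightarrow>
    holds mem l d (adjacent E x y) \<longleftrightarrow> upair (l x) (l y) \<in> elts (l E)"
  by (simp add: adjacent_def)

lemma is_independent_iff [simp]: "V < d \<Longrightarrow> E < d \<Longrightarrow> I < d \<Longrightarrow>
    holds mem l d (is_independent V E I) \<longleftrightarrow> l I \<sqsubseteq> l V \<and> independent (l E) (l I)"
  by (auto simp add: is_independent_def independent_def)

lemma is_clique_iff [simp]: "C < d \<Longrightarrow> E < d \<Longrightarrow>
    holds mem l d (is_clique C E) \<longleftrightarrow> clique (l E) (l C)"
  by (auto simp add: is_clique_def clique_def)

lemma is_subgraph_iff [simp]: "V' < d \<Longrightarrow> E' < d \<Longrightarrow> V < d \<Longrightarrow> E < d \<Longrightarrow>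
    holds mem l d (is_subgraph V' E' V E) \<longleftrightarrow>
      graph (l V') (l E') \<and> l V' \<sqsubseteq> l V \<and> l E' \<sqsubseteq> l E"
  by (simp add: is_subgraph_def)

text \<open>The edges of \<open>E\<close> with both ends in \<open>C\<close> serve as the edge set
  of the subgraph, so a clique can be treated as a mere set of vertices.\<close>

lemma clique_subgraph:
  "(\<exists>E'. graph C E' \<and> E' \<sqsubseteq> E \<and> clique E' C) \<longleftrightarrow> clique E C"
proof
  show "\<exists>E'. graph C E' \<and> E' \<sqsubseteq> E \<and> clique E' C \<Longrightarrow> clique E C"
    unfolding clique_def by blast
  assume C: "clique E C"
  have "\<exists>E'. elts E' = {e \<in> elts E. \<exists>x\<in>elts C. \<exists>y\<in>elts C. x \<noteq> y \<and> e = upair x y}"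
    by (intro separation def_intros)
  then obtain E' where "elts E' = {e \<in> elts E. \<exists>x\<in>elts C. \<exists>y\<in>elts C. x \<noteq> y \<and> e = upair x y}" ..
  then have "graph C E' \<and> E' \<sqsubseteq> E \<and> clique E' C"
    using C unfolding graph_def clique_def by blast
  then show "\<exists>E'. graph C E' \<and> E' \<sqsubseteq> E \<and> clique E' C" ..
qed

text \<open>The common shape of the three principles, which differ only in the size \<open>P\<close>
  demanded of the independent set and the size \<open>Q\<close> demanded of the clique relative to
  \<open>V\<close>.\<close>

definition edm :: "('a \<Rightarrow> bool) \<Rightarrow> ('a \<Rightarrow> 'a \<Rightarrow> bool) \<Rightarrow> bool" where
  "edm P Q \<longleftrightarrow> (\<forall>V E. graph V E \<and> \<not> V \<lesssim> omega \<longrightarrow>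
     (\<exists>I. I \<sqsubseteq> V \<and> independent E I \<and> P I) \<or>
     (\<exists>C. C \<sqsubseteq> V \<and> clique E C \<and> Q C V))"

lemma edm_alt: "edm P Q \<longleftrightarrow> (\<forall>V E. graph V E \<and> \<not> V \<lesssim> omega \<longrightarrow>
     (\<exists>I. (I \<sqsubseteq> V \<and> independent E I) \<and> P I) \<or>
     (\<exists>C E'. (graph C E' \<and> C \<sqsubseteq> V \<and> E' \<sqsubseteq> E) \<and> clique E' C \<and> Q C V))"
proof -
  have "(\<exists>C E'. (graph C E' \<and> C \<sqsubseteq> V \<and> E' \<sqsubseteq> E) \<and> clique E' C \<and> Q C V) \<longleftrightarrow>
      (\<exists>C. C \<sqsubseteq> V \<and> clique E C \<and> Q C V)" (is "?L \<longleftrightarrow> ?R") for V E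
  proof
    assume ?L
    then obtain C E' where "graph C E'" "C \<sqsubseteq> V" "E' \<sqsubseteq> E" "clique E' C" "Q C V"
      by blast
    then show ?R using clique_subgraph[of C E] by blast
  next
    assume ?R
    then obtain C where "C \<sqsubseteq> V" "clique E C" "Q C V" by blast
    then show ?L using clique_subgraph[of C E] by blast
  qed
  then show ?thesis unfolding edm_def by simp
qed

lemma EDM_DM_iff: "holds mem l 0 EDM_DM \<longleftrightarrow> edm (\<lambda>I. omega \<lesssim> I) (\<lambda>C V. C \<approx> V)"
  by (simp add: EDM_DM_def edm_alt)

lemma EDM_BG_iff: "holds mem l 0 EDM_BG \<longleftrightarrow> edm (\<lambda>I. omega \<lesssim> I) (\<lambda>C V. \<not> C \<lesssim> omega)"
  by (simp add: EDM_BG_def edm_alt)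

lemma EDM_T_iff: "holds mem l 0 EDM_T \<longleftrightarrow>
    edm (\<lambda>I. \<not> (I \<lesssim> omega \<and> \<not> I \<approx> omega)) (\<lambda>C V. \<not> C \<lesssim> omega)"
  by (simp add: EDM_T_def edm_alt)

text \<open>A symmetric definable relation is turned into a set of unordered edges, so that later
  graphs can be given by their adjacency relation alone.\<close>

lemma edmD:
  assumes edm: "edm P Q" and V: "\<not> V \<lesssim> omega"
    and R: "Def (\<lambda>e. R (e 0) (e 1))" "\<And>x y. R x y \<Longrightarrow> R y x"
  obtains (indep) I where "I \<sqsubseteq> V" "P I"
      "\<And>x y. x \<in> elts I \<Longrightarrow> y \<in> elts I \<Longrightarrow> x \<noteq> y \<Longrightarrow> \<not> R x y"
  | (clique) C where "C \<sqsubseteq> V" "Q C V"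
      "\<And>x y. x \<in> elts C \<Longrightarrow> y \<in> elts C \<Longrightarrow> x \<noteq> y \<Longrightarrow> R x y"
proof -
  have R': "Def (\<lambda>e. R (f e) (g e))" if "DefF f" "DefF g" for f g
    by (rule Def_subst2[OF R(1) that])
  obtain E where E: "elts E = {e \<in> elts (pow V). \<exists>x\<in>elts V. \<exists>y\<in>elts V. x \<noteq> y \<and> R x y \<and> e = upair x y}"
    by (erule sepE) (intro def_intros R')
  have adj: "upair x y \<in> elts E \<longleftrightarrow> R x y" if "x \<in> elts V" "y \<in> elts V" "x \<noteq> y" for x y
    using that R(2) unfolding E by (auto simp: upair_eq_iff)
  have "graph V E" unfolding graph_def E by blast
  then have "(\<exists>I. I \<sqsubseteq> V \<and> independent E I \<and> P I) \<or>
     (\<exists>C. C \<sqsubseteq> V \<and> clique E C \<and> Q C V)"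
    using edm V unfolding edm_def by blast
  then show ?thesis
  proof (elim disjE exE conjE)
    fix I assume "I \<sqsubseteq> V" "independent E I" "P I"
    then show ?thesis using adj unfolding independent_def by (intro indep[of I]) blast+
  next
    fix C assume "C \<sqsubseteq> V" "clique E C" "Q C V"
    then show ?thesis using adj unfolding clique_def by (intro clique[of C]) blast+
  qed
qed


section \<open>Consequences of the Erdos-Dushnik-Miller principles\<close>

text \<open>Without choice an uncountable set need not lie above aleph_0; it does once it contains a
  copy of \<open>omega\<close>.\<close>

lemma not_lepoll_omega_iff: "omega \<lesssim> X \<Longrightarrow> \<not> X \<lesssim> omega \<longleftrightarrow> \<not> omega \<approx> X"
  using schroeder_bernstein eqpoll_sym eqpoll_imp_lepoll by blast

lemma finite_lepoll:
  assumes "X \<lesssim> Y" "Y \<lesssim> omega" "\<not> Y \<approx> omega" shows "X \<lesssim> omega \<and> \<not> X \<approx> omega"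
proof -
  have "Y \<approx> omega" if "X \<approx> omega"
    using lepoll_trans[OF eqpoll_imp_lepoll[OF eqpoll_sym[OF that]] assms(1)] assms(2)
    by (intro schroeder_bernstein)
  then show ?thesis using assms lepoll_trans by blast
qed

lemma not_omega_eqpoll_emptyset: "\<not> emptyset \<approx> omega"
  by (auto elim!: eqpollE simp: bij_betw_def) (metis emptyset_in_omega empty_iff)

lemma edm_BG_imp_T:
  assumes "edm (\<lambda>I. omega \<lesssim> I) Q"
  shows "edm (\<lambda>I. \<not> (I \<lesssim> omega \<and> \<not> I \<approx> omega)) Q"
  using assms schroeder_bernstein unfolding edm_def by meson

lemma edm_BG_uncountable:
  assumes edm: "edm (\<lambda>I. omega \<lesssim> I) (\<lambda>C V. \<not> C \<lesssim> omega)" and V: "\<not> V \<lesssim> omega"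
  shows "omega \<lesssim> V"
proof -
  have "Def (\<lambda>e. False)" by (intro def_intros)
  from edm V this show ?thesis
  proof (rule edmD)
    fix I assume "I \<sqsubseteq> V" "omega \<lesssim> I"
    then show ?thesis using lepoll_trans subset_lepoll by blast
  next
    fix C assume C: "\<not> C \<lesssim> omega" "\<And>x y. x \<in> elts C \<Longrightarrow> y \<in> elts C \<Longrightarrow> x \<noteq> y \<Longrightarrow> False"
    have "C \<lesssim> omega"
      by (rule lepollI[where F = "\<lambda>x. emptyset"]) (intro def_intros, use C in \<open>auto simp: inj_on_def\<close>)
    then show ?thesis using C by blast
  qed simp
qed

text \<open>The disjoint union of the members of \<open>X\<close>: tagging each element with its set
  keeps overlapping members apart.\<close>

definition dunion :: "'a \<Rightarrow> 'a" where
  "dunion X = sep (product X (union X)) (\<lambda>p. psnd p \<in> elts (pfst p))"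

lemma pair_in_dunion [simp]: "pair x y \<in> elts (dunion X) \<longleftrightarrow> x \<in> elts X \<and> y \<in> elts x"
  unfolding dunion_def by (subst elts_sep) (auto intro!: def_intros)

lemma in_dunionE:
  assumes "p \<in> elts (dunion X)" obtains x y where "p = pair x y" "x \<in> elts X" "y \<in> elts x"
proof -
  have "p \<in> elts (product X (union X))"
    using assms unfolding dunion_def by (subst (asm) elts_sep) (auto intro!: def_intros)
  then show ?thesis using assms that by (auto elim!: in_productE)
qed

text \<open>From each \<open>x\<close> the element is taken whose tagged pair comes first in the
  enumeration \<open>h\<close>.\<close>

lemma choice_countable_dunion:
  assumes "dunion X \<lesssim> omega" "\<And>x. x \<in> elts X \<Longrightarrow> x \<noteq> emptyset" shows "choice X"
proof -
  obtain h where h: "func h (dunion X) omega" "inj_on (app h) (elts (dunion X))"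
    using assms(1) by (rule lepollE)
  show ?thesis
  proof (rule choiceI)
    show "Def (\<lambda>e. e 1 \<in> elts (e 0) \<and>
        (\<forall>z\<in>elts (e 0). z \<noteq> e 1 \<longrightarrow> app h (pair (e 0) (e 1)) \<in> elts (app h (pair (e 0) z))))"
      by (intro def_intros)
    show "\<exists>!y. y \<in> elts x \<and>
        (\<forall>z\<in>elts x. z \<noteq> y \<longrightarrow> app h (pair x y) \<in> elts (app h (pair x z)))"
      if x: "x \<in> elts X" for x
    proof -
      have ne: "elts x \<noteq> {}" using assms(2)[OF x] elts_emptyset_iff by blast
      \<comment> \<open>The fibre of the disjoint union over \<open>x\<close>, a nonempty part of
        the domain of \<open>h\<close>.\<close>
      let ?s = "product (upair x x) x"
      have s: "p \<in> elts ?s \<longleftrightarrow> (\<exists>y\<in>elts x. p = pair x y)" for p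
        by (auto simp: elts_product)
      define M where
        "M p \<longleftrightarrow> p \<in> elts ?s \<and> (\<forall>z\<in>elts ?s. z \<noteq> p \<longrightarrow> app h p \<in> elts (app h z))" for p
      have "\<exists>!p. M p"
        unfolding M_def by (rule lepoll_Ord_least_element[OF h Ord_omega]) (use ne x s in auto)
      then obtain p where p: "M p" and u: "\<And>q. M q \<Longrightarrow> q = p" by blast
      obtain y where y: "y \<in> elts x" "p = pair x y" using p s unfolding M_def by blast
      show ?thesis
      proof (rule ex1I[of _ y])
        show "y \<in> elts x \<and>
            (\<forall>z\<in>elts x. z \<noteq> y \<longrightarrow> app h (pair x y) \<in> elts (app h (pair x z)))"
          using p y s unfolding M_def by simp
        show "w = y" if "w \<in> elts x \<and>
            (\<forall>z\<in>elts x. z \<noteq> w \<longrightarrow> app h (pair x w) \<in> elts (app h (pair x z)))" for w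
        proof -
          have "M (pair x w)" using that unfolding M_def by (auto simp: elts_product)
          then have "pair x w = pair x y" using u y(2) by blast
          then show ?thesis by simp
        qed
      qed
    qed
  qed auto
qed

lemma lepoll_dunion:
  assumes "choice X" shows "X \<lesssim> dunion X"
proof -
  obtain f where f: "\<forall>x\<in>elts X. app f x \<in> elts x" using assms unfolding choice_def by blast
  show ?thesis
    by (rule lepollI[where F = "\<lambda>x. pair x (app f x)"])
      (intro def_intros, use f in \<open>auto simp: inj_on_def\<close>)
qed

lemma uncountable_choice_subfamily:
  assumes edm: "edm (\<lambda>I. \<not> (I \<lesssim> omega \<and> \<not> I \<approx> omega)) (\<lambda>C V. \<not> C \<lesssim> omega)"
    and X: "finite_family X" and V: "\<not> dunion X \<lesssim> omega"
  obtains Y where "Y \<sqsubseteq> X" "\<not> Y \<lesssim> omega" "choice Y"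
proof -
  have "Def (\<lambda>e. pfst (e 0) \<noteq> pfst (e 1))" by (intro def_intros)
  from edm V this show ?thesis
  proof (rule edmD)
    fix I assume I: "I \<sqsubseteq> dunion X" "\<not> (I \<lesssim> omega \<and> \<not> I \<approx> omega)"
      "\<And>p q. p \<in> elts I \<Longrightarrow> q \<in> elts I \<Longrightarrow> p \<noteq> q \<Longrightarrow> \<not> pfst p \<noteq> pfst q"
    have "I \<lesssim> omega \<and> \<not> I \<approx> omega"
    proof (cases "elts I = {}")
      case True
      then show ?thesis
        using not_omega_eqpoll_emptyset by (simp add: elts_emptyset_iff subset_lepoll)
    next
      case False
      \<comment> \<open>All vertices of an independent set share the first component of any one of
        them, so the second component embeds the set into the finite set \<open>x\<close>.\<close>
      then obtain x y where xy: "pair x y \<in> elts I" "x \<in> elts X"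
        using I(1) by (metis all_not_in_conv in_dunionE subsetD)
      have eq: "p = pair x (psnd p) \<and> psnd p \<in> elts x" if p: "p \<in> elts I" for p
      proof -
        obtain u v where "p = pair u v" "v \<in> elts u" using p I(1) by (metis in_dunionE subsetD)
        then show ?thesis using I(3)[OF p xy(1)] by (cases "p = pair x y") auto
      qed
      have "I \<lesssim> x"
      proof (rule lepollI[where F = psnd])
        show "DefF (\<lambda>e. psnd (e 0))" by (intro def_intros)
        show "inj_on psnd (elts I)" using eq by (metis inj_onI)
        show "psnd ` elts I \<subseteq> elts x" using eq by blast
      qed
      then show ?thesis using finite_lepoll X xy(2) unfolding finite_family_def by blast
    qed
    then show ?thesis using I(2) by blast
  next
    fix C assume C: "C \<sqsubseteq> dunion X" "\<not> C \<lesssim> omega"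
      "\<And>p q. p \<in> elts C \<Longrightarrow> q \<in> elts C \<Longrightarrow> p \<noteq> q \<Longrightarrow> pfst p \<noteq> pfst q"
    \<comment> \<open>Distinct vertices of \<open>C\<close> have distinct first components, so
      \<open>C\<close> itself is the graph of a choice function on the set \<open>Y\<close> of these
      components.\<close>
    obtain Y where Y: "elts Y = {x \<in> elts X. \<exists>y. pair x y \<in> elts C}"
      by (erule sepE) (intro def_intros)
    have "C \<lesssim> Y"
    proof (rule lepollI[where F = pfst])
      show "DefF (\<lambda>e. pfst (e 0))" by (intro def_intros)
      show "inj_on pfst (elts C)" using C(3) by (meson inj_onI)
      show "pfst ` elts C \<subseteq> elts Y" using C(1) by (auto simp: Y elim!: in_dunionE dest!: subsetD)
    qed
    then have "\<not> Y \<lesssim> omega" using C(2) lepoll_trans by blast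
    moreover have "choice Y"
    proof (rule choiceI)
      show "Def (\<lambda>e. pair (e 0) (e 1) \<in> elts C)" by (intro def_intros)
      show "\<exists>!y. pair x y \<in> elts C" if "x \<in> elts Y" for x
        using that C(3)[of "pair x _" "pair x _"] by (auto simp: Y)
      show "y \<in> elts x" if "pair x y \<in> elts C" for x y using that C(1) by auto
    qed
    ultimately show ?thesis using that Y by auto
  qed auto
qed

text \<open>Embedding \<open>X\<close> into \<open>dunion X\<close> uses a choice function. If
  \<open>dunion X\<close> is countable there is one, and then \<open>X\<close> is countable
  too.\<close>

lemma uncountable_dunion:
  "finite_family X \<Longrightarrow> \<not> X \<lesssim> omega \<Longrightarrow> \<not> dunion X \<lesssim> omega"
  using choice_countable_dunion lepoll_dunion lepoll_trans unfolding finite_family_def by blast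

lemma choice_un:
  assumes "choice X" "choice Y" shows "choice (un X Y)"
proof -
  obtain f g where f: "\<forall>x\<in>elts X. app f x \<in> elts x" and g: "\<forall>x\<in>elts Y. app g x \<in> elts x"
    using assms unfolding choice_def by blast
  show ?thesis
  proof (rule choiceI)
    show "Def (\<lambda>e. e 1 = (if e 0 \<in> elts X then app f (e 0) else app g (e 0)))"
      by (intro def_intros)
  qed (use f g in \<open>auto split: if_splits\<close>)
qed

lemma edm_T_imp_PC_greater:
  assumes edm: "edm (\<lambda>I. \<not> (I \<lesssim> omega \<and> \<not> I \<approx> omega)) (\<lambda>C V. \<not> C \<lesssim> omega)"
    and X: "finite_family X" "omega \<lesssim> X" "\<not> omega \<approx> X"
  shows "\<exists>Y. Y \<sqsubseteq> X \<and> (omega \<lesssim> Y \<and> \<not> omega \<approx> Y) \<and> choice Y"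
proof -
  have "\<not> dunion X \<lesssim> omega" using X not_lepoll_omega_iff uncountable_dunion by blast
  then obtain Y where Y: "Y \<sqsubseteq> X" "\<not> Y \<lesssim> omega" "choice Y"
    using uncountable_choice_subfamily[OF edm X(1)] by blast
  obtain f where f: "func f omega X" "inj_on (app f) (elts omega)" using X(2) by (rule lepollE)
  obtain C where C: "elts C = {x \<in> elts X. \<exists>n\<in>elts omega. x = app f n}"
    by (erule sepE) (intro def_intros)
  have "omega \<approx> C"
    by (rule eqpollI[where F = "app f"])
      (intro def_intros, use f in \<open>auto simp: bij_betw_def C dest: func_app\<close>)
  then have C': "omega \<lesssim> C" "C \<lesssim> omega" using eqpoll_imp_lepoll eqpoll_sym by blast+
  have fC: "finite_family C" using X(1) by (simp add: finite_family_def C)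
  \<comment> \<open>Otherwise the principle would produce an uncountable subfamily of the countable
    family \<open>C\<close>.\<close>
  have "dunion C \<lesssim> omega"
  proof (rule ccontr)
    assume "\<not> dunion C \<lesssim> omega"
    then obtain Z where "Z \<sqsubseteq> C" "\<not> Z \<lesssim> omega"
      using uncountable_choice_subfamily[OF edm fC] by blast
    then show False using C'(2) lepoll_trans subset_lepoll by blast
  qed
  then have "choice C" using choice_countable_dunion fC unfolding finite_family_def by blast
  then have "choice (un C Y)" using choice_un Y(3) by blast
  moreover have "omega \<lesssim> un C Y" using C'(1) lepoll_trans subset_lepoll[of C "un C Y"] by simp
  moreover have "\<not> un C Y \<lesssim> omega" 
    using Y(2) lepoll_trans[OF subset_lepoll[of Y "un C Y"]] by auto
  moreover have "un C Y \<sqsubseteq> X" using Y(1) C by auto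
  ultimately show ?thesis using not_lepoll_omega_iff by blast
qed

lemma edm_BG_imp_PC_not_le:
  assumes edm: "edm (\<lambda>I. omega \<lesssim> I) (\<lambda>C V. \<not> C \<lesssim> omega)"
    and X: "finite_family X" "\<not> X \<lesssim> omega"
  shows "\<exists>Y. Y \<sqsubseteq> X \<and> (omega \<lesssim> Y \<and> \<not> omega \<approx> Y) \<and> choice Y"
proof -
  obtain Y where Y: "Y \<sqsubseteq> X" "\<not> Y \<lesssim> omega" "choice Y"
    using uncountable_choice_subfamily[OF edm_BG_imp_T[OF edm] X(1) uncountable_dunion[OF X]] by blast
  then have "omega \<lesssim> Y" using edm_BG_uncountable[OF edm] by blast
  then show ?thesis using Y not_lepoll_omega_iff by blast
qed

text \<open>With two cliques as the only components, an independent set has at most two vertices and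
  a clique lies on one side. A clique of full size on the side of \<open>A\<close> would embed
  \<open>k\<close> in \<open>A\<close>, so it lies on the side of \<open>k\<close>, and
  \<open>V\<close>, hence \<open>A\<close>, embeds in \<open>k\<close>.\<close>

lemma edm_DM_imp_lepoll_Ord:
  assumes edm: "edm (\<lambda>I. omega \<lesssim> I) (\<lambda>C V. C \<approx> V)"
  obtains k where "Ord k" "A \<lesssim> k"
proof -
  \<comment> \<open>Joining \<open>omega\<close> to \<open>A\<close> makes \<open>k\<close>, and
    with it \<open>V\<close>, uncountable, as the principle demands.\<close>
  obtain k where k: "Ord k" "\<not> k \<lesssim> un A omega" by (rule hartogs)
  define one where "one = suc emptyset"
  define V where "V = un (product (upair emptyset emptyset) A) (product (upair one one) k)"
  have one: "one \<noteq> emptyset" 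
    unfolding one_def by (metis elts_suc elts_emptyset insert_not_empty)
  have kV: "k \<lesssim> V"
    by (rule lepollI[where F = "pair one"]) (intro def_intros, auto simp: inj_on_def V_def)
  have AV: "A \<lesssim> V"
    by (rule lepollI[where F = "pair emptyset"]) (intro def_intros, auto simp: inj_on_def V_def)
  have V: "pfst p = emptyset \<and> psnd p \<in> elts A \<or>
      pfst p = one \<and> psnd p \<in> elts k" if "p \<in> elts V" for p
    using that by (auto simp: V_def elim!: in_productE)
  have eta: "pair (pfst p) (psnd p) = p" if "p \<in> elts V" for p
    using that by (auto simp: V_def elim!: in_productE)
  have uncountable: "\<not> V \<lesssim> omega"
    using k(2) lepoll_trans[OF lepoll_trans[OF kV] subset_lepoll[of omega "un A omega"]] by auto
  have "Def (\<lambda>e. pfst (e 0) = pfst (e 1))" by (intro def_intros)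
  from edm uncountable this show ?thesis
  proof (rule edmD)
    fix I assume I: "I \<sqsubseteq> V" "omega \<lesssim> I"
      "\<And>p q. p \<in> elts I \<Longrightarrow> q \<in> elts I \<Longrightarrow> p \<noteq> q \<Longrightarrow> pfst p \<noteq> pfst q"
    have "I \<lesssim> suc one"
    proof (rule lepollI[where F = pfst])
      show "DefF (\<lambda>e. pfst (e 0))" by (intro def_intros)
      show "inj_on pfst (elts I)" using I(3) by (meson inj_onI)
      show "pfst ` elts I \<subseteq> elts (suc one)" using I(1) V by (auto simp: one_def)
    qed
    moreover have "suc one \<in> elts omega" by (simp add: one_def)
    ultimately show ?thesis using I(2) not_omega_lepoll lepoll_trans by blast
  next
    fix C assume C: "C \<sqsubseteq> V" "C \<approx> V"
      "\<And>p q. p \<in> elts C \<Longrightarrow> q \<in> elts C \<Longrightarrow> p \<noteq> q \<Longrightarrow> pfst p = pfst q"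
    have VC: "V \<lesssim> C" using C(2) eqpoll_sym eqpoll_imp_lepoll by blast
    have inj: "inj_on psnd (elts C)"
    proof (rule inj_onI)
      fix p q assume pq: "p \<in> elts C" "q \<in> elts C" "psnd p = psnd q"
      have "pfst p = pfst q"
      proof (cases "p = q")
        case False
        show ?thesis by (rule C(3)[OF pq(1,2) False])
      qed simp
      then show "p = q" using pq(3) eta[OF subsetD[OF C(1) pq(1)]] eta[OF subsetD[OF C(1) pq(2)]]
        by metis
    qed
    have le: "C \<lesssim> Z" if "psnd ` elts C \<subseteq> elts Z" for Z
      by (rule lepollI[OF _ inj that]) (intro def_intros)
    show ?thesis
    proof (cases "\<exists>p\<in>elts C. pfst p = one")
      case True
      then have "\<forall>q\<in>elts C. pfst q = one" using C(3) by metis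
      then have "C \<lesssim> k" using C(1) V one by (intro le) fastforce
      then show ?thesis using that k(1) AV VC lepoll_trans by blast
    next
      case False
      then have "C \<lesssim> A" using C(1) V by (intro le) blast
      then have "k \<lesssim> A" using kV VC lepoll_trans by blast
      then have "k \<lesssim> un A omega" by (rule lepoll_trans[OF _ subset_lepoll]) simp
      then show ?thesis using k(2) by blast
    qed
  qed auto
qed

lemma edm_DM_imp_choice:
  assumes "edm (\<lambda>I. omega \<lesssim> I) (\<lambda>C V. C \<approx> V)" "\<And>x. x \<in> elts X \<Longrightarrow> x \<noteq> emptyset"
  shows "choice X"
proof -
  obtain k where "Ord k" "union X \<lesssim> k" using edm_DM_imp_lepoll_Ord[OF assms(1)] by blast
  then show ?thesis using choice_lepoll_Ord assms(2) elts_emptyset_iff by blast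
qed

end


section \<open>Recursion with choices\<close>

context zf_model
begin

definition slice :: "'a \<Rightarrow> 'a \<Rightarrow> 'a" where
  "slice r x = mk {y. pair x y \<in> elts r}"

lemma in_union_union: "pair x y \<in> elts r \<Longrightarrow> y \<in> elts (union (union r))"
proof -
  assume "pair x y \<in> elts r"
  then have "upair x y \<in> elts (union r)" by (force simp: pair_def)
  then show ?thesis by force
qed

lemma slice_axiom: "\<exists>s. elts s = {y. pair x y \<in> elts r}"
proof -
  have "\<exists>s. elts s = {y \<in> elts (union (union r)). pair x y \<in> elts r}"
    by (intro separation def_intros)
  moreover have "{y \<in> elts (union (union r)). pair x y \<in> elts r} = {y. pair x y \<in> elts r}"
    using in_union_union by blast
  ultimately show ?thesis by simp
qed

lemma in_slice [simp]: "y \<in> elts (slice r x) \<longleftrightarrow> pair x y \<in> elts r"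
  unfolding slice_def elts_mk[OF slice_axiom] by simp

lemma DefF_slice [def_intros]: "DefF f \<Longrightarrow> DefF g \<Longrightarrow> DefF (\<lambda>e. slice (f e) (g e))"
  unfolding slice_def by (rule DefF_mk2[OF slice_axiom]) (simp, intro def_intros)

text \<open>For a function \<open>h\<close> on an ordinal, \<open>restr h j\<close> is the history
  before stage \<open>j\<close>; in this form recursions see their earlier choices.\<close>

definition restr :: "'a \<Rightarrow> 'a \<Rightarrow> 'a" where
  "restr h a = mk {p \<in> elts h. pfst p \<in> elts a}"

lemma restr_axiom: "\<exists>s. elts s = {p \<in> elts h. pfst p \<in> elts a}"
  by (intro separation def_intros)

lemma elts_restr [simp]: "elts (restr h a) = {p \<in> elts h. pfst p \<in> elts a}"
  unfolding restr_def by (rule elts_mk[OF restr_axiom])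

lemma DefF_restr [def_intros]: "DefF f \<Longrightarrow> DefF g \<Longrightarrow> DefF (\<lambda>e. restr (f e) (g e))"
  unfolding restr_def by (rule DefF_mk2[OF restr_axiom]) (simp, intro def_intros)

lemma func_restr:
  assumes "func h X Y" "a \<sqsubseteq> X" shows "func (restr h a) a Y"
  using assms(2) func_app[OF assms(1)] unfolding func_def
  by (auto simp: func_pair_iff[OF assms(1)] func_elts[OF assms(1)])

lemma app_restr:
  assumes "func h X Y" "a \<sqsubseteq> X" "x \<in> elts a" shows "app (restr h a) x = app h x"
proof -
  have "pair x (app h x) \<in> elts (restr h a)" using assms func_pair_iff[OF assms(1)] by auto
  then show ?thesis using func_pair_iff[OF func_restr[OF assms(1,2)]] by simp
qed

lemma func_in_pow:
  assumes "func f X Y" "X \<sqsubseteq> X'" "Y \<sqsubseteq> Y'"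
  shows "f \<in> elts (pow (product X' Y'))"
proof -
  have "x \<in> elts X' \<and> app f x \<in> elts Y'" if "x \<in> elts X" for x
    using that assms(2,3) func_app[OF assms(1)] by blast
  then show ?thesis by (auto simp: func_elts[OF assms(1)])
qed

lemma eqpoll_surj:
  assumes "func f X Y" "inj_on (app f) (elts X)" "elts Y \<subseteq> app f ` elts X" shows "X \<approx> Y"
  using assms func_app[OF assms(1)] unfolding eqpoll_def bij_betw_def by blast

lemma restr_restr: "b \<sqsubseteq> a \<Longrightarrow> restr (restr h a) b = restr h b"
  by (rule extensionality) auto

lemma restr_eqI:
  assumes "func h X Y" "func h' X' Y'" "a \<sqsubseteq> X" "a \<sqsubseteq> X'"
    "\<And>x. x \<in> elts a \<Longrightarrow> app h x = app h' x"
  shows "restr h a = restr h' a"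
  by (rule func_eqI[OF func_restr[OF assms(1,3)] func_restr[OF assms(2,4)]])
    (simp add: app_restr[OF assms(1,3)] app_restr[OF assms(2,4)] assms(5))

end

locale zfc_model = zf_model +
  assumes ac: "\<And>X. (\<And>x. x \<in> elts X \<Longrightarrow> x \<noteq> emptyset) \<Longrightarrow> choice X"
begin

lemma ac_func:
  assumes P: "Def (\<lambda>e. P (e 0) (e 1))" and ex: "\<And>x. x \<in> elts X \<Longrightarrow> \<exists>y\<in>elts Y. P x y"
  obtains f where "func f X Y" "\<And>x. x \<in> elts X \<Longrightarrow> P x (app f x)"
proof -
  have P': "Def (\<lambda>e. P (f e) (g e))" if "DefF f" "DefF g" for f g by (rule Def_subst2[OF P that])
  obtain r where r: "elts r = {p \<in> elts (product X Y). P (pfst p) (psnd p)}"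
    by (erule sepE) (intro def_intros P')
  obtain F where F: "elts F = {s \<in> elts (pow (product X Y)). \<exists>x\<in>elts X. s = product (upair x x) (slice r x)}"
    by (erule sepE) (intro def_intros)
  have F': "product (upair x x) (slice r x) \<in> elts F" if "x \<in> elts X" for x
    using that by (auto simp: F r elts_product)
  have "choice F"
  proof (rule ac)
    fix s assume "s \<in> elts F"
    then obtain x where x: "x \<in> elts X" "s = product (upair x x) (slice r x)" using F by blast
    obtain y where "y \<in> elts Y" "P x y" using ex x(1) by blast
    then have "pair x y \<in> elts s" using x by (simp add: r)
    then show "s \<noteq> emptyset" using elts_emptyset by blast
  qed
  then obtain g where g: "\<And>s. s \<in> elts F \<Longrightarrow> app g s \<in> elts s" unfolding choice_def by blast
  let ?F = "\<lambda>x. psnd (app g (product (upair x x) (slice r x)))"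
  have *: "?F x \<in> elts Y \<and> P x (?F x)" if "x \<in> elts X" for x
    using g[OF F'[OF that]] by (auto simp: r elim!: in_productE)
  have D: "DefF (\<lambda>e. ?F (e 0))" by (intro def_intros)
  obtain f where "func f X Y" "\<And>x. x \<in> elts X \<Longrightarrow> app f x = ?F x"
    by (rule lam_exists[OF D, of X Y]) (use * in blast)+
  then show ?thesis using that * by metis
qed

text \<open>Choice is used once, to pick a step function \<open>c\<close> on the set
  \<open>G\<close> of all conforming histories. Following \<open>c\<close> is then an ordinary
  recursion, whose approximations are unique and fit together.\<close>

lemma rec_choice:
  assumes D: "Def (\<lambda>e. P (e 0) (e 1))" and d: "Ord d"
    and total: "\<And>i h. i \<in> elts d \<Longrightarrow> func h i Y \<Longrightarrow>
      (\<And>j. j \<in> elts i \<Longrightarrow> P (restr h j) (app h j)) \<Longrightarrow> \<exists>y\<in>elts Y. P h y"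
  obtains f where "func f d Y" "\<And>i. i \<in> elts d \<Longrightarrow> P (restr f i) (app f i)"
proof -
  have D': "Def (\<lambda>e. P (f e) (g e))" if "DefF f" "DefF g" for f g by (rule Def_subst2[OF D that])
  obtain G where G: "elts G = {h \<in> elts (pow (product d Y)). \<exists>i\<in>elts d. func h i Y \<and>
      (\<forall>j\<in>elts i. P (restr h j) (app h j))}"
    by (erule sepE) (intro def_intros D')
  obtain c where c: "func c G Y" "\<And>h. h \<in> elts G \<Longrightarrow> P h (app c h)"
    by (rule ac_func[OF D, of G Y]) (use total G in blast)+
  \<comment> \<open>\<open>K\<close> follows \<open>c\<close> without mentioning \<open>P\<close>,
    which gives uniqueness. That \<open>P\<close> holds along the way takes a separate induction,
    because \<open>c\<close> respects \<open>P\<close> only on \<open>G\<close>.\<close>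
  define K where
    "K h i \<longleftrightarrow> func h i Y \<and> (\<forall>j\<in>elts i. app h j = app c (restr h j))" for h i
  have K_agree: "app h j = app h' j"
    if K: "K h i" "K h' i'" "Ord i" "Ord i'" and j: "j \<in> elts i" "j \<in> elts i'" for h h' i i' j
  proof -
    have "Def (\<lambda>e. e 0 \<in> elts i \<and> e 0 \<in> elts i' \<longrightarrow> app h (e 0) = app h' (e 0))"
      by (intro def_intros)
    moreover have "Ord j" using K(3) j(1) by (rule Ord_mem)
    ultimately have "j \<in> elts i \<and> j \<in> elts i' \<longrightarrow> app h j = app h' j"
    proof (induction rule: Ord_induct)
      case (step j)
      show ?case
      proof
        assume j: "j \<in> elts i \<and> j \<in> elts i'"
        then have sub: "j \<sqsubseteq> i" "j \<sqsubseteq> i'" using K(3,4) Ord_subset by blast+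
        have "restr h j = restr h' j"
        proof (rule restr_eqI[OF _ _ sub])
          show "func h i Y" "func h' i' Y" using K(1,2) by (simp_all add: K_def)
          show "app h k = app h' k" if "k \<in> elts j" for k using step.IH[OF that] that sub by blast
        qed
        then show "app h j = app h' j" using K(1,2) j unfolding K_def by simp
      qed
    qed
    then show ?thesis using j by blast
  qed
  have K_unique: "h = h'" if "K h i" "K h' i" "Ord i" for h h' i
    using K_agree[OF that(1,2,3,3)] that(1,2) func_eqI unfolding K_def by blast
  have K_restr: "K (restr h j) j" if "K h i" "Ord i" "j \<in> elts i" for h i j
  proof -
    have sub: "j \<sqsubseteq> i" using that Ord_subset by blast
    have h: "func h i Y" using that(1) by (simp add: K_def)
    have "app (restr h j) k = app c (restr (restr h j) k)" if k: "k \<in> elts j" for k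
    proof -
      have "k \<sqsubseteq> j" using Ord_subset[OF Ord_mem[OF \<open>Ord i\<close> \<open>j \<in> elts i\<close>] k] .
      then show ?thesis
        using app_restr[OF h sub k] restr_restr[of k j h] \<open>K h i\<close> k sub by (auto simp: K_def)
    qed
    then show ?thesis using func_restr[OF h sub] by (simp add: K_def)
  qed
  have K_P: "P (restr h j) (app h j)" if K: "K h i" "Ord i" "i \<sqsubseteq> d" and j: "j \<in> elts i" for h i j
  proof -
    have h: "func h i Y" using K(1) by (simp add: K_def)
    have "Def (\<lambda>e. e 0 \<in> elts i \<longrightarrow> P (restr h (e 0)) (app h (e 0)))"
      by (intro def_intros D')
    moreover have "Ord j" using K(2) j by (rule Ord_mem)
    ultimately have "j \<in> elts i \<longrightarrow> P (restr h j) (app h j)"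
    proof (induction rule: Ord_induct)
      case (step j)
      show ?case
      proof
        assume j: "j \<in> elts i"
        have sub: "j \<sqsubseteq> i" using K(2) j Ord_subset by blast
        have "P (restr (restr h j) k) (app (restr h j) k)" if "k \<in> elts j" for k
        proof -
          have "k \<sqsubseteq> j" using Ord_subset[OF \<open>Ord j\<close> that] .
          then show ?thesis
            using step.IH[OF that] that sub app_restr[OF h sub that] restr_restr[of k j h] by auto
        qed
        moreover have f: "func (restr h j) j Y" using func_restr[OF h sub] .
        moreover have "restr h j \<in> elts (pow (product d Y))"
          by (rule func_in_pow[OF f]) (use sub K(3) in auto)
        ultimately have "restr h j \<in> elts G" using j K(3) unfolding G by blast
        then show "P (restr h j) (app h j)" using c(2) K(1) j unfolding K_def by auto
      qed
    qed
    then show ?thesis using j by blast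
  qed
  have K_G: "h \<in> elts G" if "K h i" "i \<in> elts d" for h i
  proof -
    have i: "Ord i" "i \<sqsubseteq> d" using d that(2) Ord_mem Ord_subset by blast+
    have "func h i Y" using that(1) by (simp add: K_def)
    moreover have "h \<in> elts (pow (product d Y))"
      by (rule func_in_pow[OF calculation i(2)]) simp
    ultimately show ?thesis using K_P[OF that(1) i] that(2) unfolding G by blast
  qed
  have ex: "i \<sqsubseteq> d \<longrightarrow> (\<exists>h. K h i)" if "Ord i" for i
  proof -
    have "Def (\<lambda>e. e 0 \<sqsubseteq> d \<longrightarrow> (\<exists>h. K h (e 0)))"
      unfolding K_def by (intro def_intros)
    then show ?thesis using that
    proof (induction rule: Ord_induct)
      case (step i)
      show ?case
      proof
        assume i: "i \<sqsubseteq> d"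
        have K_ex: "\<exists>h. K h j" if "j \<in> elts i" for j
          using step.IH[OF that] i Ord_subset[OF \<open>Ord i\<close> that] by blast
        have Oi: "Ord j" if "j \<in> elts i" for j using Ord_mem[OF \<open>Ord i\<close> that] .
        \<comment> \<open>The value at \<open>j\<close> is the step taken from the approximation of
          length \<open>j\<close>, which exists by induction and is unique.\<close>
        have DQ: "Def (\<lambda>e. \<exists>h. K h (e 0) \<and> e 1 = app c h)" unfolding K_def by (intro def_intros)
        obtain f where f: "func f i Y" "\<And>j. j \<in> elts i \<Longrightarrow> \<exists>h. K h j \<and> app f j = app c h"
        proof (rule func_exists[of "\<lambda>j y. \<exists>h. K h j \<and> y = app c h" i Y, OF DQ])
          show "\<exists>!y. \<exists>h. K h j \<and> y = app c h" if "j \<in> elts i" for j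
            using K_ex[OF that] K_unique[OF _ _ Oi[OF that]] by blast
          show "y \<in> elts Y" if "j \<in> elts i" "\<exists>h. K h j \<and> y = app c h" for j y
            using that K_G c(1) i by auto
        qed blast
        have "app f j = app c (restr f j)" if j: "j \<in> elts i" for j
        proof -
          obtain h where h: "K h j" "app f j = app c h" using f(2)[OF j] by blast
          have hY: "func h j Y" using h(1) by (simp add: K_def)
          have sub: "j \<sqsubseteq> i" using Ord_subset[OF \<open>Ord i\<close> j] .
          have "restr f j = h"
          proof (rule func_eqI[OF func_restr[OF f(1) sub] hY])
            fix k assume k: "k \<in> elts j"
            obtain h' where h': "K h' k" "app f k = app c h'" using f(2) sub k by blast
            have "h' = restr h k"
              using K_unique[OF h'(1) K_restr[OF h(1) Oi[OF j] k]] Oi sub k by blast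
            then show "app (restr f j) k = app h k"
              using app_restr[OF f(1) sub k] h' h(1) k by (simp add: K_def)
          qed
          then show ?thesis using h(2) by simp
        qed
        then show "\<exists>h. K h i" using f(1) unfolding K_def by blast
      qed
    qed
  qed
  then obtain f where f: "K f d" using d by blast
  then have "func f d Y" by (simp add: K_def)
  moreover have "P (restr f i) (app f i)" if "i \<in> elts d" for i
    using K_P[OF f d subset_refl that] .
  ultimately show ?thesis using that by blast
qed

text \<open>Choosing new elements as long as possible must stop, by Hartogs' theorem.\<close>

lemma greedy:
  assumes D: "Def (\<lambda>e. P (e 0) (e 1))"
    and new: "\<And>h y. P h y \<Longrightarrow> y \<in> elts V \<and> (\<forall>x. pair x y \<notin> elts h)"
  obtains i h where "Ord i" "func h i V" "inj_on (app h) (elts i)"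
    "\<And>j. j \<in> elts i \<Longrightarrow> P (restr h j) (app h j)" "\<And>y. \<not> P h y"
proof -
  have inj: "inj_on (app h) (elts i)"
    if i: "Ord i" and h: "func h i V" and P: "\<And>j. j \<in> elts i \<Longrightarrow> P (restr h j) (app h j)" for i h
  proof -
    have *: "app h j \<noteq> app h k" if "k \<in> elts i" "j \<in> elts k" for j k
    proof -
      have "j \<in> elts i" using Ord_trans[OF i that] .
      then have "pair j (app h j) \<in> elts (restr h k)" using func_pair_iff[OF h] that(2) by simp
      then show ?thesis using new[OF P[OF that(1)]] by auto
    qed
    show ?thesis
    proof (rule inj_onI, rule ccontr)
      fix j k assume "j \<in> elts i" "k \<in> elts i" "app h j = app h k" "j \<noteq> k"
      then show False using *[of j k] *[of k j] Ord_linear[OF Ord_mem[OF i] Ord_mem[OF i]] by metis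
    qed
  qed
  note stop = that
  obtain d where d: "Ord d" "\<not> d \<lesssim> V" by (rule hartogs)
  show ?thesis
  proof (rule ccontr)
    \<comment> \<open>The negated \<open>thesis\<close> says that every conforming history can be
      extended, which is the totality premise of \<open>rec_choice\<close>.\<close>
    assume contr: "\<not> thesis"
    obtain f where f: "func f d V" "\<And>i. i \<in> elts d \<Longrightarrow> P (restr f i) (app f i)"
    proof (rule rec_choice[OF D d(1), of V])
      fix i h assume i: "i \<in> elts d" and h: "func h i V"
        and P: "\<And>j. j \<in> elts i \<Longrightarrow> P (restr h j) (app h j)"
      have "Ord i" using Ord_mem[OF d(1) i] .
      then have "\<exists>y. P h y" using stop[OF _ h inj[OF _ h P] P] contr by blast
      then show "\<exists>y\<in>elts V. P h y" using new by blast
    qed blast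
    then have "d \<lesssim> V" using inj[OF d(1) f] unfolding lepoll_def by blast
    then show False using d(2) by blast
  qed
qed

text \<open>Each step takes any element not yet taken; being stuck means that \<open>V\<close> is
  exhausted.\<close>

lemma well_ordering: obtains k where "Ord k" "V \<approx> k"
proof -
  have D: "Def (\<lambda>e. e 1 \<in> elts V \<and> (\<forall>x. pair x (e 1) \<notin> elts (e 0)))" by (intro def_intros)
  obtain i h where ih: "Ord i" "func h i V" "inj_on (app h) (elts i)"
    "\<And>y. \<not> (y \<in> elts V \<and> (\<forall>x. pair x y \<notin> elts h))"
    by (rule greedy[OF D]) auto
  have "elts V \<subseteq> app h ` elts i"
  proof
    fix y assume "y \<in> elts V"
    then obtain x where "pair x y \<in> elts h" using ih(4) by blast
    then show "y \<in> app h ` elts i" using func_pair_iff[OF ih(2)] by blast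
  qed
  then have "i \<approx> V" using eqpoll_surj[OF ih(2,3)] by blast
  then show ?thesis using that ih(1) eqpoll_sym by blast
qed


section \<open>Cardinals under the axiom of choice\<close>

text \<open>Infinite initial ordinals; finite sizes are left to \<open>Fin\<close>.\<close>

definition Card :: "'a \<Rightarrow> bool" where
  "Card k \<longleftrightarrow> Ord k \<and> omega \<sqsubseteq> k \<and> (\<forall>a\<in>elts k. \<not> k \<lesssim> a)"

text \<open>For \<open>Card k\<close> this is |X| < k, in a form that hands over a bound below
  \<open>k\<close>; by \<open>small_or_lepoll\<close> and \<open>not_small\<close> it is then the
  negation of \<open>k \<lesssim> X\<close>.\<close>

definition small :: "'a \<Rightarrow> 'a \<Rightarrow> bool" where
  "small k X \<longleftrightarrow> (\<exists>a\<in>elts k. X \<lesssim> a)"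

lemma Def_Card [def_intros]: "DefF f \<Longrightarrow> Def (\<lambda>e. Card (f e))"
  by (rule Def_subst1[where P = Card]) (unfold Card_def, intro def_intros)

lemma Card_exists:
  assumes "\<not> Fin V" obtains k where "Card k" "V \<approx> k"
proof -
  obtain a where a: "Ord a" "V \<approx> a" by (rule well_ordering)
  have "Def (\<lambda>e. V \<approx> e 0)" by (intro def_intros)
  then obtain k where k: "Ord k" "V \<approx> k" "\<And>b. b \<in> elts k \<Longrightarrow> \<not> V \<approx> b" "k \<sqsubseteq> a"
    using Ord_minimal[of "\<lambda>x. V \<approx> x" a, OF _ a] by blast
  have "\<not> k \<lesssim> b" if "b \<in> elts k" for b
    using k(3)[OF that] k(2) schroeder_bernstein[OF _ subset_lepoll[OF Ord_subset[OF k(1) that]]]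
      eqpoll_trans by blast
  moreover have "k \<notin> elts omega" using assms k(2) eqpoll_imp_lepoll unfolding Fin_def by blast
  then have "omega \<sqsubseteq> k" using Ord_not_mem k(1) Ord_omega by blast
  ultimately show ?thesis using that[of k] k unfolding Card_def by blast
qed

lemma lepoll_linear: "X \<lesssim> Y \<or> Y \<lesssim> X"
proof -
  obtain a b where ab: "Ord a" "X \<approx> a" "Ord b" "Y \<approx> b" by (meson well_ordering)
  have "a \<lesssim> b \<or> b \<lesssim> a" using ab Ord_linear Ord_subset subset_lepoll by (metis lepoll_refl)
  then show ?thesis
    using ab eqpoll_imp_lepoll eqpoll_sym lepoll_trans by metis
qed

lemma small_lepoll: "small k Y \<Longrightarrow> X \<lesssim> Y \<Longrightarrow> small k X"
  unfolding small_def using lepoll_trans by blast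

lemma small_subset: "small k Y \<Longrightarrow> X \<sqsubseteq> Y \<Longrightarrow> small k X"
  using small_lepoll subset_lepoll by blast

lemma small_mem: "a \<in> elts k \<Longrightarrow> small k a"
  unfolding small_def using lepoll_refl by blast

lemma not_small: "Card k \<Longrightarrow> k \<lesssim> X \<Longrightarrow> \<not> small k X"
  unfolding small_def Card_def using lepoll_trans by blast

lemma small_or_lepoll:
  assumes "Card k" shows "small k X \<or> k \<lesssim> X"
proof -
  obtain a where a: "Ord a" "X \<approx> a" by (rule well_ordering)
  show ?thesis
  proof (cases "a \<in> elts k")
    case True
    then show ?thesis using a eqpoll_imp_lepoll unfolding small_def by blast
  next
    case False
    then have "k \<lesssim> a" using Ord_not_mem[OF a(1)] assms subset_lepoll unfolding Card_def by blast
    then show ?thesis using a(2) eqpoll_imp_lepoll eqpoll_sym lepoll_trans by blast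
  qed
qed

lemma Fin_small: "Card k \<Longrightarrow> Fin X \<Longrightarrow> small k X"
  unfolding Card_def Fin_def small_def by blast

lemma Card_mem:
  assumes "Card k" "a \<in> elts k" "\<not> Fin a" obtains c where "Card c" "c \<in> elts k" "a \<approx> c"
proof -
  obtain c where c: "Card c" "a \<approx> c" using assms(3) by (rule Card_exists)
  have "\<not> k \<lesssim> c"
    using assms(1,2) lepoll_trans[OF _ eqpoll_imp_lepoll[OF eqpoll_sym[OF c(2)]]]
    unfolding Card_def by blast
  then have "c \<in> elts k"
    using Ord_not_mem[of c k] subset_lepoll assms(1) c(1) unfolding Card_def by blast
  then show ?thesis using that c by blast
qed

lemma Fin_Ord: "Ord a \<Longrightarrow> Fin a \<longleftrightarrow> a \<in> elts omega"
  using lepoll_omega_cases Fin_not_omega lepoll_refl unfolding Fin_def by blast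

lemma suc_neq_emptyset [simp]: "suc a \<noteq> emptyset" "emptyset \<noteq> suc a"
  by (metis elts_suc elts_emptyset insert_not_empty)+

lemma suc_eq_iff: "suc a = suc b \<longleftrightarrow> a = b"
  using not_mem_sym by (metis elts_suc insertE insertI1)

text \<open>An infinite cardinal is a limit ordinal, because \<open>suc a\<close> embeds in
  \<open>a\<close> for infinite \<open>a\<close>.\<close>

lemma Card_suc:
  assumes k: "Card k" and a: "a \<in> elts k" shows "suc a \<in> elts k"
proof (cases "a \<in> elts omega")
  case True
  then show ?thesis using k unfolding Card_def by auto
next
  case False
  have oa: "Ord a" using k a Ord_mem unfolding Card_def by blast
  then have wa: "omega \<sqsubseteq> a" using Ord_not_mem Ord_omega False by blast
  \<comment> \<open>Hilbert's hotel: \<open>a\<close> takes the place of 0, the natural numbers move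
    up by one, everything else stays.\<close>
  let ?F = "\<lambda>x. if x = a then emptyset else if x \<in> elts omega then suc x else x"
  have "suc a \<lesssim> a"
  proof (rule lepollI[where F = ?F])
    show "DefF (\<lambda>e. ?F (e 0))" by (intro def_intros)
    show "inj_on ?F (elts (suc a))"
      using False unfolding inj_on_def by (auto simp: suc_eq_iff split: if_splits)
    show "?F ` elts (suc a) \<subseteq> elts a" using wa emptyset_in_omega suc_in_omega by auto
  qed
  then have "\<not> k \<sqsubseteq> suc a"
    using k a subset_lepoll lepoll_trans unfolding Card_def by blast
  then show ?thesis using Ord_not_mem[OF Ord_suc[OF oa]] k unfolding Card_def by blast
qed

lemma Ord_un: "Ord a \<Longrightarrow> Ord b \<Longrightarrow> un a b = a \<or> un a b = b"
  using Ord_linear[of a b] Ord_subset[of a b] Ord_subset[of b a] elts_eq_iff[of "un a b"]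
  by (auto simp: Un_absorb1 Un_absorb2)

lemma Ord_un_mem: "Ord k \<Longrightarrow> a \<in> elts k \<Longrightarrow> b \<in> elts k \<Longrightarrow> un a b \<in> elts k"
  using Ord_un Ord_mem by metis

section \<open>Products and unions of sets smaller than a cardinal\<close>

lemma product_lepoll_mono:
  assumes "X \<lesssim> X'" "Y \<lesssim> Y'" shows "product X Y \<lesssim> product X' Y'"
proof -
  obtain f g where f: "func f X X'" "inj_on (app f) (elts X)"
    and g: "func g Y Y'" "inj_on (app g) (elts Y)"
    using assms by (meson lepollE)
  show ?thesis
  proof (rule lepollI[where F = "\<lambda>p. pair (app f (pfst p)) (app g (psnd p))"])
    show "DefF (\<lambda>e. pair (app f (pfst (e 0))) (app g (psnd (e 0))))" by (intro def_intros)
  qed (use f g in \<open>auto simp: inj_on_def elim!: in_productE\<close>)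
qed

text \<open>An ordinal below \<open>k\<close> is finite or has the size of a smaller infinite
  cardinal, to which the hypothesis on squares applies.\<close>

lemma small_square_aux:
  assumes IH: "\<And>c. c \<in> elts k \<Longrightarrow> Card c \<Longrightarrow> product c c \<lesssim> c"
    and k: "Card k" and a: "a \<in> elts k"
  shows "small k (product a a)"
proof (cases "Fin a")
  case True
  moreover have "Ord a" using k a Ord_mem unfolding Card_def by blast
  ultimately have "Fin (product a a)" using Fin_product Fin_Ord by blast
  then show ?thesis using Fin_small[OF k] by blast
next
  case False
  then obtain c where c: "Card c" "c \<in> elts k" "a \<approx> c" using Card_mem[OF k a] by blast
  then have "product a a \<lesssim> product c c" using product_lepoll_mono eqpoll_imp_lepoll by blast
  then show ?thesis using IH[OF c(2,1)] c(2) lepoll_trans unfolding small_def by blast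
qed

text \<open>
  Enumerating \<open>k \<times> k\<close> by non-decreasing maximum of the coordinates, every proper initial segment
  lies in a square \<open>a \<times> a\<close> with \<open>a < k\<close>.
\<close>

lemma square_step:
  assumes IH: "\<And>c. c \<in> elts k \<Longrightarrow> Card c \<Longrightarrow> product c c \<lesssim> c" and k: "Card k"
  shows "product k k \<lesssim> k"
proof -
  let ?V = "product k k"
  have ok: "Ord k" using k by (simp add: Card_def)
  \<comment> \<open>The larger coordinate, since the union of two ordinals is their maximum.\<close>
  define m where "m p = un (pfst p) (psnd p)" for p
  have m: "m p \<in> elts k" if "p \<in> elts ?V" for p
    using that Ord_un_mem[OF ok] by (auto simp: m_def elim!: in_productE)
  define P where "P h y \<longleftrightarrow> y \<in> elts ?V \<and> (\<forall>x. pair x y \<notin> elts h) \<and>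
    (\<forall>z\<in>elts ?V. (\<forall>x. pair x z \<notin> elts h) \<longrightarrow> m z \<notin> elts (m y))" for h y
  have D: "Def (\<lambda>e. P (e 0) (e 1))" unfolding P_def m_def by (intro def_intros)
  obtain i h where i: "Ord i" and h: "func h i ?V" "inj_on (app h) (elts i)"
    and P: "\<And>j. j \<in> elts i \<Longrightarrow> P (restr h j) (app h j)" and stuck: "\<And>y. \<not> P h y"
  proof (rule greedy[OF D, of ?V])
    show "P h y \<Longrightarrow> y \<in> elts ?V \<and> (\<forall>x. pair x y \<notin> elts h)" for h y unfolding P_def by blast
  qed blast
  have "elts ?V \<subseteq> app h ` elts i"
  proof (rule ccontr)
    assume "\<not> elts ?V \<subseteq> app h ` elts i"
    then obtain z where z: "z \<in> elts ?V" "\<forall>x. pair x z \<notin> elts h"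
      using func_pair_iff[OF h(1)] by blast
    have "Def (\<lambda>e. \<exists>z\<in>elts ?V. (\<forall>x. pair x z \<notin> elts h) \<and> e 0 = m z)"
      unfolding m_def by (intro def_intros)
    then obtain a where a: "\<exists>z\<in>elts ?V. (\<forall>x. pair x z \<notin> elts h) \<and> a = m z"
        "\<And>b. b \<in> elts a \<Longrightarrow> \<not> (\<exists>z\<in>elts ?V. (\<forall>x. pair x z \<notin> elts h) \<and> b = m z)"
      by (rule Ord_minimal[where a = "m z"]) (use z Ord_mem[OF ok m] in blast)+
    then obtain y where "y \<in> elts ?V" "\<forall>x. pair x y \<notin> elts h" "a = m y" by blast
    then have "P h y" using a(2) unfolding P_def by blast
    then show False using stuck by blast
  qed
  then have Vi: "?V \<approx> i" using eqpoll_sym[OF eqpoll_surj[OF h]] by blast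
  have seg: "small k j" if j: "j \<in> elts i" for j
  proof -
    \<comment> \<open>The successor makes room for coordinates equal to the maximum.\<close>
    let ?a = "suc (m (app h j))"
    have hj: "app h j \<in> elts ?V" using func_app[OF h(1) j] .
    have a: "?a \<in> elts k" using Card_suc[OF k m[OF hj]] .
    have "app h l \<in> elts (product ?a ?a)" if l: "l \<in> elts j" for l
    proof -
      have li: "l \<in> elts i" using Ord_trans[OF i j l] .
      have hl: "app h l \<in> elts ?V" using func_app[OF h(1) li] .
      have "pair x (app h j) \<notin> elts (restr h l)" for x
      proof
        assume "pair x (app h j) \<in> elts (restr h l)"
        then have "x \<in> elts i" "app h j = app h x" "x \<in> elts l"
          using func_pair_iff[OF h(1)] by auto
        then have "j \<in> elts l" using h(2) j by (metis inj_onD)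
        then show False using l not_mem_sym by blast
      qed
      then have "m (app h j) \<notin> elts (m (app h l))" using P[OF li] hj unfolding P_def by blast
      then have sub: "m (app h l) \<sqsubseteq> m (app h j)"
        using Ord_not_mem Ord_mem[OF ok m] hj hl by blast
      obtain x y where xy: "app h l = pair x y" "x \<in> elts k" "y \<in> elts k"
        using hl by (rule in_productE)
      have "x \<sqsubseteq> m (app h j)" "y \<sqsubseteq> m (app h j)"
        using sub xy(1) by (auto simp: m_def[of "pair x y"])
      then have "x \<in> elts ?a" "y \<in> elts ?a"
        using Ord_subset_iff[OF _ Ord_mem[OF ok m[OF hj]]] Ord_mem[OF ok] xy(2,3) by auto
      then show ?thesis using xy(1) by simp
    qed
    moreover have "inj_on (app h) (elts j)"
      using h(2) Ord_subset[OF i j] by (rule inj_on_subset)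
    ultimately have "j \<lesssim> product ?a ?a"
      by (intro lepollI[where F = "app h"]) (auto intro: def_intros)
    then show ?thesis using small_square_aux[OF IH k a] small_lepoll by blast
  qed
  \<comment> \<open>An enumeration longer than \<open>k\<close> would have \<open>k\<close> itself
    as a proper initial segment, making \<open>k\<close> small.\<close>
  have "k \<notin> elts i" using seg[of k] not_small[OF k, of k] by auto
  then have "i \<lesssim> k" using Ord_not_mem[OF ok i] subset_lepoll by blast
  then show ?thesis using Vi eqpoll_imp_lepoll lepoll_trans by blast
qed

lemma small_square:
  assumes "Card k" "a \<in> elts k" shows "small k (product a a)"
proof -
  have "Card c \<longrightarrow> product c c \<lesssim> c" if "Ord c" for c
  proof -
    have "Def (\<lambda>e. Card (e 0) \<longrightarrow> product (e 0) (e 0) \<lesssim> e 0)" by (intro def_intros)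
    then show ?thesis using that
      by (induction rule: Ord_induct) (use square_step in blast)
  qed
  then show ?thesis using small_square_aux[OF _ assms] unfolding Card_def by blast
qed

lemma small_product:
  assumes k: "Card k" and "small k X" "small k Y" shows "small k (product X Y)"
proof -
  obtain a b where ab: "a \<in> elts k" "X \<lesssim> a" "b \<in> elts k" "Y \<lesssim> b"
    using assms(2,3) unfolding small_def by blast
  let ?c = "un a b"
  have "X \<lesssim> ?c" "Y \<lesssim> ?c"
    using ab lepoll_trans[OF _ subset_lepoll, of _ _ ?c] by auto
  then have "product X Y \<lesssim> product ?c ?c" by (rule product_lepoll_mono)
  moreover have "?c \<in> elts k" using Ord_un_mem ab k unfolding Card_def by blast
  ultimately show ?thesis using small_square[OF k] small_lepoll by blast
qed

lemma small_un:
  assumes k: "Card k" and X: "small k X" and Y: "small k Y" shows "small k (un X Y)"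
proof -
  let ?two = "suc (suc emptyset)"
  have two: "?two \<in> elts omega" by simp
  obtain a b where ab: "a \<in> elts k" "X \<lesssim> a" "b \<in> elts k" "Y \<lesssim> b"
    using assms(2,3) unfolding small_def by blast
  obtain f g where f: "func f X a" "inj_on (app f) (elts X)"
    and g: "func g Y b" "inj_on (app g) (elts Y)"
    using ab by (meson lepollE)
  have c: "un a b \<in> elts k" using Ord_un_mem ab k unfolding Card_def by blast
  let ?F = "\<lambda>z. if z \<in> elts X then pair emptyset (app f z) else pair (suc emptyset) (app g z)"
  have "un X Y \<lesssim> product ?two (un a b)"
  proof (rule lepollI[where F = ?F])
    show "DefF (\<lambda>e. ?F (e 0))" by (intro def_intros)
    show "inj_on ?F (elts (un X Y))"
      using f(2) g(2) unfolding inj_on_def by (auto split: if_splits)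
    show "?F ` elts (un X Y) \<subseteq> elts (product ?two (un a b))" using f(1) g(1) by auto
  qed
  moreover have "small k (product ?two (un a b))"
    using small_product[OF k] small_mem c two k unfolding Card_def by blast
  ultimately show ?thesis using small_lepoll by blast
qed

text \<open>The uniform bound \<open>a\<close> on the slices takes the place of regularity of
  \<open>k\<close>: with an injection into \<open>a\<close> chosen for each slice, and a slice
  chosen for each point, \<open>Z\<close> embeds in \<open>product I a\<close>.\<close>

lemma small_UN:
  assumes k: "Card k" and I: "small k I" and a: "a \<in> elts k"
    and slice: "\<And>x. x \<in> elts I \<Longrightarrow> slice r x \<lesssim> a"
    and cover: "\<And>z. z \<in> elts Z \<Longrightarrow> \<exists>x\<in>elts I. pair x z \<in> elts r"
  shows "small k Z"
proof -
  let ?Y = "pow (product (union (union r)) a)"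
  have D: "Def (\<lambda>e. func (e 1) (slice r (e 0)) a \<and> inj_on (app (e 1)) (elts (slice r (e 0))))"
    unfolding inj_on_def by (intro def_intros)
  have ex: "\<exists>g\<in>elts ?Y. func g (slice r x) a \<and> inj_on (app g) (elts (slice r x))"
    if x: "x \<in> elts I" for x
  proof -
    obtain g where g: "func g (slice r x) a" "inj_on (app g) (elts (slice r x))"
      using slice[OF x] by (rule lepollE)
    have "g \<in> elts ?Y" by (rule func_in_pow[OF g(1)]) (use in_union_union in auto)
    then show ?thesis using g by blast
  qed
  obtain G where G: "\<And>x. x \<in> elts I \<Longrightarrow>
      func (app G x) (slice r x) a \<and> inj_on (app (app G x)) (elts (slice r x))"
    by (rule ac_func[OF D ex]) blast+
  have "Def (\<lambda>e. pair (e 1) (e 0) \<in> elts r)" by (intro def_intros)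
  then obtain H where H: "func H Z I" "\<And>z. z \<in> elts Z \<Longrightarrow> pair (app H z) z \<in> elts r"
    by (rule ac_func[where X = Z and Y = I]) (use cover in blast)+
  have HI: "app H z \<in> elts I" if "z \<in> elts Z" for z using func_app[OF H(1) that] .
  have "Z \<lesssim> product I a"
  proof (rule lepollI[where F = "\<lambda>z. pair (app H z) (app (app G (app H z)) z)"])
    show "DefF (\<lambda>e. pair (app H (e 0)) (app (app G (app H (e 0))) (e 0)))" by (intro def_intros)
    show "inj_on (\<lambda>z. pair (app H z) (app (app G (app H z)) z)) (elts Z)"
    proof (rule inj_onI)
      fix z z' assume z: "z \<in> elts Z" "z' \<in> elts Z"
        "pair (app H z) (app (app G (app H z)) z) = pair (app H z') (app (app G (app H z')) z')"
      then have e: "app H z = app H z'" "app (app G (app H z)) z = app (app G (app H z)) z'"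
        by auto
      have "inj_on (app (app G (app H z))) (elts (slice r (app H z)))" using G HI z(1) by blast
      then show "z = z'" using e H(2)[OF z(1)] H(2)[OF z(2)] by (simp add: inj_on_def)
    qed
    show "(\<lambda>z. pair (app H z) (app (app G (app H z)) z)) ` elts Z \<subseteq> elts (product I a)"
    proof (rule image_subsetI)
      fix z assume z: "z \<in> elts Z"
      have "func (app G (app H z)) (slice r (app H z)) a" using G HI[OF z] by blast
      then have "app (app G (app H z)) z \<in> elts a" by (rule func_app) (simp add: H(2) z)
      then show "pair (app H z) (app (app G (app H z)) z) \<in> elts (product I a)" using HI[OF z] by simp
    qed
  qed
  then show ?thesis using small_product[OF k I small_mem[OF a]] small_lepoll by blast
qed

end


section \<open>The Erdos-Dushnik-Miller theorem under the axiom of choice\<close>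

context zf_model
begin

text \<open>Ordered pairs are used so that \<open>slice (nonadj V E) x\<close> is the set of
  non-neighbours of \<open>x\<close>.\<close>

definition nonadj :: "'a \<Rightarrow> 'a \<Rightarrow> 'a" where
  "nonadj V E = sep (product V V) (\<lambda>p. pfst p \<noteq> psnd p \<and> upair (pfst p) (psnd p) \<notin> elts E)"

lemma pair_in_nonadj:
  "pair x y \<in> elts (nonadj V E) \<longleftrightarrow> x \<in> elts V \<and> y \<in> elts V \<and> x \<noteq> y \<and> upair x y \<notin> elts E"
  unfolding nonadj_def by (subst elts_sep) (auto intro!: def_intros)

lemma upair_commute: "upair x y = upair y x"
  by (simp add: upair_eq_iff)

lemma nonadj_sym: "pair x y \<in> elts (nonadj V E) \<Longrightarrow> pair y x \<in> elts (nonadj V E)"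
  by (auto simp: pair_in_nonadj upair_commute[of y x])

lemma func_image:
  assumes "func h i V" obtains I where "elts I = app h ` elts i" "I \<sqsubseteq> V"
proof -
  obtain I where "elts I = {y \<in> elts V. \<exists>x\<in>elts i. y = app h x}"
    by (erule sepE) (intro def_intros)
  then show ?thesis using that[of I] func_app[OF assms] by blast
qed

lemma restr_earlier:
  assumes "func h i V" "Ord i" "j \<in> elts i" "l \<in> elts j"
  shows "pair l (app h l) \<in> elts (restr h j)"
  using func_pair_iff[OF assms(1)] Ord_trans[OF assms(2-4)] assms(4) by simp

lemma lepoll_image:
  assumes "func h i V" "inj_on (app h) (elts i)" "app h ` elts i \<subseteq> elts I" shows "i \<lesssim> I"
  using assms(2,3) by (intro lepollI[where F = "app h"]) (auto intro: def_intros)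

end

context zfc_model
begin

text \<open>Greedy selection of points of \<open>B\<close> adjacent to all points chosen so far;
  once it is stuck, every other point of \<open>B\<close> is a non-neighbour of a chosen
  one.\<close>

lemma maximal_clique:
  assumes B: "B \<sqsubseteq> V"
  obtains C where "C \<sqsubseteq> B" "clique E C"
    "\<And>z. z \<in> elts B \<Longrightarrow> z \<in> elts C \<or> (\<exists>x\<in>elts C. pair x z \<in> elts (nonadj V E))"
proof -
  let ?N = "nonadj V E"
  define P where "P h y \<longleftrightarrow> y \<in> elts B \<and> (\<forall>x. pair x y \<notin> elts h) \<and>
    (\<forall>x w. pair x w \<in> elts h \<longrightarrow> pair w y \<notin> elts ?N)" for h y
  have D: "Def (\<lambda>e. P (e 0) (e 1))" unfolding P_def by (intro def_intros)
  obtain i h where i: "Ord i" and h: "func h i B" "inj_on (app h) (elts i)"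
    and P: "\<And>j. j \<in> elts i \<Longrightarrow> P (restr h j) (app h j)" and stuck: "\<And>y. \<not> P h y"
  proof (rule greedy[OF D, of B])
    show "P h y \<Longrightarrow> y \<in> elts B \<and> (\<forall>x. pair x y \<notin> elts h)" for h y unfolding P_def by blast
  qed blast
  obtain C where C: "elts C = app h ` elts i" "C \<sqsubseteq> B" using h(1) by (rule func_image)
  have later: "pair (app h l) (app h j) \<notin> elts ?N" if "j \<in> elts i" "l \<in> elts j" for j l
    using P[OF that(1)] restr_earlier[OF h(1) i that] unfolding P_def by blast
  have "clique E C" unfolding clique_def
  proof (intro ballI impI)
    fix x y assume "x \<in> elts C" "y \<in> elts C" and xy: "x \<noteq> y"
    then obtain j l where jl: "j \<in> elts i" "l \<in> elts i" "x = app h j" "y = app h l"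
      unfolding C by blast
    have "j \<in> elts l \<or> l \<in> elts j"
      using Ord_linear[OF Ord_mem[OF i jl(1)] Ord_mem[OF i jl(2)]] jl xy by blast
    then have "pair x y \<notin> elts ?N" using later jl nonadj_sym by blast
    then show "upair x y \<in> elts E"
      using xy C(2) B \<open>x \<in> elts C\<close> \<open>y \<in> elts C\<close> unfolding pair_in_nonadj by blast
  qed
  moreover have "z \<in> elts C \<or> (\<exists>x\<in>elts C. pair x z \<in> elts ?N)" if "z \<in> elts B" for z
    using stuck[of z] that func_pair_iff[OF h(1)] unfolding P_def C by blast
  ultimately show ?thesis using that C(2) by blast
qed

text \<open>Pairwise non-adjacent points are chosen as long as their common non-neighbours in
  \<open>B\<close> still number at least \<open>k\<close>. The chosen points are independent, so the
  process stops after finitely many steps; a point of the remaining set \<open>A\<close> with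
  \<open>k\<close> non-neighbours in \<open>A\<close> would allow another step.\<close>

lemma large_set_with_small_nonneighbours:
  assumes k: "Card k" and B: "B \<sqsubseteq> V" "k \<lesssim> B"
    and noind: "\<And>I. I \<sqsubseteq> V \<Longrightarrow> independent E I \<Longrightarrow> \<not> omega \<lesssim> I"
  obtains A where "A \<sqsubseteq> B" "k \<lesssim> A"
    "\<And>x. x \<in> elts A \<Longrightarrow> small k (inter A (slice (nonadj V E) x))"
proof -
  let ?N = "nonadj V E"
  \<comment> \<open>\<open>t\<close> is the set of common non-neighbours in \<open>B\<close> of the
    values of \<open>h\<close>.\<close>
  define T where "T h t \<longleftrightarrow>
    (\<forall>z. z \<in> elts t \<longleftrightarrow> z \<in> elts B \<and> (\<forall>x w. pair x w \<in> elts h \<longrightarrow> pair w z \<in> elts ?N))" for h t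
  define P where "P h y \<longleftrightarrow> y \<in> elts B \<and> (\<forall>x. pair x y \<notin> elts h) \<and>
    (\<forall>x w. pair x w \<in> elts h \<longrightarrow> pair w y \<in> elts ?N) \<and>
    (\<exists>t. T h t \<and> k \<lesssim> inter t (slice ?N y))" for h y
  have D: "Def (\<lambda>e. P (e 0) (e 1))" unfolding P_def T_def by (intro def_intros)
  obtain i h where i: "Ord i" and h: "func h i B" "inj_on (app h) (elts i)"
    and P: "\<And>j. j \<in> elts i \<Longrightarrow> P (restr h j) (app h j)" and stuck: "\<And>y. \<not> P h y"
  proof (rule greedy[OF D, of B])
    show "P h y \<Longrightarrow> y \<in> elts B \<and> (\<forall>x. pair x y \<notin> elts h)" for h y unfolding P_def by blast
  qed blast
  obtain I where I: "elts I = app h ` elts i" "I \<sqsubseteq> B" using h(1) by (rule func_image)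
  have later: "pair (app h l) (app h j) \<in> elts ?N" if "j \<in> elts i" "l \<in> elts j" for j l
    using P[OF that(1)] restr_earlier[OF h(1) i that] unfolding P_def by blast
  have "independent E I" unfolding independent_def
  proof (intro ballI impI)
    fix x y assume "x \<in> elts I" "y \<in> elts I" and xy: "x \<noteq> y"
    then obtain j l where jl: "j \<in> elts i" "l \<in> elts i" "x = app h j" "y = app h l"
      unfolding I by blast
    have "j \<in> elts l \<or> l \<in> elts j"
      using Ord_linear[OF Ord_mem[OF i jl(1)] Ord_mem[OF i jl(2)]] jl xy by blast
    then have "pair x y \<in> elts ?N" using later jl nonadj_sym by blast
    then show "upair x y \<notin> elts E" by (simp add: pair_in_nonadj)
  qed
  then have "\<not> omega \<lesssim> I" using noind I(2) B(1) by blast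
  moreover have "i \<lesssim> I" by (rule lepoll_image[OF h]) (simp add: I)
  ultimately have iw: "i \<in> elts omega" using lepoll_omega_cases[OF i] lepoll_trans by blast
  obtain A where A: "elts A = {z \<in> elts B. \<forall>x w. pair x w \<in> elts h \<longrightarrow> pair w z \<in> elts ?N}"
    by (erule sepE) (intro def_intros)
  \<comment> \<open>Either nothing was chosen, or, \<open>i\<close> being finite, there is a last
    choice; its size condition already concerns the common non-neighbours of all chosen
    points.\<close>
  have "k \<lesssim> A"
  proof (cases rule: omega_cases[OF iw])
    case 1
    then have "B \<sqsubseteq> A" using func_pair_iff[OF h(1)] by (auto simp: A)
    then show ?thesis using B(2) subset_lepoll lepoll_trans by blast
  next
    case (2 m)
    then have m: "m \<in> elts i" by simp
    obtain t where t: "T (restr h m) t" "k \<lesssim> inter t (slice ?N (app h m))"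
      using P[OF m] unfolding P_def by blast
    have "inter t (slice ?N (app h m)) \<sqsubseteq> A"
    proof
      fix z assume "z \<in> elts (inter t (slice ?N (app h m)))"
      then have z: "z \<in> elts t" "pair (app h m) z \<in> elts ?N" by auto
      have "pair w z \<in> elts ?N" if xw: "pair x w \<in> elts h" for x w
      proof -
        have x: "x \<in> elts i" "w = app h x" using func_pair_iff[OF h(1)] xw by auto
        show ?thesis
        proof (cases "x = m")
          case True
          then show ?thesis using x z(2) by simp
        next
          case False
          then have "pair x w \<in> elts (restr h m)" using x(1) xw 2(2) by simp
          then show ?thesis using z(1) t(1) unfolding T_def by blast
        qed
      qed
      moreover have "z \<in> elts B" using z(1) t(1) unfolding T_def by blast
      ultimately show "z \<in> elts A" by (simp add: A)
    qed
    then show ?thesis using t(2) subset_lepoll lepoll_trans by blast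
  qed
  moreover have "small k (inter A (slice ?N y))" if y: "y \<in> elts A" for y
  proof -
    have "T h A" unfolding T_def A by blast
    moreover have "pair x y \<notin> elts h" for x
      using y unfolding A by (auto simp: pair_in_nonadj)
    ultimately have "\<not> k \<lesssim> inter A (slice ?N y)"
      using stuck[of y] y unfolding P_def A by blast
    then show ?thesis using small_or_lepoll[OF k] by blast
  qed
  ultimately show ?thesis using that[of A] A by blast
qed

section \<open>Cofinality of an infinite cardinal\<close>

definition cofinal :: "'a \<Rightarrow> 'a \<Rightarrow> 'a \<Rightarrow> bool" where
  "cofinal k l g \<longleftrightarrow> func g l k \<and> (\<forall>a\<in>elts k. \<exists>i\<in>elts l. a \<sqsubseteq> app g i)"

text \<open>\<open>l\<close> is the least ordinal with a cofinal map into \<open>k\<close>.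
  Minimality bounds every map into \<open>k\<close> from a set smaller than \<open>l\<close>, which
  is the form of regularity needed for collecting bounds.\<close>

lemma cofinality:
  assumes k: "Card k"
  obtains l g where "Ord l" "l \<in> elts k \<or> l = k" "cofinal k l g"
    "\<And>X m. \<exists>a\<in>elts l. X \<lesssim> a \<Longrightarrow> func m X k \<Longrightarrow> \<exists>b\<in>elts k. \<forall>x\<in>elts X. app m x \<in> elts b"
    "l = k \<or> omega \<sqsubseteq> l"
proof -
  have ok: "Ord k" and kw: "omega \<sqsubseteq> k" using k by (auto simp: Card_def)
  obtain f where "func f k k" "\<And>x. x \<in> elts k \<Longrightarrow> app f x = x"
    by (rule lam_exists[of "\<lambda>x. x" k k]) (auto intro: def_intros)
  then have "\<exists>g. cofinal k k g" unfolding cofinal_def by fastforce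
  moreover have "Def (\<lambda>e. \<exists>g. cofinal k (e 0) g)" unfolding cofinal_def by (intro def_intros)
  ultimately obtain l where l: "Ord l" "\<exists>g. cofinal k l g"
      "\<And>a. a \<in> elts l \<Longrightarrow> \<not> (\<exists>g. cofinal k a g)" "l \<sqsubseteq> k"
    using Ord_minimal[of "\<lambda>l. \<exists>g. cofinal k l g" k, OF _ ok] by metis
  obtain g where g: "cofinal k l g" using l(2) by blast
  have bdd: "\<exists>b\<in>elts k. \<forall>x\<in>elts X. app m x \<in> elts b"
    if X: "\<exists>a\<in>elts l. X \<lesssim> a" and m: "func m X k" for X m
  proof -
    obtain a f where a: "a \<in> elts l" and f: "func f X a" "inj_on (app f) (elts X)"
      using X by (meson lepollE)
    \<comment> \<open>The map \<open>m\<close> is transported along \<open>f\<close> to the ordinal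
      \<open>a\<close>, with value \<open>emptyset\<close> off the range of \<open>f\<close>, so
      that minimality of \<open>l\<close> applies.\<close>
    let ?Q = "\<lambda>j y. (\<exists>x\<in>elts X. j = app f x \<and> y = app m x) \<or>
      \<not> (\<exists>x\<in>elts X. j = app f x) \<and> y = emptyset"
    have "Def (\<lambda>e. ?Q (e 0) (e 1))" by (intro def_intros)
    then obtain q where q: "func q a k" "\<And>j. j \<in> elts a \<Longrightarrow> ?Q j (app q j)"
    proof (rule func_exists[of ?Q a k])
      show "\<exists>!y. ?Q j y" for j using f(2) unfolding inj_on_def by metis
      show "y \<in> elts k" if "?Q j y" for j y
        using that func_app[OF m] kw emptyset_in_omega by blast
    qed blast
    have "\<not> cofinal k a q" using l(3)[OF a] by blast
    then obtain b where b: "b \<in> elts k" "\<And>j. j \<in> elts a \<Longrightarrow> \<not> b \<sqsubseteq> app q j"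
      using q(1) unfolding cofinal_def by blast
    have "app m x \<in> elts b" if x: "x \<in> elts X" for x
    proof -
      have fx: "app f x \<in> elts a" using func_app[OF f(1) x] .
      have "app q (app f x) = app m x" using q(2)[OF fx] x f(2) by (metis inj_onD)
      then have "\<not> b \<sqsubseteq> app m x" using b(2)[OF fx] by simp
      then show ?thesis
        using Ord_not_mem Ord_mem[OF ok b(1)] Ord_mem[OF ok func_app[OF m x]] by blast
    qed
    then show ?thesis using b(1) by blast
  qed
  \<comment> \<open>If \<open>a\<close> were the last index, the values of \<open>g\<close> before
    it would have a bound \<open>b\<close> below \<open>k\<close>, and the successor of the maximum
    of \<open>b\<close> and \<open>app g a\<close> would be missed.\<close>
  have not_suc: "l \<noteq> suc a" for a
  proof
    assume la: "l = suc a"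
    have gf: "func g l k" using g by (simp add: cofinal_def)
    have "func (restr g a) a k" by (rule func_restr[OF gf]) (auto simp: la)
    moreover have "\<exists>c\<in>elts l. a \<lesssim> c" using la by auto
    ultimately obtain b where b: "b \<in> elts k" "\<forall>x\<in>elts a. app (restr g a) x \<in> elts b"
      using bdd by blast
    let ?c = "suc (un b (app g a))"
    have ga: "app g a \<in> elts k" using func_app[OF gf] la by simp
    have "?c \<in> elts k" using Card_suc[OF k] Ord_un_mem[OF ok b(1) ga] by blast
    then obtain i where i: "i \<in> elts l" "?c \<sqsubseteq> app g i"
      using g unfolding cofinal_def by blast
    have gi: "Ord (app g i)" using Ord_mem[OF ok func_app[OF gf i(1)]] .
    show False
    proof (cases "i = a")
      case True
      then have "un b (app g a) \<in> elts (un b (app g a))" using i(2) by auto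
      then show False using not_mem_self by blast
    next
      case False
      then have ia: "i \<in> elts a" using i(1) la by simp
      have "a \<sqsubseteq> l" unfolding la elts_suc by (rule subset_insertI)
      then have "app (restr g a) i = app g i" using app_restr[OF gf _ ia] by blast
      then have "app g i \<in> elts b" using b(2) ia by metis
      moreover have "b \<sqsubseteq> app g i" using i(2) by auto
      ultimately show False using not_mem_self by blast
    qed
  qed
  have "emptyset \<in> elts k" using kw emptyset_in_omega by blast
  then have "l \<noteq> emptyset" using g unfolding cofinal_def by auto
  then have "l \<notin> elts omega" using not_suc by (metis omega_cases)
  then have "omega \<sqsubseteq> l" using Ord_not_mem[OF l(1) Ord_omega] by blast
  moreover have "l \<in> elts k \<or> l = k" using l(4) Ord_subset_iff[OF l(1) ok] by blast
  ultimately show ?thesis using that[OF l(1) _ g bdd] by blast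
qed

lemma clique_of_small_nonneighbours:
  assumes k: "Card k"
    and IH: "\<And>c B. c \<in> elts k \<Longrightarrow> Card c \<Longrightarrow> B \<sqsubseteq> V \<Longrightarrow> c \<lesssim> B \<Longrightarrow>
      \<exists>C. C \<sqsubseteq> B \<and> clique E C \<and> c \<lesssim> C"
    and A: "A \<sqsubseteq> V" "k \<lesssim> A"
    and small_nonadj: "\<And>x. x \<in> elts A \<Longrightarrow> small k (inter A (slice (nonadj V E) x))"
  shows "\<exists>C. C \<sqsubseteq> A \<and> clique E C \<and> k \<lesssim> C"
proof -
  let ?N = "nonadj V E"
  have ok: "Ord k" and kw: "omega \<sqsubseteq> k" using k by (auto simp: Card_def)
  \<comment> \<open>Non-adjacency with targets restricted to \<open>A\<close>, so that a slice
    contains the non-neighbours inside \<open>A\<close> only.\<close>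
  define N where "N = inter ?N (product V A)"
  have N: "pair x z \<in> elts N \<longleftrightarrow> z \<in> elts A \<and> pair x z \<in> elts ?N" for x z
    unfolding N_def by (auto simp: pair_in_nonadj)
  have sN: "slice N x = inter A (slice ?N x)" for x
    by (rule extensionality) (auto simp: N)
  \<comment> \<open>The vertices with at most |a| non-neighbours in \<open>A\<close>. A small set
    inside a single \<open>L a\<close> has few non-neighbours in total, whatever the cofinality of
    \<open>k\<close>.\<close>
  define L where "L a = sep A (\<lambda>x. slice N x \<lesssim> a)" for a
  have L: "elts (L a) = {x \<in> elts A. slice N x \<lesssim> a}" for a
    unfolding L_def by (rule elts_sep) (intro def_intros)
  have L_mono: "L a \<sqsubseteq> L b" if "a \<sqsubseteq> b" for a b
    using subset_lepoll[OF that] lepoll_trans unfolding L by blast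
  have in_L: "\<exists>a\<in>elts k. x \<in> elts (L a)" if "x \<in> elts A" for x
    using small_nonadj[OF that] that unfolding small_def L sN by blast
  have small_nbhd: "small k Z"
    if T: "small k T" "a \<in> elts k" "T \<sqsubseteq> L a"
      and Z: "\<And>z. z \<in> elts Z \<Longrightarrow> z \<in> elts A \<and> (\<exists>x\<in>elts T. pair x z \<in> elts ?N)" for T a Z
  proof (rule small_UN[OF k T(1,2)])
    show "slice N x \<lesssim> a" if "x \<in> elts T" for x using that T(3) by (auto simp: L)
    show "\<exists>x\<in>elts T. pair x z \<in> elts N" if "z \<in> elts Z" for z using Z[OF that] N by blast
  qed
  \<comment> \<open>Maximality writes \<open>B\<close> as \<open>C\<close> together with
    non-neighbours of points of \<open>C\<close>; if \<open>C\<close> were small with a common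
    bound, both parts would be small.\<close>
  have max_clique: "k \<lesssim> C"
    if B: "B \<sqsubseteq> A" "k \<lesssim> B" and C: "C \<sqsubseteq> B"
      and max: "\<And>z. z \<in> elts B \<Longrightarrow> z \<in> elts C \<or> (\<exists>x\<in>elts C. pair x z \<in> elts ?N)"
      and bdd: "small k C \<Longrightarrow> \<exists>a\<in>elts k. C \<sqsubseteq> L a" for B C
  proof (rule ccontr)
    assume "\<not> k \<lesssim> C"
    then have sC: "small k C" using small_or_lepoll[OF k] by blast
    then obtain a where a: "a \<in> elts k" "C \<sqsubseteq> L a" using bdd by blast
    have "small k (diff B C)" by (rule small_nbhd[OF sC a]) (use max B(1) in auto)
    then have "small k (un C (diff B C))" using small_un[OF k sC] by blast
    then have "small k B" by (rule small_subset) auto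
    then show False using not_small[OF k B(2)] by blast
  qed
  show ?thesis
  proof (cases "\<exists>a\<in>elts k. k \<lesssim> L a")
    case True
    then obtain a where a: "a \<in> elts k" "k \<lesssim> L a" by blast
    have LA: "L a \<sqsubseteq> A" by (auto simp: L)
    then have "L a \<sqsubseteq> V" using A(1) by blast
    then obtain C where C: "C \<sqsubseteq> L a" "clique E C"
      "\<And>z. z \<in> elts (L a) \<Longrightarrow> z \<in> elts C \<or> (\<exists>x\<in>elts C. pair x z \<in> elts ?N)"
      by (rule maximal_clique) blast
    then have "k \<lesssim> C" using max_clique[OF LA a(2) C(1,3)] a(1) by blast
    then show ?thesis using C(1,2) LA by blast
  next
    case False
    then have smallL: "small k (L a)" if "a \<in> elts k" for a
      using that small_or_lepoll[OF k] by blast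
    obtain l g where l: "Ord l" "l \<in> elts k \<or> l = k" "cofinal k l g"
      and bdd: "\<And>X m. \<exists>a\<in>elts l. X \<lesssim> a \<Longrightarrow> func m X k \<Longrightarrow>
        \<exists>b\<in>elts k. \<forall>x\<in>elts X. app m x \<in> elts b"
      and lw: "l = k \<or> omega \<sqsubseteq> l"
      using k by (rule cofinality) blast
    have DL: "Def (\<lambda>e. e 0 \<in> elts A \<and> slice N (e 0) \<lesssim> e 1)" by (intro def_intros)
    show ?thesis
    proof (cases "l = k")
      case True
      obtain C where C: "C \<sqsubseteq> A" "clique E C"
        "\<And>z. z \<in> elts A \<Longrightarrow> z \<in> elts C \<or> (\<exists>x\<in>elts C. pair x z \<in> elts ?N)"
        using A(1) by (rule maximal_clique) blast
      have "\<exists>a\<in>elts k. C \<sqsubseteq> L a" if sC: "small k C"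
      proof -
        \<comment> \<open>Each vertex of \<open>C\<close> gets a bound below \<open>k\<close>; as
          \<open>l = k\<close>, these fewer than \<open>k\<close> bounds are bounded
          together.\<close>
        obtain m where m: "func m C k" "\<And>x. x \<in> elts C \<Longrightarrow> x \<in> elts A \<and> slice N x \<lesssim> app m x"
          by (rule ac_func[OF DL, of C k]) (use in_L C(1) in \<open>auto simp: L\<close>)
        obtain b where b: "b \<in> elts k" "\<forall>x\<in>elts C. app m x \<in> elts b"
          using bdd[OF _ m(1)] sC True unfolding small_def by blast
        have "x \<in> elts (L b)" if x: "x \<in> elts C" for x
          using L_mono[OF Ord_subset[OF Ord_mem[OF ok b(1)], of "app m x"]] m(2)[OF x] b(2) x
          by (auto simp: L)
        then show ?thesis using b(1) by blast
      qed
      then have "k \<lesssim> C" using max_clique[OF _ A(2) C(1,3)] by blast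
      then show ?thesis using C(1,2) by blast
    next
      case False
      then have lk: "l \<in> elts k" and lw: "omega \<sqsubseteq> l" using l(2) lw by auto
      have wk: "omega \<in> elts k"
        using lw lk Ord_subset_iff[OF Ord_omega l(1)] Ord_trans[OF ok lk] by auto
      have gf: "func g l k" using l(3) by (simp add: cofinal_def)
      have gk: "app g i \<in> elts k" if "i \<in> elts l" for i using func_app[OF gf that] .
      \<comment> \<open>Otherwise \<open>A\<close> would be covered by \<open>T\<close> and
        \<open>l\<close>, hence fewer than \<open>k\<close>, pieces of size at most
        \<open>c\<close>.\<close>
      have large: "\<exists>a\<in>elts k. c \<lesssim> diff (L a) T" if T: "small k T" and c: "c \<in> elts k" for T c
      proof (rule ccontr)
        assume contr: "\<not> (\<exists>a\<in>elts k. c \<lesssim> diff (L a) T)"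
        obtain r where r: "elts r = {p \<in> elts (product l A).
            slice N (psnd p) \<lesssim> app g (pfst p) \<and> psnd p \<notin> elts T}"
          by (erule sepE) (intro def_intros)
        have "small k (diff A T)"
        proof (rule small_UN[OF k small_mem[OF lk] c])
          fix i assume i: "i \<in> elts l"
          have "slice r i = diff (L (app g i)) T"
            by (rule extensionality) (use i in \<open>auto simp: r L\<close>)
          then show "slice r i \<lesssim> c" using contr gk[OF i] lepoll_linear by metis
        next
          fix z assume z: "z \<in> elts (diff A T)"
          then obtain a where a: "a \<in> elts k" "z \<in> elts (L a)" using in_L by auto
          then obtain i where i: "i \<in> elts l" "a \<sqsubseteq> app g i"
            using l(3) unfolding cofinal_def by blast
          then have "z \<in> elts (L (app g i))" using L_mono a(2) by blast
          then show "\<exists>i\<in>elts l. pair i z \<in> elts r" using i(1) z by (auto simp: r L)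
        qed
        then have "small k (un T (diff A T))" using small_un[OF k T] by blast
        then have "small k A" by (rule small_subset) auto
        then show False using not_small[OF k A(2)] by blast
      qed
      have extend: "\<exists>D. elts D \<subseteq> elts A - elts T \<and> clique E D \<and> a \<lesssim> D \<and> (\<exists>b\<in>elts k. D \<sqsubseteq> L b)"
        if T: "small k T" and a: "a \<in> elts k" for T a
      proof -
        \<comment> \<open>Joining \<open>omega\<close> makes the size infinite, so that the
          induction hypothesis applies to its cardinal.\<close>
        have a': "un a omega \<in> elts k" using Ord_un_mem[OF ok a wk] .
        have "\<not> Fin (un a omega)" using Fin_not_omega subset_lepoll[of omega "un a omega"] by auto
        then obtain c where c: "Card c" "c \<in> elts k" "un a omega \<approx> c"
          using Card_mem[OF k a'] by blast
        obtain b where b: "b \<in> elts k" "c \<lesssim> diff (L b) T" using large[OF T c(2)] by blast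
        have "(diff (L b) T) \<sqsubseteq> V" using A(1) by (auto simp: L)
        then obtain D where D: "D \<sqsubseteq> (diff (L b) T)" "clique E D" "c \<lesssim> D"
          using IH[OF c(2,1) _ b(2)] by blast
        have "a \<lesssim> un a omega" by (rule subset_lepoll) auto
        then have "a \<lesssim> D" using c(3) D(3) eqpoll_imp_lepoll lepoll_trans by blast
        then show ?thesis using D(1,2) b(1) by (intro exI[of _ D]) (auto simp: L)
      qed
      \<comment> \<open>The relation sees only the history \<open>h\<close>, so the current stage
        \<open>i\<close> is recovered as the domain of \<open>h\<close>. A bound \<open>b\<close> is
        demanded of each clique so that later stages can combine the bounds.\<close>
      define P where "P h D \<longleftrightarrow> D \<sqsubseteq> A \<and> clique E D \<and>
        (\<exists>b\<in>elts k. \<forall>x\<in>elts D. slice N x \<lesssim> b) \<and>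
        (\<forall>i\<in>elts l. (\<forall>j. (\<exists>D'. pair j D' \<in> elts h) \<longleftrightarrow> j \<in> elts i) \<longrightarrow> app g i \<lesssim> D) \<and>
        (\<forall>j D'. pair j D' \<in> elts h \<longrightarrow>
          (\<forall>x\<in>elts D'. \<forall>z\<in>elts D. pair x z \<notin> elts ?N))" for h D
      have DP: "Def (\<lambda>e. P (e 0) (e 1))" unfolding P_def clique_def by (intro def_intros)
      obtain f where f: "func f l (pow A)" "\<And>i. i \<in> elts l \<Longrightarrow> P (restr f i) (app f i)"
      proof (rule rec_choice[OF DP l(1), of "pow A"])
        fix i h assume i: "i \<in> elts l" and h: "func h i (pow A)"
          and P: "\<And>j. j \<in> elts i \<Longrightarrow> P (restr h j) (app h j)"
        have "Def (\<lambda>e. \<forall>x\<in>elts (app h (e 0)). slice N x \<lesssim> e 1)" by (intro def_intros)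
        then obtain m where m: "func m i k"
            "\<And>j. j \<in> elts i \<Longrightarrow> \<forall>x\<in>elts (app h j). slice N x \<lesssim> app m j"
          by (rule ac_func[where X = i and Y = k]) (use P in \<open>auto simp: P_def\<close>)
        \<comment> \<open>Fewer than \<open>l\<close> earlier cliques have a common bound
          \<open>b\<close> below \<open>k\<close>, by the choice of \<open>l\<close>.\<close>
        have "\<exists>a\<in>elts l. i \<lesssim> a" using i lepoll_refl by blast
        then obtain b where b: "b \<in> elts k" "\<forall>j\<in>elts i. app m j \<in> elts b"
          using bdd[OF _ m(1)] by blast
        obtain T where T: "elts T = {x \<in> elts A. \<exists>j\<in>elts i. x \<in> elts (app h j)}"
          by (erule sepE) (intro def_intros)
        have TL: "T \<sqsubseteq> L b"
        proof
          fix x assume "x \<in> elts T"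
          then obtain j where j: "x \<in> elts A" "j \<in> elts i" "x \<in> elts (app h j)" by (auto simp: T)
          have "app m j \<lesssim> b"
            by (rule subset_lepoll[OF Ord_subset[OF Ord_mem[OF ok b(1)]]]) (use b(2) j(2) in blast)
          then show "x \<in> elts (L b)" using m(2)[OF j(2)] j lepoll_trans by (auto simp: L)
        qed
        \<comment> \<open>In this case every \<open>L b\<close> is small, hence so is the union
          \<open>T\<close> of the earlier cliques.\<close>
        have sT: "small k T" by (rule small_subset[OF smallL[OF b(1)] TL])
        obtain Z where Z: "elts Z = {z \<in> elts A. \<exists>x\<in>elts T. pair x z \<in> elts ?N}"
          by (erule sepE) (intro def_intros)
        have "small k Z" by (rule small_nbhd[OF sT b(1) TL]) (simp add: Z)
        then obtain D where D: "elts D \<subseteq> elts A - elts Z" "clique E D" "app g i \<lesssim> D"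
            "\<exists>b\<in>elts k. D \<sqsubseteq> L b"
          using extend[OF _ gk[OF i]] by blast
        have hi: "(\<exists>D'. pair j D' \<in> elts h) \<longleftrightarrow> j \<in> elts i" for j
          using func_pair_iff[OF h] by auto
        have "app g i' \<lesssim> D" if "\<forall>j. (\<exists>D'. pair j D' \<in> elts h) \<longleftrightarrow> j \<in> elts i'" for i'
        proof -
          have "i' = i" by (rule extensionality) (use that hi in blast)
          then show ?thesis using D(3) by simp
        qed
        moreover have "pair x z \<notin> elts ?N"
          if "pair j D' \<in> elts h" "x \<in> elts D'" "z \<in> elts D" for j D' x z
        proof -
          have "j \<in> elts i" "D' = app h j" using func_pair_iff[OF h] that(1) by auto
          then have "x \<in> elts T" using func_app[OF h, of j] that(2) by (auto simp: T)
          then show ?thesis using D(1) that(3) by (auto simp: Z)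
        qed
        moreover have "\<exists>b\<in>elts k. \<forall>x\<in>elts D. slice N x \<lesssim> b" using D(4) unfolding L by blast
        ultimately have "P h D" unfolding P_def using D(1,2) by blast
        then show "\<exists>D\<in>elts (pow A). P h D" using D(1) by (intro bexI[of _ D]) auto
      qed blast
      have fA: "app f i \<sqsubseteq> A" if "i \<in> elts l" for i using func_app[OF f(1) that] by simp
      have later: "pair x z \<notin> elts ?N"
        if "i \<in> elts l" "j \<in> elts i" "x \<in> elts (app f j)" "z \<in> elts (app f i)" for i j x z
        using f(2)[OF that(1)] restr_earlier[OF f(1) l(1) that(1,2)] that(3,4)
        unfolding P_def by blast
      have size: "app g i \<lesssim> app f i" if i: "i \<in> elts l" for i
      proof -
        have "(\<exists>D'. pair j D' \<in> elts (restr f i)) \<longleftrightarrow> j \<in> elts i" for j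
          using func_pair_iff[OF f(1)] Ord_trans[OF l(1) i] by auto
        then show ?thesis using f(2)[OF i] i unfolding P_def by blast
      qed
      obtain H where H: "elts H = {x \<in> elts A. \<exists>i\<in>elts l. x \<in> elts (app f i)}"
        by (erule sepE) (intro def_intros)
      have "clique E H" unfolding clique_def
      proof (intro ballI impI)
        fix x y assume x: "x \<in> elts H" and y: "y \<in> elts H" and xy: "x \<noteq> y"
        obtain i j where ij: "i \<in> elts l" "x \<in> elts (app f i)" "j \<in> elts l" "y \<in> elts (app f j)"
          using x y by (auto simp: H)
        show "upair x y \<in> elts E"
        proof (cases "i = j")
          case True
          have "clique E (app f i)" using f(2)[OF ij(1)] by (simp add: P_def)
          then show ?thesis using ij xy True unfolding clique_def by blast
        next
          case False
          then have "i \<in> elts j \<or> j \<in> elts i"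
            using Ord_linear[OF Ord_mem[OF l(1) ij(1)] Ord_mem[OF l(1) ij(3)]] by blast
          then have "pair x y \<notin> elts ?N"
            using later[OF ij(3) _ ij(2,4)] later[OF ij(1) _ ij(4,2)] nonadj_sym by blast
          then show ?thesis using xy x y A(1) unfolding pair_in_nonadj H by blast
        qed
      qed
      moreover have "k \<lesssim> H"
      proof (rule ccontr)
        assume "\<not> k \<lesssim> H"
        then obtain a where a: "a \<in> elts k" "H \<lesssim> a"
          using small_or_lepoll[OF k] unfolding small_def by blast
        \<comment> \<open>Each \<open>app g i\<close> would embed in \<open>a\<close>, and
          \<open>k\<close>, being the union of these fewer than \<open>k\<close> sets, would be
          small.\<close>
        obtain r where r: "elts r = {p \<in> elts (product l k). psnd p \<in> elts (app g (pfst p))}"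
          by (erule sepE) (intro def_intros)
        have "small k k"
        proof (rule small_UN[OF k small_mem[OF lk] a(1)])
          fix i assume i: "i \<in> elts l"
          have "slice r i \<lesssim> app g i" by (rule subset_lepoll) (auto simp: r)
          moreover have "app f i \<lesssim> H" by (rule subset_lepoll) (use i fA in \<open>auto simp: H\<close>)
          ultimately show "slice r i \<lesssim> a" using size[OF i] a(2) lepoll_trans by blast
        next
          fix z assume z: "z \<in> elts k"
          then obtain i where "i \<in> elts l" "suc z \<sqsubseteq> app g i"
            using l(3) Card_suc[OF k z] unfolding cofinal_def by blast
          then show "\<exists>i\<in>elts l. pair i z \<in> elts r" using z by (auto simp: r)
        qed
        then show False using not_small[OF k lepoll_refl] by blast
      qed
      moreover have "H \<sqsubseteq> A" by (auto simp: H)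
      ultimately show ?thesis by blast
    qed
  qed
qed

text \<open>The induction on \<open>k\<close> keeps \<open>V\<close> fixed but varies
  \<open>B\<close>, because the singular case applies the hypothesis inside sets of the form
  \<open>diff (L b) T\<close>.\<close>

theorem dushnik_miller:
  assumes noind: "\<And>I. I \<sqsubseteq> V \<Longrightarrow> independent E I \<Longrightarrow> \<not> omega \<lesssim> I"
    and k: "Card k" and B: "B \<sqsubseteq> V" "k \<lesssim> B"
  shows "\<exists>C. C \<sqsubseteq> B \<and> clique E C \<and> k \<lesssim> C"
proof -
  have "Def (\<lambda>e. Card (e 0) \<longrightarrow> (\<forall>B. B \<sqsubseteq> V \<and> e 0 \<lesssim> B \<longrightarrow>
      (\<exists>C. C \<sqsubseteq> B \<and> clique E C \<and> e 0 \<lesssim> C)))"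
    unfolding clique_def by (intro def_intros)
  moreover have "Ord k" using k by (simp add: Card_def)
  ultimately have "Card k \<longrightarrow> (\<forall>B. B \<sqsubseteq> V \<and> k \<lesssim> B \<longrightarrow>
      (\<exists>C. C \<sqsubseteq> B \<and> clique E C \<and> k \<lesssim> C))"
  proof (induction rule: Ord_induct)
    case (step k)
    show ?case
    proof (intro impI allI, elim conjE)
      fix B assume k: "Card k" and B: "B \<sqsubseteq> V" "k \<lesssim> B"
      obtain A where A: "A \<sqsubseteq> B" "k \<lesssim> A"
        "\<And>x. x \<in> elts A \<Longrightarrow> small k (inter A (slice (nonadj V E) x))"
        using large_set_with_small_nonneighbours[OF k B noind] by blast
      have "\<exists>C. C \<sqsubseteq> A \<and> clique E C \<and> k \<lesssim> C"
        by (rule clique_of_small_nonneighbours[OF k _ _ A(2,3)]) (use step.IH A(1) B(1) in blast)+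
      then show "\<exists>C. C \<sqsubseteq> B \<and> clique E C \<and> k \<lesssim> C" using A(1) by blast
    qed
  qed
  then show ?thesis using k B by blast
qed

lemma edm_DM: "edm (\<lambda>I. omega \<lesssim> I) (\<lambda>C V. C \<approx> V)"
  unfolding edm_def
proof (intro allI impI, elim conjE)
  fix V E assume V: "\<not> V \<lesssim> omega"
  have "\<not> Fin V" using V omega_transitive subset_lepoll lepoll_trans unfolding Fin_def by blast
  then obtain k where k: "Card k" "V \<approx> k" by (rule Card_exists)
  have kV: "k \<lesssim> V" using k(2) eqpoll_sym eqpoll_imp_lepoll by blast
  show "(\<exists>I. I \<sqsubseteq> V \<and> independent E I \<and> omega \<lesssim> I) \<or>
      (\<exists>C. C \<sqsubseteq> V \<and> clique E C \<and> C \<approx> V)"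
  proof (rule disjCI)
    assume n: "\<not> (\<exists>C. C \<sqsubseteq> V \<and> clique E C \<and> C \<approx> V)"
    show "\<exists>I. I \<sqsubseteq> V \<and> independent E I \<and> omega \<lesssim> I"
    proof (rule ccontr)
      assume "\<not> (\<exists>I. I \<sqsubseteq> V \<and> independent E I \<and> omega \<lesssim> I)"
      then obtain C where C: "C \<sqsubseteq> V" "clique E C" "k \<lesssim> C"
        using dushnik_miller[OF _ k(1) subset_refl kV, of E] by blast
      have "V \<lesssim> C" using k(2) C(3) eqpoll_imp_lepoll lepoll_trans by blast
      then have "C \<approx> V" using schroeder_bernstein subset_lepoll[OF C(1)] by blast
      then show False using n C by blast
    qed
  qed
qed

end


section \<open>The implications in an arbitrary model\<close>

context zf_model
begin

lemma holds_EDM_DM_iff_AC: "holds mem l 0 (EDM_DM \<^bold>\<longleftrightarrow> AC)"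
proof -
  have "edm (\<lambda>I. omega \<lesssim> I) (\<lambda>C V. C \<approx> V)"
    if "\<forall>X. (\<forall>x\<in>elts X. x \<noteq> emptyset) \<longrightarrow> choice X"
  proof -
    interpret zfc_model mem by unfold_locales (use that in blast)
    show ?thesis by (rule edm_DM)
  qed
  then show ?thesis using edm_DM_imp_choice by (auto simp: EDM_DM_iff AC_iff)
qed

lemma holds_EDM_BG_imp_EDM_T: "holds mem l 0 (EDM_BG \<^bold>\<longrightarrow> EDM_T)"
  using edm_BG_imp_T by (simp add: EDM_BG_iff EDM_T_iff)

lemma holds_EDM_T_imp_PC_greater: "holds mem l 0 (EDM_T \<^bold>\<longrightarrow> PC_greater)"
  using edm_T_imp_PC_greater by (simp add: EDM_T_iff PC_greater_iff)

lemma holds_EDM_BG_imp_PC_not_le: "holds mem l 0 (EDM_BG \<^bold>\<longrightarrow> PC_not_le)"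
  using edm_BG_imp_PC_not_le by (simp add: EDM_BG_iff PC_not_le_iff)

lemma holds_PC_not_le_imp_PC_greater: "holds mem l 0 (PC_not_le \<^bold>\<longrightarrow> PC_greater)"
  using not_lepoll_omega_iff by (simp add: PC_not_le_iff PC_greater_iff)

end


section \<open>From models to derivations\<close>

lemma fv_below_All_funpow: "fv_below 0 ((All ^^ n) p) \<longleftrightarrow> fv_below n p"
proof -
  have "fv_below m ((All ^^ n) p) \<longleftrightarrow> fv_below (m + n) p" for m
    by (induction n arbitrary: m) auto
  then show ?thesis by simp
qed

lemma fv_below_ren: "fv_below n p \<Longrightarrow> (\<And>i. i < n \<Longrightarrow> f i < m) \<Longrightarrow> fv_below m (ren f p)"
proof (induction p arbitrary: n m f)
  case (Imp p q)
  then show ?case by (metis fv_below.simps(4) ren.simps(4))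
next
  case (All p)
  have "fv_below (Suc m) (ren (case_nat 0 (\<lambda>i. Suc (f i))) p)"
    using All.prems by (intro All.IH[of "Suc n"]) (auto split: nat.splits)
  then show ?case by simp
qed auto

lemmas form_defs = fmem_def feq_def fimp_def fnot_def fall_def fconj_def fdisj_def fiff_def fex_def

lemmas vocabulary_defs = is_subset_def is_empty_def is_upair_def is_pair_def is_succ_def
  is_inductive_def is_omega_def maps_def is_fun_def is_inj_def is_bij_def card_le_def card_eq_def
  card_less_def card_le_aleph0_def card_ge_aleph0_def card_less_aleph0_def
  card_greater_aleph0_def has_choice_function_def

lemma fv_below_schematic:
  "fv_below m p \<Longrightarrow> (\<And>i. i < m \<Longrightarrow> v i < d) \<Longrightarrow> fv_below d (schematic p v d)"
  unfolding schematic_def by (rule fv_below_ren) (use gr_implies_not_zero in fastforce)+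

lemma ZF_sentence: "p \<in> ZF \<Longrightarrow> fv_below 0 p"
proof -
  have "fv_below 0 (Separation n p)" if "fv_below (Suc n) p" for n p
    using fv_below_schematic[OF that, of "case_nat (Suc (Suc n)) (\<lambda>i. i)" "Suc (Suc (Suc n))"]
    by (simp add: Separation_def fv_below_All_funpow form_defs split: nat.splits)
  moreover have "fv_below 0 (Replacement n p)" if "fv_below (Suc (Suc n)) p" for n p
    using that
    by (auto simp: Replacement_def fv_below_All_funpow form_defs Let_def split: nat.splits
        intro!: fv_below_schematic[OF that])
  ultimately show "p \<in> ZF \<Longrightarrow> fv_below 0 p"
    by (auto simp: ZF_def Extensionality_def Foundation_def Pairing_def Union_axiom_def
        Power_set_def Infinity_def vocabulary_defs form_defs)
qed

text \<open>Pairing and Union give a \<open>u\<close> containing all of \<open>F\<close>. If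
  \<open>u\<close> were equal to some member of \<open>F\<close>, it would belong to itself, against
  Foundation. The argument precedes the quotient, so equality is only the congruence
  \<open>eq\<close>.\<close>

lemma infinitely_many_classes:
  assumes "finite (F :: 'a set)" and ZF: "\<And>p e. p \<in> ZF \<Longrightarrow> sat eq mem e p"
    and refl: "\<And>i. eq i i" and sym: "\<And>i j. eq i j \<Longrightarrow> eq j i"
    and cong: "\<And>i j i' j'. eq i i' \<Longrightarrow> eq j j' \<Longrightarrow> mem i j \<Longrightarrow> mem i' j'"
  shows "\<exists>i. \<forall>j\<in>F. \<not> eq i j"
proof -
  have "sat eq mem undefined (Pairing 0)" by (rule ZF) (simp add: ZF_def)
  then have pair: "\<exists>p. \<forall>z. mem z p \<longleftrightarrow> eq z x \<or> eq z y" for x y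
    by (auto simp: Pairing_def is_upair_def form_defs) metis
  have "sat eq mem undefined (Union_axiom 0)" by (rule ZF) (simp add: ZF_def)
  then have union: "\<exists>u. \<forall>z. mem z u \<longleftrightarrow> (\<exists>y. mem y x \<and> mem z y)" for x
    by (auto simp: Union_axiom_def form_defs) metis
  have "sat eq mem undefined (Foundation 0)" by (rule ZF) (simp add: ZF_def)
  then have found: "mem w x \<Longrightarrow> \<exists>y. mem y x \<and> \<not> (\<exists>z. mem z x \<and> mem z y)" for w x
    by (auto simp: Foundation_def is_empty_def form_defs)
  have irrefl: "\<not> mem i i" for i
  proof
    assume i: "mem i i"
    obtain p where p: "\<And>z. mem z p \<longleftrightarrow> eq z i" using pair[of i i] by blast
    obtain y where y: "mem y p" "\<And>z. mem z p \<Longrightarrow> \<not> mem z y" using found[of i p] p refl by blast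
    then have "mem i y" using p cong[OF refl sym i] by blast
    then show False using y(2)[of i] p refl by blast
  qed
  have "\<exists>u. \<forall>j\<in>F. mem j u" using \<open>finite F\<close>
  proof (induction rule: finite_induct)
    case (insert x F)
    then obtain u where u: "\<forall>j\<in>F. mem j u" by blast
    obtain s where s: "\<And>z. mem z s \<longleftrightarrow> eq z x" using pair[of x x] by blast
    obtain q where q: "\<And>z. mem z q \<longleftrightarrow> eq z u \<or> eq z s" using pair[of u s] by blast
    obtain v where v: "\<And>z. mem z v \<longleftrightarrow> (\<exists>y. mem y q \<and> mem z y)" using union[of q] by blast
    have "\<forall>j\<in>insert x F. mem j v" unfolding v q using u s refl by blast
    then show ?case by blast
  qed auto
  then obtain u where u: "\<forall>j\<in>F. mem j u" by blast
  have "\<not> eq u j" if "j \<in> F" for j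
    using u that irrefl[of u] cong[of j u u u] sym refl by blast
  then show ?thesis by blast
qed

lemma ZF_provesI:
  assumes sentence: "fv_below 0 (A 0)"
    and valid: "\<And>mem :: nat \<Rightarrow> nat \<Rightarrow> bool. zf_model mem \<Longrightarrow> holds mem undefined 0 A"
  shows "ZF_proves A"
  unfolding ZF_proves_def
proof (rule completeness[OF ZF_sentence sentence])
  fix mem :: "nat \<Rightarrow> nat \<Rightarrow> bool" and e :: "nat \<Rightarrow> nat"
  assume "\<And>p e. p \<in> ZF \<Longrightarrow> sat (=) mem e p"
  then have m: "zf_model mem" by unfold_locales
  have "sat (=) mem (levels undefined 0) (A 0)" using valid[OF m] by (simp add: holds_def)
  then show "sat (=) mem e (A 0)" using sat_cong[OF sentence] by blast
next
  fix eq mem :: "nat \<Rightarrow> nat \<Rightarrow> bool" and F :: "nat set"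
  assume "finite F" "\<And>p e. p \<in> ZF \<Longrightarrow> sat eq mem e p" "\<And>i. eq i i" "\<And>i j. eq i j \<Longrightarrow> eq j i"
    "\<And>i j i' j'. eq i i' \<Longrightarrow> eq j j' \<Longrightarrow> mem i j \<Longrightarrow> mem i' j'"
  then show "\<exists>i. \<forall>j\<in>F. \<not> eq i j" by (rule infinitely_many_classes)
qed

lemmas principle_defs = AC_def EDM_DM_def EDM_BG_def EDM_T_def PC_greater_def PC_not_le_def
  nonempty_finite_family_def is_graph_def adjacent_def is_independent_def is_subgraph_def
  is_clique_def

lemma principle_sentences:
  "fv_below 0 (AC 0)" "fv_below 0 (EDM_DM 0)" "fv_below 0 (EDM_BG 0)" "fv_below 0 (EDM_T 0)"
  "fv_below 0 (PC_greater 0)" "fv_below 0 (PC_not_le 0)"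
  by (simp_all add: principle_defs vocabulary_defs form_defs)

lemma sentence_fimp: "fv_below 0 (A 0) \<Longrightarrow> fv_below 0 (B 0) \<Longrightarrow> fv_below 0 ((A \<^bold>\<longrightarrow> B) 0)"
  and sentence_fiff: "fv_below 0 (A 0) \<Longrightarrow> fv_below 0 (B 0) \<Longrightarrow> fv_below 0 ((A \<^bold>\<longleftrightarrow> B) 0)"
  by (simp_all add: form_defs)

theorem proposition5p5:
  "ZF_proves (EDM_DM \<^bold>\<longleftrightarrow> AC) \<and>
   (ZF_proves (EDM_BG \<^bold>\<longrightarrow> EDM_T) \<and> ZF_proves (EDM_T \<^bold>\<longrightarrow> PC_greater)) \<and>
   (ZF_proves (EDM_BG \<^bold>\<longrightarrow> PC_not_le) \<and> ZF_proves (PC_not_le \<^bold>\<longrightarrow> PC_greater))"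
  by (intro conjI ZF_provesI sentence_fiff sentence_fimp principle_sentences
      zf_model.holds_EDM_DM_iff_AC zf_model.holds_EDM_BG_imp_EDM_T
      zf_model.holds_EDM_T_imp_PC_greater zf_model.holds_EDM_BG_imp_PC_not_le
      zf_model.holds_PC_not_le_imp_PC_greater)

end
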